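(* Fix constants $0<\alpha<\frac12$, $M_1>1$, $M_2>0$, $\bar c\ge1$, $C_q>0$. There is a (small) constant $c_*>0$, depending only on these fixed constants, such that the following holds as $n,p\to\infty$ for $k=k_{n,p}\ge1$ with $k\le c_*\frac{n}{\log p}$ and $\xi=\xi_{n,p}\in\Xi(q,\bar c)$ with $1\le q\le C_qk$. The confidence interval $\mathrm{CI}^S_\alpha(\xi^{\intercal}\beta,Z)$ defined in the context satisfies $$\liminf_{n,p\to\infty}\ \inf_{\theta\in\Theta(k)}\mathbb{P}_\theta\big(\xi^{\intercal}\beta\in \mathrm{CI}^S_\alpha(\xi^{\intercal}\beta,Z)\big)\ \ge\ 1-\alpha ,$$ and, for some constant $C>0$ and all sufficiently large $n,p$, $$\sup_{\theta\in\Theta(k)}\mathbb{E}_\theta L\big(\mathrm{CI}^S_\alpha(\xi^{\intercal}\beta,Z)\big)\ \le\ C\,\|\xi\|_2\Big(k\frac{\log p}{n}+\frac1{\sqrt n}\Big).$$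
   Context: Model: one observes $Z=(Z_1,\dots,Z_n)$ with $Z_i=(y_i,X_{i\cdot})\in\mathbb{R}^{p+1}$, $y=X\beta+\epsilon$, where $X\in\mathbb{R}^{n\times p}$ has i.i.d. rows $X_{i\cdot}\sim N_p(0,\Sigma)$, independent of $\epsilon\sim N_n(0,\sigma^2 \mathrm{I})$; $\Omega=\Sigma^{-1}$, $\theta=(\beta,\Omega,\sigma)$. $X_{\cdot j}$ is the $j$-th column of $X$; $\max\|X_{\cdot j}\|_2$, $\min\|X_{\cdot j}\|_2$ are over $1\le j\le p$. $L([l,u])=u-l$ is the length of an interval. $z_{\alpha/2}$ is the upper $\alpha/2$ quantile of $N(0,1)$. $\Theta(k)=\{(\beta,\Omega,\sigma):\|\beta\|_0\le k,\ \frac1{M_1}\le\lambda_{\min}(\Omega)\le\lambda_{\max}(\Omega)\le M_1,\ 0<\sigma\le M_2\}$, and $\Xi(q,\bar c)=\{\xi\in\mathbb{R}^p:\|\xi\|_0=q,\ \xi\ne0,\ \max_{j\in\mathrm{supp}(\xi)}|\xi_j|\le\bar c\min_{j\in\mathrm{supp}(\xi)}|\xi_j|\}$. Construction of the interval. Scaled Lasso with $\lambda_0=\sqrt{2.05\log p/n}$: $$\{\widehat\beta,\hat\sigma\}=\arg\min_{\beta\in\mathbb{R}^p,\sigma\in\mathbb{R}^+}\frac{\|y-X\beta\|_2^2}{2n\sigma}+\frac\sigma2+\lambda_0\sum_{j=1}^p\frac{\|X_{\cdot j}\|_2}{\sqrt n}|\beta_j| .$$ With $\widehat\Sigma=\frac1nX^{\intercal}X$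 and $\lambda_n=12\|\xi\|_2M_1^2\sqrt{\log p/n}$, let $\widehat u=\arg\min_{u\in\mathbb{R}^p}\{u^{\intercal}\widehat\Sigma u:\ \|\widehat\Sigma u-\xi\|_\infty\le\lambda_n\}$ (if the constraint set is empty, take $\widehat u=0$), and $\widetilde\mu=\xi^{\intercal}\widehat\beta+\widehat u^{\intercal}\frac1nX^{\intercal}(y-X\widehat\beta)$. Restricted eigenvalue: $\kappa(X,k,\alpha_0)=\min_{J_0\subset\{1,\dots,p\},|J_0|\le k}\ \min_{\delta\ne0,\ \|\delta_{J_0^c}\|_1\le\alpha_0\|\delta_{J_0}\|_1}\frac{\|X\delta\|_2}{\sqrt n\|\delta_{J_0}\|_2}$. Let $$C_1(X,k)=7000M_1^2\frac{\sqrt n}{\min\|X_{\cdot j}\|_2}\max\Big\{1.25,\ \frac{912\max\|X_{\cdot j}\|_2^2}{n\,\kappa^2\big(X,k,405\frac{\max\|X_{\cdot j}\|_2}{\min\|X_{\cdot j}\|_2}\big)}\Big\},$$ $$\rho_1(k)=\|\xi\|_2\hat\sigma\min\Big\{1.01\sqrt{\tfrac{\widehat u^{\intercal}\widehat\Sigma\widehat u}{n\|\xi\|_2^2}}\,z_{\alpha/2}+C_1(X,k)\,k\tfrac{\log p}{n},\ \ \log p\big(\tfrac1{\sqrt n}+\tfrac{k\log p}{n}\big)\Big\}$$ (with $1/0=+\infty$). Finally $\mathrm{CI}^S_\alpha(\xi^{\intercal}\beta,Z)=[\widetilde\mu-\rho_1(k),\widetilde\mu+\rho_1(k)]$ on the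 event $\{\hat\sigma\le\log p\}$, and $\mathrm{CI}^S_\alpha(\xi^{\intercal}\beta,Z)=\{0\}$ otherwise. *)

theory Defs
  imports "HOL-Probability.Probability" "Jordan_Normal_Form.Spectral_Radius"
begin

unbundle no vec_syntax and no inner_syntax

hide_const (open) Finite_Cartesian_Product.vec Finite_Cartesian_Product.mat
  Finite_Cartesian_Product.row Finite_Cartesian_Product.column
  Finite_Cartesian_Product.transpose Determinants.det
hide_type (open) Finite_Cartesian_Product.vec

definition supp_vec :: "real vec \<Rightarrow> nat set" where
  "supp_vec v = {j. j < dim_vec v \<and> v $ j \<noteq> 0}"

definition norm_l0 :: "real vec \<Rightarrow> nat" where
  "norm_l0 v = card (supp_vec v)"

definition norm_l1 :: "real vec \<Rightarrow> real" where
  "norm_l1 v = (\<Sum>j<dim_vec v. \<bar>v $ j\<bar>)"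

definition norm_l2 :: "real vec \<Rightarrow> real" where
  "norm_l2 v = sqrt (v \<bullet> v)"

definition norm_linf :: "real vec \<Rightarrow> real" where
  "norm_linf v = (MAX j\<in>{..<dim_vec v}. \<bar>v $ j\<bar>)"

definition vec_restrict :: "real vec \<Rightarrow> nat set \<Rightarrow> real vec" where
  "vec_restrict v J = vec (dim_vec v) (\<lambda>j. if j \<in> J then v $ j else 0)"

definition min_col_norm :: "real mat \<Rightarrow> real" where
  "min_col_norm X = (MIN j\<in>{..<dim_col X}. norm_l2 (col X j))"

definition max_col_norm :: "real mat \<Rightarrow> real" where
  "max_col_norm X = (MAX j\<in>{..<dim_col X}. norm_l2 (col X j))"


text \<open>The parameter is \<open>\<theta> = (\<beta>, \<Omega>, \<sigma>)\<close>. A precision matrix is the inverse of a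
  covariance matrix, hence symmetric; its eigenvalues are then real, so that
  \<^const>\<open>spectrum\<close> over the reals contains all of them.\<close>

definition param_space ::
  "nat \<Rightarrow> nat \<Rightarrow> real \<Rightarrow> real \<Rightarrow> (real vec \<times> real mat \<times> real) set" where
  "param_space p k M1 M2 = {(\<beta>, \<Omega>, \<sigma>).
     \<beta> \<in> carrier_vec p \<and> norm_l0 \<beta> \<le> k \<and>
     \<Omega> \<in> carrier_mat p p \<and> transpose_mat \<Omega> = \<Omega> \<and>
     1 / M1 \<le> Min (spectrum \<Omega>) \<and> Min (spectrum \<Omega>) \<le> Max (spectrum \<Omega>) \<and>
     Max (spectrum \<Omega>) \<le> M1 \<and> 0 < \<sigma> \<and> \<sigma> \<le> M2}"

definition loading_space :: "nat \<Rightarrow> nat \<Rightarrow> real \<Rightarrow> real vec set" where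
  "loading_space p q cbar = {\<xi> \<in> carrier_vec p.
     norm_l0 \<xi> = q \<and> \<xi> \<noteq> 0\<^sub>v p \<and>
     (MAX j\<in>supp_vec \<xi>. \<bar>\<xi> $ j\<bar>) \<le> cbar * (MIN j\<in>supp_vec \<xi>. \<bar>\<xi> $ j\<bar>)}"


text \<open>A sample \<open>z = (y, x)\<close> is stored in coordinates, \<open>y i\<close> being the response and \<open>x i\<close> the
  covariate row of the \<open>i\<close>-th observation. This makes the product \<open>\<sigma>\<close>-algebras available;
  all computations are done with the corresponding vector and matrix.\<close>

type_synonym sample = "(nat \<Rightarrow> real) \<times> (nat \<Rightarrow> nat \<Rightarrow> real)"

definition response :: "nat \<Rightarrow> sample \<Rightarrow> real vec" where
  "response n z = vec n (fst z)"

definition design :: "nat \<Rightarrow> nat \<Rightarrow> sample \<Rightarrow> real mat" where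
  "design n p z = mat n p (\<lambda>(i, j). snd z i j)"

definition sample_space :: "nat \<Rightarrow> nat \<Rightarrow> sample measure" where
  "sample_space n p =
     (\<Pi>\<^sub>M i\<in>{..<n}. borel) \<Otimes>\<^sub>M (\<Pi>\<^sub>M i\<in>{..<n}. \<Pi>\<^sub>M j\<in>{..<p}. borel)"

text \<open>The non-degenerate centred Gaussian law \<open>N\<^sub>p(0, \<Sigma>)\<close>, for positive definite \<open>\<Sigma>\<close>.\<close>

definition mvn :: "nat \<Rightarrow> real mat \<Rightarrow> (nat \<Rightarrow> real) measure" where
  "mvn p \<Sigma> = density (\<Pi>\<^sub>M j\<in>{..<p}. lborel)
     (\<lambda>x. ennreal (exp (- (vec p x \<bullet> (the (mat_inverse \<Sigma>) *\<^sub>v vec p x)) / 2)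
                    / sqrt ((2 * pi) ^ p * det \<Sigma>)))"

definition sample_law :: "nat \<Rightarrow> nat \<Rightarrow> real vec \<times> real mat \<times> real \<Rightarrow> sample measure" where
  "sample_law n p = (\<lambda>(\<beta>, \<Omega>, \<sigma>).
     distr ((\<Pi>\<^sub>M i\<in>{..<n}. mvn p (the (mat_inverse \<Omega>))) \<Otimes>\<^sub>M mvn n (\<sigma>\<^sup>2 \<cdot>\<^sub>m 1\<^sub>m n))
       (sample_space n p)
       (\<lambda>(x, \<epsilon>). (\<lambda>i\<in>{..<n}. (mat n p (\<lambda>(i, j). x i j) *\<^sub>v \<beta> + vec n \<epsilon>) $ i, x)))"


definition scaled_lasso_objective ::
  "nat \<Rightarrow> nat \<Rightarrow> real vec \<Rightarrow> real mat \<Rightarrow> real vec \<times> real \<Rightarrow> real" where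
  "scaled_lasso_objective n p y X = (\<lambda>(b, s).
     (norm_l2 (y - X *\<^sub>v b))\<^sup>2 / (2 * real n * s) + s / 2
     + sqrt (2.05 * ln (real p) / real n)
       * (\<Sum>j<p. norm_l2 (col X j) / sqrt (real n) * \<bar>b $ j\<bar>))"

text \<open>The minimiser over \<open>\<sigma> > 0\<close> need not be unique, and need not exist (when the data are
  interpolated). A scaled Lasso estimator is any statistic with values in the parameter
  domain that is a minimiser whenever there is one.\<close>

definition scaled_lasso ::
  "nat \<Rightarrow> nat \<Rightarrow> (real vec \<Rightarrow> real mat \<Rightarrow> real vec) \<Rightarrow> (real vec \<Rightarrow> real mat \<Rightarrow> real) \<Rightarrow> bool" where
  "scaled_lasso n p bhat shat \<longleftrightarrow>
     (\<forall>j<p. (\<lambda>z. bhat (response n z) (design n p z) $ j) \<in> borel_measurable (sample_space n p)) \<and>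
     (\<lambda>z. shat (response n z) (design n p z)) \<in> borel_measurable (sample_space n p) \<and>
     (\<forall>y\<in>carrier_vec n. \<forall>X\<in>carrier_mat n p.
        let f = scaled_lasso_objective n p y X; D = (\<lambda>(b, s). b \<in> carrier_vec p \<and> s > 0)
        in D (bhat y X, shat y X) \<and>
           ((\<exists>a. is_arg_min f D a) \<longrightarrow> is_arg_min f D (bhat y X, shat y X)))"

definition sample_cov :: "nat \<Rightarrow> real mat \<Rightarrow> real mat" where
  "sample_cov n X = (1 / real n) \<cdot>\<^sub>m (transpose_mat X * X)"

definition projection_feasible :: "nat \<Rightarrow> nat \<Rightarrow> real \<Rightarrow> real vec \<Rightarrow> real mat \<Rightarrow> real vec set" where
  "projection_feasible n p M1 \<xi> X = {u \<in> carrier_vec p.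
     norm_linf (sample_cov n X *\<^sub>v u - \<xi>) \<le> 12 * norm_l2 \<xi> * M1\<^sup>2 * sqrt (ln (real p) / real n)}"

text \<open>The minimiser is not unique when the sample covariance is singular; any measurable
  selection qualifies.\<close>

definition projection_direction ::
  "nat \<Rightarrow> nat \<Rightarrow> real \<Rightarrow> real vec \<Rightarrow> (real mat \<Rightarrow> real vec) \<Rightarrow> bool" where
  "projection_direction n p M1 \<xi> uhat \<longleftrightarrow>
     (\<forall>j<p. (\<lambda>z. uhat (design n p z) $ j) \<in> borel_measurable (sample_space n p)) \<and>
     (\<forall>X\<in>carrier_mat n p.
        if projection_feasible n p M1 \<xi> X = {} then uhat X = 0\<^sub>v p
        else is_arg_min (\<lambda>u. u \<bullet> (sample_cov n X *\<^sub>v u))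
               (\<lambda>u. u \<in> projection_feasible n p M1 \<xi> X) (uhat X))"

definition debiased_estimate ::
  "nat \<Rightarrow> real vec \<Rightarrow> real vec \<Rightarrow> real mat \<Rightarrow> real vec \<Rightarrow> real vec \<Rightarrow> real" where
  "debiased_estimate n \<xi> y X b u =
     \<xi> \<bullet> b + u \<bullet> ((1 / real n) \<cdot>\<^sub>v (transpose_mat X *\<^sub>v (y - X *\<^sub>v b)))"

definition restricted_eigenvalue :: "nat \<Rightarrow> nat \<Rightarrow> real mat \<Rightarrow> nat \<Rightarrow> real \<Rightarrow> real" where
  "restricted_eigenvalue n p X k \<alpha>0 =
     Inf {norm_l2 (X *\<^sub>v \<delta>) / (sqrt (real n) * norm_l2 (vec_restrict \<delta> J)) | J \<delta>.
       J \<subseteq> {..<p} \<and> card J \<le> k \<and> \<delta> \<in> carrier_vec p \<and> \<delta> \<noteq> 0\<^sub>v p \<and>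
       norm_l1 (vec_restrict \<delta> ({..<p} - J)) \<le> \<alpha>0 * norm_l1 (vec_restrict \<delta> J)}"

text \<open>Division in \<^typ>\<open>ereal\<close> gives \<open>a / 0 = \<infinity>\<close> for \<open>a > 0\<close>. The real quotient of column norms
  inside is irrelevant if the least column norm vanishes: the outer factor is then infinite.\<close>

definition C1_const :: "real \<Rightarrow> nat \<Rightarrow> nat \<Rightarrow> real mat \<Rightarrow> nat \<Rightarrow> ereal" where
  "C1_const M1 n p X k =
     ereal (7000 * M1\<^sup>2 * sqrt (real n)) / ereal (min_col_norm X)
     * max (ereal 1.25)
         (ereal (912 * (max_col_norm X)\<^sup>2)
          / ereal (real n * (restricted_eigenvalue n p X k
                               (405 * (max_col_norm X / min_col_norm X)))\<^sup>2))"

definition normal_upper_quantile :: "real \<Rightarrow> real" where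
  "normal_upper_quantile a = (THE t. measure (density lborel std_normal_density) {t<..} = a)"

definition half_width ::
  "real \<Rightarrow> real \<Rightarrow> nat \<Rightarrow> nat \<Rightarrow> nat \<Rightarrow> real vec \<Rightarrow> real mat \<Rightarrow> real \<Rightarrow> real vec \<Rightarrow> real" where
  "half_width \<alpha> M1 n p k \<xi> X s u = norm_l2 \<xi> * s * real_of_ereal (min
     (ereal (1.01 * sqrt (u \<bullet> (sample_cov n X *\<^sub>v u) / (real n * (norm_l2 \<xi>)\<^sup>2))
               * normal_upper_quantile (\<alpha> / 2))
      + C1_const M1 n p X k * ereal (real k * ln (real p) / real n))
     (ereal (ln (real p) * (1 / sqrt (real n) + real k * ln (real p) / real n))))"

definition conf_int ::
  "real \<Rightarrow> real \<Rightarrow> nat \<Rightarrow> nat \<Rightarrow> nat \<Rightarrow> real vec \<Rightarrow> (real vec \<Rightarrow> real mat \<Rightarrow> real vec)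
   \<Rightarrow> (real vec \<Rightarrow> real mat \<Rightarrow> real) \<Rightarrow> (real mat \<Rightarrow> real vec) \<Rightarrow> sample \<Rightarrow> real set" where
  "conf_int \<alpha> M1 n p k \<xi> bhat shat uhat z =
     (let y = response n z; X = design n p z; b = bhat y X; s = shat y X; u = uhat X;
          \<mu> = debiased_estimate n \<xi> y X b u; \<rho> = half_width \<alpha> M1 n p k \<xi> X s u
      in if s \<le> ln (real p) then {\<mu> - \<rho>..\<mu> + \<rho>} else {0})"

definition interval_length :: "real set \<Rightarrow> real" where
  "interval_length I = Sup I - Inf I"

definition coverage_prob ::
  "nat \<Rightarrow> nat \<Rightarrow> real vec \<Rightarrow> (sample \<Rightarrow> real set) \<Rightarrow> real vec \<times> real mat \<times> real \<Rightarrow> real" where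
  "coverage_prob n p \<xi> CI \<theta> =
     measure (sample_law n p \<theta>) {z \<in> space (sample_law n p \<theta>). \<xi> \<bullet> fst \<theta> \<in> CI z}"

definition expected_length ::
  "nat \<Rightarrow> nat \<Rightarrow> (sample \<Rightarrow> real set) \<Rightarrow> real vec \<times> real mat \<times> real \<Rightarrow> ennreal" where
  "expected_length n p CI \<theta> = (\<integral>\<^sup>+ z. ennreal (interval_length (CI z)) \<partial>sample_law n p \<theta>)"


text \<open>The pairs \<open>(n, p)\<close> at which \<open>k\<close>, \<open>q\<close> and \<open>\<xi>\<close> satisfy the standing constraints. No choice
  of \<open>k \<ge> 1\<close> meets \<open>k \<le> c n / log p\<close> for all \<open>n\<close> and \<open>p\<close>, so the limit \<open>n, p \<rightarrow> \<infinity>\<close> is taken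
  along these pairs only. Since \<open>ln 0 = 0\<close> and \<open>x / 0 = 0\<close> here, they have \<open>n \<ge> 1\<close> and \<open>p \<ge> 2\<close>.\<close>

definition admissible ::
  "real \<Rightarrow> real \<Rightarrow> real \<Rightarrow> (nat \<Rightarrow> nat \<Rightarrow> nat) \<Rightarrow> (nat \<Rightarrow> nat \<Rightarrow> nat) \<Rightarrow> (nat \<Rightarrow> nat \<Rightarrow> real vec)
   \<Rightarrow> (nat \<times> nat) set" where
  "admissible c Cq cbar k q \<xi> = {(n, p).
     1 \<le> k n p \<and> real (k n p) \<le> c * real n / ln (real p) \<and>
     1 \<le> q n p \<and> real (q n p) \<le> Cq * real (k n p) \<and> \<xi> n p \<in> loading_space p (q n p) cbar}"

definition limit_along :: "(nat \<times> nat) set \<Rightarrow> (nat \<times> nat) filter" where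
  "limit_along A = inf (sequentially \<times>\<^sub>F sequentially) (principal A)"

end

theory Submission
  imports Defs "HOL-Real_Asymp.Real_Asymp"
begin

text \<open>
  The error of the debiased estimator is \<open>u\<^sup>T X\<^sup>T \<epsilon> / n\<close> plus the bias \<open>(\<xi> - \<Sigma>-hat u)\<^sup>T (\<beta>-hat - \<beta>)\<close>.
  Conditionally on the design the first term is exactly centred normal, and the bias is at most
  \<open>\<lambda>\<^sub>n \<parallel>\<beta>-hat - \<beta>\<parallel>\<^sub>1\<close>, which the deterministic analysis of the scaled Lasso (the square-root
  Lasso after minimisation over the scale) bounds by the second summand of the half width. On a good
  event the half width is of the stated order; off it the length is at most twice the rate times
  \<open>(log p)\<^sup>2\<close>, and the failure probability \<open>O(p powr (- 1 / 100))\<close> absorbs this factor.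

  The restricted eigenvalue is bounded below without nets or order statistics: by Maurey's empirical
  method a lower bound for the quadratic form on all sums of \<open>N\<close> signed unit vectors extends to
  every \<open>v\<close> at the price of a multiple of \<open>\<parallel>v\<parallel>\<^sub>1\<^sup>2 / N\<close>, and there are only \<open>(2 p) ^ N\<close> such sums.
  With \<open>N\<close> a large multiple of \<open>k\<close> this price is small on the cone, and the union bound costs a small
  multiple of \<open>n\<close> in the exponent because \<open>k log p \<le> c n\<close>.
\<close>

section \<open>Gaussian integrals\<close>

text \<open>The interval carries fixed numbers (12, 405, 912, 7000, 1.01), so bounds up to
  unspecified constants do not suffice: every estimate is explicit, and only \<open>c\<close> is
  free. A tiny \<open>c\<close> makes the second-order terms of the Lasso analysis negligible; the
  bias then costs about 5.7 million against the available \<open>7000 * 912\<close>.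

  The design enters only through squared norms of \<open>X t\<close> at finitely many fixed
  directions \<open>t\<close>, each a multiple of a chi-square variable. The Laplace transform is
  read off the Gaussian density itself, because tilting by a squared linear form changes the
  precision matrix by rank one; hence the determinants at the start. Even the feasibility of
  \<open>\<Omega>\<xi>\<close>, a bilinear statement, is reduced to such squares.

  The estimators are arbitrary measurable selections, and a scaled Lasso minimiser may fail to
  exist. Existence is proved on the good event, from a lower bound on the residuals of all
  competitors that do no worse than the true coefficients. Conditional normality survives because
  \<open>uhat\<close> depends on the design only.\<close>

definition quad_form :: "nat \<Rightarrow> (nat \<Rightarrow> nat \<Rightarrow> real) \<Rightarrow> (nat \<Rightarrow> real) \<Rightarrow> real" where
  "quad_form p A x = (\<Sum>i<p. \<Sum>j<p. A i j * x i * x j)"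

text \<open>Matrices and vectors are functions here, so that points of a product measure need no
  conversion and induction on the dimension is a restriction of indices.\<close>

definition pos_def :: "nat \<Rightarrow> (nat \<Rightarrow> nat \<Rightarrow> real) \<Rightarrow> bool" where
  "pos_def p A \<longleftrightarrow> (\<forall>i<p. \<forall>j<p. A i j = A j i) \<and> (\<forall>x. (\<exists>i<p. x i \<noteq> 0) \<longrightarrow> quad_form p A x > 0)"

section \<open>Determinants and the Gaussian integral\<close>

lemma sum_lessThan_delta:
  fixes f :: "nat \<Rightarrow> 'a::comm_semiring_1"
  assumes "j < p"
  shows "(\<Sum>k<p. f k * (if k = j then 1 else 0)) = f j"
    "(\<Sum>k<p. (if k = j then 1 else 0) * f k) = f j"
    "(\<Sum>k<p. f k * (if j = k then 1 else 0)) = f j"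
    "(\<Sum>k<p. (if j = k then 1 else 0) * f k) = f j"
  using assms by (simp_all add: if_distrib[where f="\<lambda>x. _ * x"] if_distrib[where f="\<lambda>x. x * _"] cong: if_cong)

text \<open>Multiplication from the right by the unit triangular block matrix with last row
  \<open>w\<close> clears the last row outside the corner. Both remaining determinants are then
  those of block triangular matrices.\<close>

lemma det_schur_complement:
  fixes A :: "nat \<Rightarrow> nat \<Rightarrow> real"
  assumes a: "A p p \<noteq> 0"
  shows "det (mat (Suc p) (Suc p) (\<lambda>(i, j). A i j)) =
    A p p * det (mat p p (\<lambda>(i, j). A i j - A i p * A p j / A p p))"
proof -
  define M where "M = mat (Suc p) (Suc p) (\<lambda>(i, j). A i j)"
  define B where "B = mat p p (\<lambda>(i, j). A i j)"
  define u where "u = mat p 1 (\<lambda>(i, j). A i p)"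
  define v where "v = mat 1 p (\<lambda>(i, j). A p j)"
  define d where "d = mat 1 1 (\<lambda>(i, j). A p p)"
  define w where "w = mat 1 p (\<lambda>(i, j). - A p j / A p p)"
  have M: "M = four_block_mat B u v d"
    by (rule eq_matI) (auto simp: M_def B_def u_def v_def d_def less_Suc_eq)
  have c: "B \<in> carrier_mat p p" "u \<in> carrier_mat p 1" "v \<in> carrier_mat 1 p" "d \<in> carrier_mat 1 1"
    "w \<in> carrier_mat 1 p"
    by (auto simp: B_def u_def v_def d_def w_def)
  have "M * four_block_mat (1\<^sub>m p) (0\<^sub>m p 1) w (1\<^sub>m 1) =
      four_block_mat (B * 1\<^sub>m p + u * w) (B * 0\<^sub>m p 1 + u * 1\<^sub>m 1) (v * 1\<^sub>m p + d * w) (v * 0\<^sub>m p 1 + d * 1\<^sub>m 1)"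
    unfolding M by (rule mult_four_block_mat) (use c in auto)
  also have "\<dots> = four_block_mat (mat p p (\<lambda>(i, j). A i j - A i p * A p j / A p p)) u (0\<^sub>m 1 p) d"
  proof (rule arg_cong4[where f=four_block_mat])
    show "B * 1\<^sub>m p + u * w = mat p p (\<lambda>(i, j). A i j - A i p * A p j / A p p)"
      using c by (intro eq_matI) (auto simp: B_def u_def w_def scalar_prod_def)
    show "B * 0\<^sub>m p 1 + u * 1\<^sub>m 1 = u" "v * 0\<^sub>m p 1 + d * 1\<^sub>m 1 = d"
      using c by auto
    show "v * 1\<^sub>m p + d * w = 0\<^sub>m 1 p"
      using c a by (intro eq_matI) (auto simp: v_def d_def w_def scalar_prod_def)
  qed
  finally have eq: "M * four_block_mat (1\<^sub>m p) (0\<^sub>m p 1) w (1\<^sub>m 1) =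
    four_block_mat (mat p p (\<lambda>(i, j). A i j - A i p * A p j / A p p)) u (0\<^sub>m 1 p) d" .
  have "det (M * four_block_mat (1\<^sub>m p) (0\<^sub>m p 1) w (1\<^sub>m 1)) = det M * det (four_block_mat (1\<^sub>m p) (0\<^sub>m p 1) w (1\<^sub>m 1))"
    by (rule det_mult[of _ "p + 1"]) (auto simp: M_def intro: four_block_carrier_mat)
  also have "det (four_block_mat (1\<^sub>m p) (0\<^sub>m p 1) w (1\<^sub>m 1)) = 1"
    by (subst det_four_block_mat_upper_right_zero[of _ p _ 1]) (use c in auto)
  also have "det (M * four_block_mat (1\<^sub>m p) (0\<^sub>m p 1) w (1\<^sub>m 1)) = A p p * det (mat p p (\<lambda>(i, j). A i j - A i p * A p j / A p p))"
    unfolding eq by (subst det_four_block_mat_lower_left_zero[of _ p _ 1]) (use c in \<open>auto simp: d_def det_single\<close>)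
  finally show ?thesis by (simp add: M_def)
qed

text \<open>Border the matrix \<open>A\<close> with the column \<open>u\<close>, the row
  \<open>- v\<close> and the corner 1, and compute the determinant of the result twice: eliminating
  with the corner produces \<open>A + u v^T\<close>, eliminating with \<open>A\<close>, whose
  inverse is \<open>B\<close>, produces \<open>det A\<close> times the scalar factor.\<close>

lemma det_rank_one_update:
  fixes A B :: "nat \<Rightarrow> nat \<Rightarrow> real"
  assumes inv: "\<And>i j. i < p \<Longrightarrow> j < p \<Longrightarrow> (\<Sum>k<p. A i k * B k j) = (if i = j then 1 else 0)"
  shows "det (mat p p (\<lambda>(i, j). A i j + u i * v j)) =
    det (mat p p (\<lambda>(i, j). A i j)) * (1 + (\<Sum>i<p. \<Sum>j<p. B i j * v i * u j))"
proof -
  define F where "F = (\<lambda>i j. if i < p then (if j < p then A i j else u i) else (if j < p then - v j else 1))"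
  define M where "M = mat (Suc p) (Suc p) (\<lambda>(i, j). F i j)"
  define A' where "A' = mat p p (\<lambda>(i, j). A i j)"
  define u' where "u' = mat p 1 (\<lambda>(i, j). u i)"
  define v' where "v' = mat 1 p (\<lambda>(i, j). - v j)"
  define w where "w = mat p 1 (\<lambda>(i, j). - (\<Sum>k<p. B i k * u k))"
  have M: "M = four_block_mat A' u' v' (1\<^sub>m 1)"
    by (rule eq_matI) (auto simp: M_def A'_def u'_def v'_def F_def less_Suc_eq)
  have c: "A' \<in> carrier_mat p p" "u' \<in> carrier_mat p 1" "v' \<in> carrier_mat 1 p" "w \<in> carrier_mat p 1"
    by (auto simp: A'_def u'_def v'_def w_def)
  define s where "s = mat 1 1 (\<lambda>(i, j). 1 + (\<Sum>i<p. \<Sum>j<p. B i j * v i * u j))"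
  have "M * four_block_mat (1\<^sub>m p) w (0\<^sub>m 1 p) (1\<^sub>m 1) =
      four_block_mat (A' * 1\<^sub>m p + u' * 0\<^sub>m 1 p) (A' * w + u' * 1\<^sub>m 1) (v' * 1\<^sub>m p + 1\<^sub>m 1 * 0\<^sub>m 1 p) (v' * w + 1\<^sub>m 1 * 1\<^sub>m 1)"
    unfolding M by (rule mult_four_block_mat) (use c in auto)
  also have "\<dots> = four_block_mat A' (0\<^sub>m p 1) v' s"
  proof (rule arg_cong4[where f=four_block_mat])
    show "A' * 1\<^sub>m p + u' * 0\<^sub>m 1 p = A'" "v' * 1\<^sub>m p + 1\<^sub>m 1 * 0\<^sub>m 1 p = v'"
      using c by auto
    have "(\<Sum>k<p. A i k * (\<Sum>l<p. B k l * u l)) = u i" if "i < p" for i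
    proof -
      have "(\<Sum>k<p. A i k * (\<Sum>l<p. B k l * u l)) = (\<Sum>l<p. (\<Sum>k<p. A i k * B k l) * u l)"
        unfolding sum_distrib_left sum_distrib_right by (subst sum.swap) (simp add: mult.assoc)
      also have "\<dots> = u i"
        using that by (simp add: inv sum_lessThan_delta)
      finally show ?thesis .
    qed
    then show "A' * w + u' * 1\<^sub>m 1 = 0\<^sub>m p 1"
      using c by (intro eq_matI)
        (auto simp: A'_def u'_def w_def scalar_prod_def lessThan_atLeast0 sum_negf)
    show "v' * w + 1\<^sub>m 1 * 1\<^sub>m 1 = s"
      using c by (intro eq_matI)
        (auto simp: v'_def s_def w_def scalar_prod_def lessThan_atLeast0 sum_distrib_left ac_simps sum_negf)
  qed
  finally have eq: "M * four_block_mat (1\<^sub>m p) w (0\<^sub>m 1 p) (1\<^sub>m 1) = four_block_mat A' (0\<^sub>m p 1) v' s" .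
  have "det (M * four_block_mat (1\<^sub>m p) w (0\<^sub>m 1 p) (1\<^sub>m 1)) = det M * det (four_block_mat (1\<^sub>m p) w (0\<^sub>m 1 p) (1\<^sub>m 1))"
    by (rule det_mult[of _ "p + 1"]) (auto simp: M_def intro: four_block_carrier_mat)
  also have "det (four_block_mat (1\<^sub>m p) w (0\<^sub>m 1 p) (1\<^sub>m 1)) = 1"
    by (subst det_four_block_mat_lower_left_zero[of _ p _ 1]) (use c in auto)
  also have "det (M * four_block_mat (1\<^sub>m p) w (0\<^sub>m 1 p) (1\<^sub>m 1)) = det A' * (1 + (\<Sum>i<p. \<Sum>j<p. B i j * v i * u j))"
    unfolding eq by (subst det_four_block_mat_upper_right_zero[of _ p _ 1]) (use c in \<open>auto simp: s_def det_single\<close>)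
  finally have 1: "det M = det A' * (1 + (\<Sum>i<p. \<Sum>j<p. B i j * v i * u j))" by simp
  have "det M = F p p * det (mat p p (\<lambda>(i, j). F i j - F i p * F p j / F p p))"
    unfolding M_def by (rule det_schur_complement) (simp add: F_def)
  also have "mat p p (\<lambda>(i, j). F i j - F i p * F p j / F p p) = mat p p (\<lambda>(i, j). A i j + u i * v j)"
    by (rule eq_matI) (auto simp: F_def)
  finally show ?thesis using 1 by (simp add: F_def A'_def)
qed

text \<open>Completing the square in the last coordinate leaves the form of the Schur complement.
  This is the algebra behind integrating out one coordinate of a Gaussian.\<close>

lemma quad_form_Suc:
  assumes a: "A p p \<noteq> 0" and sym: "\<And>i. i < p \<Longrightarrow> A i p = A p i"
  shows "quad_form (Suc p) A x = A p p * (x p + (\<Sum>i<p. A i p * x i) / A p p)\<^sup>2 +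
    quad_form p (\<lambda>i j. A i j - A i p * A p j / A p p) x"
proof -
  define s where "s = (\<Sum>i<p. A i p * x i)"
  have 1: "quad_form (Suc p) A x = quad_form p A x + 2 * x p * s + A p p * (x p)\<^sup>2"
  proof -
    have "(\<Sum>i<p. A p i * x p * x i) = x p * s" "(\<Sum>i<p. A i p * x i * x p) = x p * s"
      unfolding s_def sum_distrib_left by (auto intro!: sum.cong simp: sym)
    then show ?thesis
      by (simp add: quad_form_def sum.distrib power2_eq_square)
  qed
  have 2: "quad_form p (\<lambda>i j. A i j - A i p * A p j / A p p) x = quad_form p A x - s * s / A p p"
  proof -
    have "(\<Sum>i<p. \<Sum>j<p. A i p * A p j / A p p * x i * x j) = s * s / A p p"
      unfolding s_def sum_product sum_divide_distrib by (intro sum.cong) (auto simp: sym)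
    then show ?thesis
      by (simp add: quad_form_def sum_subtractf left_diff_distrib)
  qed
  have "A p p * (x p + s / A p p)\<^sup>2 = A p p * (x p)\<^sup>2 + 2 * x p * s + s * s / A p p"
    using a by (simp add: power2_eq_square field_simps)
  then show ?thesis unfolding 1 2 s_def by simp
qed

lemma quad_form_cong: "(\<And>i. i < p \<Longrightarrow> x i = y i) \<Longrightarrow> quad_form p A x = quad_form p A y"
  unfolding quad_form_def by (intro sum.cong) auto

lemma pos_def_Suc:
  assumes pd: "pos_def (Suc p) A"
  shows "A p p > 0" "pos_def p (\<lambda>i j. A i j - A i p * A p j / A p p)"
proof -
  have "quad_form (Suc p) A (\<lambda>i. if i = p then 1 else 0) > 0"
    using pd unfolding pos_def_def by auto
  also have "quad_form (Suc p) A (\<lambda>i. if i = p then 1 else 0) = A p p"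
    by (simp add: quad_form_def)
  finally show a: "A p p > 0" .
  have sym: "A i j = A j i" if "i < Suc p" "j < Suc p" for i j
    using pd that unfolding pos_def_def by blast
  show "pos_def p (\<lambda>i j. A i j - A i p * A p j / A p p)"
    unfolding pos_def_def
  proof (intro conjI allI impI)
    fix x :: "nat \<Rightarrow> real" assume x: "\<exists>i<p. x i \<noteq> 0"
    \<comment> \<open>The last coordinate is chosen so that the completed square vanishes; only the
      form of the Schur complement is left.\<close>
    define y where "y = (\<lambda>i. if i = p then - (\<Sum>i<p. A i p * x i) / A p p else x i)"
    have "\<exists>i<Suc p. y i \<noteq> 0"
      using x by (force simp: y_def)
    then have "quad_form (Suc p) A y > 0"
      using pd unfolding pos_def_def by blast
    also have "quad_form (Suc p) A y = quad_form p (\<lambda>i j. A i j - A i p * A p j / A p p) y"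
      using a by (subst quad_form_Suc) (auto simp: sym y_def)
    also have "\<dots> = quad_form p (\<lambda>i j. A i j - A i p * A p j / A p p) x"
      by (rule quad_form_cong) (simp add: y_def)
    finally show "quad_form p (\<lambda>i j. A i j - A i p * A p j / A p p) x > 0" .
  next
    fix i j assume "i < p" "j < p"
    then show "A i j - A i p * A p j / A p p = A j i - A j p * A p i / A p p"
      using sym[of i j] sym[of i p] sym[of j p] by simp
  qed
qed

lemma nn_integral_gaussian:
  assumes a: "a > (0::real)"
  shows "(\<integral>\<^sup>+ t. ennreal (exp (- (a * (t + c)\<^sup>2) / 2)) \<partial>lborel) = ennreal (sqrt (2 * pi / a))"
proof -
  have "prob_space (density lborel (normal_density (- c) (1 / sqrt a)))"
    using a by (intro prob_space_normal_density) auto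
  then have 1: "(\<integral>\<^sup>+ t. ennreal (normal_density (- c) (1 / sqrt a) t) \<partial>lborel) = 1"
    by (auto simp: emeasure_density dest!: prob_space.emeasure_space_1)
  have "(\<integral>\<^sup>+ t. ennreal (exp (- (a * (t + c)\<^sup>2) / 2)) \<partial>lborel) =
    (\<integral>\<^sup>+ t. ennreal (sqrt (2 * pi / a)) * ennreal (normal_density (- c) (1 / sqrt a) t) \<partial>lborel)"
    using a by (intro nn_integral_cong) (simp flip: ennreal_mult add: normal_density_def real_sqrt_divide power_divide divide_simps mult_ac)
  also have "\<dots> = ennreal (sqrt (2 * pi / a))"
    by (subst nn_integral_cmult) (simp_all add: 1)
  finally show ?thesis .
qed

lemma measurable_quad_form [measurable]:
  "(\<lambda>x. quad_form p A x) \<in> borel_measurable (\<Pi>\<^sub>M j\<in>{..<p}. lborel)"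
  unfolding quad_form_def by measurable

text \<open>Induction on the dimension: the innermost integral is a one-dimensional Gaussian whose
  centre depends on the other coordinates but whose value does not, and the Schur complement
  remains. Positivity of the determinant travels along, and is later the source of
  invertibility.\<close>

lemma gaussian_integral:
  assumes "pos_def p A"
  shows "det (mat p p (\<lambda>(i, j). A i j)) > 0 \<and>
    (\<integral>\<^sup>+ x. ennreal (exp (- quad_form p A x / 2)) \<partial>(\<Pi>\<^sub>M j\<in>{..<p}. lborel)) =
      ennreal (sqrt ((2 * pi) ^ p / det (mat p p (\<lambda>(i, j). A i j))))"
  using assms
proof (induction p arbitrary: A)
  case 0
  interpret product_sigma_finite "\<lambda>_::nat. lborel :: real measure" by standard
  show ?case by (simp add: quad_form_def nn_integral_empty PiM_empty emeasure_count_space)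
next
  case (Suc p)
  interpret product_sigma_finite "\<lambda>_::nat. lborel :: real measure" by standard
  define A' where "A' = (\<lambda>i j. A i j - A i p * A p j / A p p)"
  have a: "A p p > 0" and pd: "pos_def p A'"
    using pos_def_Suc[OF Suc.prems] by (auto simp: A'_def)
  have IH: "det (mat p p (\<lambda>(i, j). A' i j)) > 0"
    "(\<integral>\<^sup>+ x. ennreal (exp (- quad_form p A' x / 2)) \<partial>(\<Pi>\<^sub>M j\<in>{..<p}. lborel)) =
      ennreal (sqrt ((2 * pi) ^ p / det (mat p p (\<lambda>(i, j). A' i j))))"
    using Suc.IH[OF pd] by auto
  have det: "det (mat (Suc p) (Suc p) (\<lambda>(i, j). A i j)) = A p p * det (mat p p (\<lambda>(i, j). A' i j))"
    unfolding A'_def using a by (intro det_schur_complement) auto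
  have meas: "(\<lambda>x. ennreal (exp (- quad_form (Suc p) A x / 2))) \<in> borel_measurable (\<Pi>\<^sub>M j\<in>insert p {..<p}. lborel)"
    using measurable_quad_form[of "Suc p" A] unfolding lessThan_Suc by measurable
  have "(\<integral>\<^sup>+ x. ennreal (exp (- quad_form (Suc p) A x / 2)) \<partial>(\<Pi>\<^sub>M j\<in>{..<Suc p}. lborel)) =
    (\<integral>\<^sup>+ x. (\<integral>\<^sup>+ t. ennreal (exp (- quad_form (Suc p) A (x(p := t)) / 2)) \<partial>lborel) \<partial>(\<Pi>\<^sub>M j\<in>{..<p}. lborel))"
    unfolding lessThan_Suc by (rule product_nn_integral_insert) (use meas in auto)
  also have "\<dots> = (\<integral>\<^sup>+ x. ennreal (exp (- quad_form p A' x / 2)) * ennreal (sqrt (2 * pi / A p p)) \<partial>(\<Pi>\<^sub>M j\<in>{..<p}. lborel))"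
  proof (rule nn_integral_cong)
    fix x :: "nat \<Rightarrow> real"
    define c where "c = (\<Sum>i<p. A i p * x i) / A p p"
    have "quad_form (Suc p) A (x(p := t)) = A p p * (t + c)\<^sup>2 + quad_form p A' x" for t
    proof -
      have "quad_form (Suc p) A (x(p := t)) = A p p * (t + c)\<^sup>2 + quad_form p A' (x(p := t))"
        using a Suc.prems by (subst quad_form_Suc) (auto simp: c_def A'_def pos_def_def)
      then show ?thesis using quad_form_cong[of p "x(p := t)" x A'] by simp
    qed
    then have "ennreal (exp (- quad_form (Suc p) A (x(p := t)) / 2)) =
      ennreal (exp (- quad_form p A' x / 2)) * ennreal (exp (- (A p p * (t + c)\<^sup>2) / 2))" for t
      by (simp add: exp_add[symmetric] add_divide_distrib diff_divide_distrib flip: ennreal_mult)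
    then show "(\<integral>\<^sup>+ t. ennreal (exp (- quad_form (Suc p) A (x(p := t)) / 2)) \<partial>lborel) =
      ennreal (exp (- quad_form p A' x / 2)) * ennreal (sqrt (2 * pi / A p p))"
      using nn_integral_gaussian[OF a, of c] by (simp add: nn_integral_cmult)
  qed
  also have "\<dots> = ennreal (sqrt ((2 * pi) ^ p / det (mat p p (\<lambda>(i, j). A' i j)))) * ennreal (sqrt (2 * pi / A p p))"
    by (subst nn_integral_multc) (simp_all add: IH(2)[simplified])
  also have "\<dots> = ennreal (sqrt ((2 * pi) ^ Suc p / det (mat (Suc p) (Suc p) (\<lambda>(i, j). A i j))))"
    using a IH(1) by (simp add: det real_sqrt_mult[symmetric] mult_ac flip: ennreal_mult)
  finally show ?case using a IH(1) by (simp add: det)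
qed

section \<open>Extreme eigenvalues of symmetric matrices\<close>

lemma quad_form_alt: "quad_form p A x = (\<Sum>i<p. x i * (\<Sum>j<p. A i j * x j))"
  by (simp add: quad_form_def sum_distrib_left mult_ac)

lemma quad_form_add:
  assumes sym: "\<And>i j. i < p \<Longrightarrow> j < p \<Longrightarrow> A i j = A j i"
  shows "quad_form p A (\<lambda>i. x i + c * y i) =
    quad_form p A x + 2 * c * (\<Sum>i<p. x i * (\<Sum>j<p. A i j * y j)) + c\<^sup>2 * quad_form p A y"
proof -
  let ?B = "\<lambda>x y. \<Sum>i<p. \<Sum>j<p. A i j * x i * y j"
  have 1: "?B y x = ?B x y"
    by (subst sum.swap) (intro sum.cong, simp_all add: sym)
  have 2: "?B x y = (\<Sum>i<p. x i * (\<Sum>j<p. A i j * y j))"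
    unfolding sum_distrib_left by (intro sum.cong refl) simp
  have "quad_form p A (\<lambda>i. x i + c * y i) = (\<Sum>i<p. \<Sum>j<p.
      A i j * x i * x j + c * (A i j * y i * x j) + c * (A i j * x i * y j) + c\<^sup>2 * (A i j * y i * y j))"
    unfolding quad_form_def by (intro sum.cong refl) (simp add: algebra_simps power2_eq_square)
  also have "\<dots> = ?B x x + c * ?B y x + c * ?B x y + c\<^sup>2 * ?B y y"
    by (simp only: sum.distrib sum_distrib_left[symmetric])
  finally show ?thesis
    by (simp add: 1 quad_form_def flip: 2)
qed

text \<open>Pinning the coordinates from \<open>p\<close> on to zero lets Tychonoff's theorem apply
  to the space of all functions, so that extreme value arguments run without leaving the function
  type.\<close>

lemma compact_box_fun: "compact {x :: nat \<Rightarrow> real. (\<forall>i<p. \<bar>x i\<bar> \<le> R) \<and> (\<forall>i\<ge>p. x i = 0)}"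
proof -
  have "compactin (product_topology (\<lambda>_. euclidean) UNIV)
    (PiE UNIV (\<lambda>i. if i < p then {- R..R} else {0::real}))"
    by (subst compactin_PiE) auto
  then have "compact (PiE (UNIV :: nat set) (\<lambda>i. if i < p then {- R..R} else {0::real}))"
    by (simp add: euclidean_product_topology)
  also have "PiE (UNIV :: nat set) (\<lambda>i. if i < p then {- R..R} else {0::real}) =
    {x. (\<forall>i<p. \<bar>x i\<bar> \<le> R) \<and> (\<forall>i\<ge>p. x i = 0)}"
  proof -
    have "x i \<in> (if i < p then {- R..R} else {0::real}) \<longleftrightarrow> (i < p \<longrightarrow> \<bar>x i\<bar> \<le> R) \<and> (i \<ge> p \<longrightarrow> x i = 0)" for x :: "nat \<Rightarrow> real" and i
      by (simp add: abs_le_iff) linarith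
    then show ?thesis
      by (simp only: PiE_UNIV_domain Pi_def) blast
  qed
  finally show ?thesis .
qed

lemma continuous_on_coordinate [continuous_intros]: "continuous_on S (\<lambda>x :: nat \<Rightarrow> real. x i)"
  by (rule continuous_on_subset[OF continuous_on_product_coordinates]) simp

lemma continuous_on_quad_form: "continuous_on S (quad_form p A)"
  unfolding quad_form_def by (intro continuous_intros)

text \<open>The minimum of the Rayleigh quotient over the unit sphere is an eigenvalue. The sign
  \<open>s\<close> treats both ends of the spectrum at once: \<open>s = -1\<close> turns the maximum
  into a minimum.\<close>

lemma symmetric_eigenvalue_bound:
  fixes \<Omega> :: "real mat" and s :: real
  assumes \<Omega>: "\<Omega> \<in> carrier_mat p p" and sym: "transpose_mat \<Omega> = \<Omega>" and p: "p > 0" and s: "s\<^sup>2 = 1"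
  obtains \<mu> where "s * \<mu> \<in> spectrum \<Omega>"
    "\<And>x. \<mu> * (\<Sum>i<p. (x i)\<^sup>2) \<le> s * quad_form p (\<lambda>i j. \<Omega> $$ (i, j)) x"
proof -
  let ?A = "\<lambda>i j. \<Omega> $$ (i, j)"
  let ?K = "{x :: nat \<Rightarrow> real. (\<forall>i<p. \<bar>x i\<bar> \<le> 1) \<and> (\<forall>i\<ge>p. x i = 0)} \<inter> {x. (\<Sum>i<p. (x i)\<^sup>2) = 1}"
  have symA: "?A i j = ?A j i" if "i < p" "j < p" for i j
    using that \<Omega> sym by (metis carrier_matD index_transpose_mat(1))
  have "closed {x :: nat \<Rightarrow> real. (\<Sum>i<p. (x i)\<^sup>2) = 1}"
    by (intro closed_Collect_eq continuous_intros)
  then have "compact ?K" by (intro compact_Int_closed compact_box_fun)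
  moreover have "(\<lambda>i::nat. if i = 0 then 1 else 0 :: real) \<in> ?K"
    using p by (auto simp: if_distrib[where f="\<lambda>x. x\<^sup>2"] cong: if_cong)
  then have "?K \<noteq> {}" by (metis (no_types) empty_iff)
  moreover have "continuous_on ?K (\<lambda>x. s * quad_form p ?A x)"
    by (intro continuous_on_mult_left continuous_on_quad_form)
  ultimately have "\<exists>v\<in>?K. \<forall>y\<in>?K. s * quad_form p ?A v \<le> s * quad_form p ?A y"
    by (rule continuous_attains_inf)
  then obtain v where v: "v \<in> ?K"
    and vmin: "\<And>y. y \<in> ?K \<Longrightarrow> s * quad_form p ?A v \<le> s * quad_form p ?A y"
    by (elim bexE) (rule that, assumption, drule (1) bspec, assumption)
  define \<mu> where "\<mu> = s * quad_form p ?A v"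
  have bound: "\<mu> * (\<Sum>i<p. (x i)\<^sup>2) \<le> s * quad_form p ?A x" for x
  proof (cases "(\<Sum>i<p. (x i)\<^sup>2) = 0")
    case True
    then have "\<forall>i<p. x i = 0" by (subst (asm) sum_nonneg_eq_0_iff) auto
    then have "quad_form p ?A x = 0" by (simp add: quad_form_def)
    with True show ?thesis by simp
  next
    case False
    define S where "S = (\<Sum>i<p. (x i)\<^sup>2)"
    have S: "S > 0" using False by (simp add: S_def less_le sum_nonneg)
    define y where "y = (\<lambda>i. if i < p then x i / sqrt S else 0)"
    have "(\<Sum>i<p. (y i)\<^sup>2) = (\<Sum>i<p. (x i)\<^sup>2 / S)"
      using S by (intro sum.cong) (auto simp: y_def power_divide)
    also have "\<dots> = 1" using S by (simp add: S_def flip: sum_divide_distrib)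
    finally have y1: "(\<Sum>i<p. (y i)\<^sup>2) = 1" .
    have "\<bar>y i\<bar> \<le> 1" if "i < p" for i
    proof -
      have "(y i)\<^sup>2 \<le> (\<Sum>i<p. (y i)\<^sup>2)" using that by (intro member_le_sum) auto
      then show ?thesis using y1 by (simp add: abs_square_le_1)
    qed
    then have "y \<in> ?K" using y1 by (auto simp: y_def)
    then have "\<mu> \<le> s * quad_form p ?A y" unfolding \<mu>_def by (rule vmin)
    also have "quad_form p ?A y = quad_form p ?A x / S"
      unfolding quad_form_def sum_divide_distrib using S
      by (intro sum.cong) (auto simp: y_def field_simps)
    finally show ?thesis using S by (simp add: S_def field_simps)
  qed
  have eig: "(\<Sum>j<p. ?A i j * v j) = s * \<mu> * v i" if i: "i < p" for i
  proof -
    define d where "d = s * (\<Sum>j<p. ?A i j * v j) - \<mu> * v i"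
    define e where "e = (\<lambda>k::nat. if k = i then 1 else 0 :: real)"
    have sv: "(\<Sum>i<p. (v i)\<^sup>2) = 1" using v by simp
    have "0 \<le> 2 * c * d + c\<^sup>2 * (s * ?A i i - \<mu>)" for c
    proof -
      have q: "quad_form p ?A (\<lambda>k. v k + c * e k) = quad_form p ?A v + 2 * c * (\<Sum>j<p. ?A i j * v j) + c\<^sup>2 * ?A i i"
      proof -
        have "quad_form p ?A (\<lambda>k. v k + c * e k) =
          quad_form p ?A v + 2 * c * (\<Sum>k<p. v k * (\<Sum>j<p. ?A k j * e j)) + c\<^sup>2 * quad_form p ?A e"
          by (rule quad_form_add) (rule symA)
        also have "quad_form p ?A e = ?A i i"
          using i by (simp add: quad_form_alt e_def sum_lessThan_delta)
        also have "(\<Sum>k<p. v k * (\<Sum>j<p. ?A k j * e j)) = (\<Sum>j<p. ?A i j * v j)"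
          using i by (intro sum.cong) (auto simp: e_def sum_lessThan_delta symA)
        finally show ?thesis .
      qed
      have n: "(\<Sum>k<p. (v k + c * e k)\<^sup>2) = 1 + 2 * c * v i + c\<^sup>2"
      proof -
        have "(\<Sum>k<p. (v k + c * e k)\<^sup>2) = (\<Sum>k<p. (v k)\<^sup>2) + 2 * c * (\<Sum>k<p. v k * e k) + c\<^sup>2 * (\<Sum>k<p. e k * e k)"
          by (simp add: sum.distrib sum_distrib_left power2_eq_square algebra_simps)
        also have "\<dots> = 1 + 2 * c * v i + c\<^sup>2"
          using i sv by (simp add: e_def sum_lessThan_delta)
        finally show ?thesis .
      qed
      show ?thesis
        using bound[of "\<lambda>k. v k + c * e k"] unfolding q n d_def \<mu>_def by (simp add: algebra_simps)
    qed
    note quad = this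
    \<comment> \<open>A quadratic in \<open>c\<close> without constant term that is nowhere negative
      has no linear term. Otherwise \<open>c = - d / a\<close>, with \<open>a\<close> larger than
      the second-order coefficient, would make it negative.\<close>
    have "d = 0"
    proof (rule ccontr)
      assume d: "d \<noteq> 0"
      define a where "a = \<bar>s * ?A i i - \<mu>\<bar> + 1"
      have a: "a > 0" by (simp add: a_def)
      have "0 \<le> 2 * (- d / a) * d + (- d / a)\<^sup>2 * (s * ?A i i - \<mu>)" by (rule quad)
      also have "\<dots> \<le> 2 * (- d / a) * d + (- d / a)\<^sup>2 * a"
        by (intro add_left_mono mult_left_mono) (auto simp: a_def)
      also have "\<dots> = - (d\<^sup>2 / a)" using a by (simp add: power2_eq_square field_simps)
      finally show False using a d by (simp add: field_simps)
    qed
    then have "s * (\<Sum>j<p. ?A i j * v j) = \<mu> * v i" by (simp add: d_def)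
    then have "s * (s * (\<Sum>j<p. ?A i j * v j)) = s * (\<mu> * v i)" by (rule arg_cong)
    then have "s\<^sup>2 * (\<Sum>j<p. ?A i j * v j) = s * \<mu> * v i"
      by (simp only: mult.assoc power2_eq_square)
    then show ?thesis using s by simp
  qed
  have "eigenvector \<Omega> (vec p v) (s * \<mu>)"
    unfolding eigenvector_def
  proof (intro conjI)
    show "vec p v \<in> carrier_vec (dim_row \<Omega>)" using \<Omega> by auto
    show "vec p v \<noteq> 0\<^sub>v (dim_row \<Omega>)"
    proof
      assume "vec p v = 0\<^sub>v (dim_row \<Omega>)"
      then have "\<forall>i<p. v i = 0" using \<Omega> by (metis carrier_matD(1) index_vec index_zero_vec(1))
      then show False using v by simp
    qed
    show "\<Omega> *\<^sub>v vec p v = s * \<mu> \<cdot>\<^sub>v vec p v"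
      using \<Omega> by (intro eq_vecI) (auto simp: scalar_prod_def eig[symmetric] lessThan_atLeast0 intro!: sum.cong)
  qed
  then have "s * \<mu> \<in> spectrum \<Omega>" by (auto simp: spectrum_def eigenvalue_def)
  with bound show thesis by (intro that)
qed

lemma spectrum_bounds_quad_form:
  assumes \<Omega>: "\<Omega> \<in> carrier_mat p p" and sym: "transpose_mat \<Omega> = \<Omega>"
    and lo: "a \<le> Min (spectrum \<Omega>)" and hi: "Max (spectrum \<Omega>) \<le> b"
  shows "a * (\<Sum>i<p. (x i)\<^sup>2) \<le> quad_form p (\<lambda>i j. \<Omega> $$ (i, j)) x"
    and "quad_form p (\<lambda>i j. \<Omega> $$ (i, j)) x \<le> b * (\<Sum>i<p. (x i)\<^sup>2)"
proof -
  let ?N = "\<Sum>i<p. (x i)\<^sup>2"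
  have N: "?N \<ge> 0" by (rule sum_nonneg) simp
  have fin: "finite (spectrum \<Omega>)" by (rule card_finite_spectrum[OF \<Omega>])
  show "a * ?N \<le> quad_form p (\<lambda>i j. \<Omega> $$ (i, j)) x"
  proof (cases "p = 0")
    case False
    obtain \<mu> where "1 * \<mu> \<in> spectrum \<Omega>" "\<And>x. \<mu> * (\<Sum>i<p. (x i)\<^sup>2) \<le> 1 * quad_form p (\<lambda>i j. \<Omega> $$ (i, j)) x"
      by (rule symmetric_eigenvalue_bound[OF \<Omega> sym, of 1]) (use False in auto)
    note \<mu> = this
    then have "Min (spectrum \<Omega>) \<le> \<mu>" using fin by (intro Min_le) auto
    then have "a * ?N \<le> \<mu> * ?N" using N lo by (intro mult_right_mono) auto
    then show ?thesis using \<mu>(2)[of x] by simp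
  qed (simp add: quad_form_def)
  show "quad_form p (\<lambda>i j. \<Omega> $$ (i, j)) x \<le> b * ?N"
  proof (cases "p = 0")
    case False
    obtain \<mu> where "-1 * \<mu> \<in> spectrum \<Omega>" and le: "\<And>x. \<mu> * (\<Sum>i<p. (x i)\<^sup>2) \<le> -1 * quad_form p (\<lambda>i j. \<Omega> $$ (i, j)) x"
      by (rule symmetric_eigenvalue_bound[OF \<Omega> sym, of "-1"]) (use False in auto)
    then have "-1 * \<mu> \<le> Max (spectrum \<Omega>)" using fin by (intro Max_ge) auto
    then have "-1 * \<mu> \<le> b" using hi by simp
    then have "-1 * \<mu> * ?N \<le> b * ?N" using N by (rule mult_right_mono)
    then show ?thesis using le[of x] by simp
  qed (simp add: quad_form_def)
qed

text \<open>The sampling law inverts \<open>\<Omega>\<close> to get the covariance, and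
  \<open>mvn\<close> inverts that again in its density; the clause on \<open>mat_inverse\<close>
  records that this round trip returns \<open>\<Omega>\<close>.\<close>

definition precision_pair :: "nat \<Rightarrow> real mat \<Rightarrow> real mat \<Rightarrow> bool" where
  "precision_pair p \<Omega> \<Sigma> \<longleftrightarrow> \<Omega> \<in> carrier_mat p p \<and> \<Sigma> \<in> carrier_mat p p \<and>
    \<Omega> * \<Sigma> = 1\<^sub>m p \<and> \<Sigma> * \<Omega> = 1\<^sub>m p \<and> mat_inverse \<Sigma> = Some \<Omega> \<and> pos_def p (\<lambda>i j. \<Omega> $$ (i, j))"

lemma mat_inverse_SomeI:
  assumes A: "A \<in> carrier_mat n n" and B: "(B :: real mat) \<in> carrier_mat n n" and BA: "B * A = 1\<^sub>m n"
  shows "mat_inverse A = Some B"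
proof -
  have "det B * det A = 1" using det_mult[OF B A] BA by simp
  then have dA: "det A \<noteq> 0" by auto
  then obtain C where C: "mat_inverse A = Some C"
    using mat_inverse(1)[OF A, of undefined] det_non_zero_imp_unit[OF A, of undefined] by (cases "mat_inverse A") auto
  have AC: "A * C = 1\<^sub>m n" "C \<in> carrier_mat n n" using mat_inverse(2)[OF A C] by auto
  have "C = B * (A * C)"
    using A B AC BA by (metis assoc_mult_mat left_mult_one_mat)
  also have "\<dots> = B" using AC B by auto
  finally show ?thesis using C by simp
qed

lemma precision_pair_inverse:
  assumes \<Omega>: "\<Omega> \<in> carrier_mat p p" and pd: "pos_def p (\<lambda>i j. \<Omega> $$ (i, j))"
  shows "precision_pair p \<Omega> (the (mat_inverse \<Omega>))"
proof -
  have "mat p p (\<lambda>(i, j). \<Omega> $$ (i, j)) = \<Omega>" using \<Omega> by (intro eq_matI) auto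
  then have "det \<Omega> > 0" using gaussian_integral[OF pd] by simp
  then obtain C where C: "mat_inverse \<Omega> = Some C"
    using mat_inverse(1)[OF \<Omega>, of undefined] det_non_zero_imp_unit[OF \<Omega>, of undefined] by (cases "mat_inverse \<Omega>") auto
  then have inv: "\<Omega> * C = 1\<^sub>m p" "C * \<Omega> = 1\<^sub>m p" "C \<in> carrier_mat p p" using mat_inverse(2)[OF \<Omega> C] by auto
  have "mat_inverse C = Some \<Omega>" by (rule mat_inverse_SomeI) (use inv \<Omega> in auto)
  then show ?thesis using \<Omega> inv pd C by (simp add: precision_pair_def)
qed

section \<open>The centred Gaussian law with a given precision matrix\<close>

lemma sets_mvn: "sets (mvn p S) = sets (\<Pi>\<^sub>M j\<in>{..<p}. borel)"
  unfolding mvn_def by (simp cong: sets_PiM_cong)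

abbreviation (input) entries :: "real mat \<Rightarrow> nat \<Rightarrow> nat \<Rightarrow> real" where
  "entries A \<equiv> \<lambda>i j. A $$ (i, j)"

context
  fixes p :: nat and \<Omega> \<Sigma> :: "real mat"
  assumes pp: "precision_pair p \<Omega> \<Sigma>"
begin


lemma precision_carrier: "\<Omega> \<in> carrier_mat p p" "\<Sigma> \<in> carrier_mat p p"
  using pp by (auto simp: precision_pair_def)

lemma precision_pos_def: "pos_def p (entries \<Omega>)"
  using pp by (simp add: precision_pair_def)

lemma precision_symmetric: "i < p \<Longrightarrow> j < p \<Longrightarrow> entries \<Omega> i j = entries \<Omega> j i"
  using precision_pos_def by (auto simp: pos_def_def)

lemma precision_inverse:
  assumes "i < p" "j < p"
  shows "(\<Sum>k<p. entries \<Omega> i k * entries \<Sigma> k j) = (if i = j then 1 else 0)" "(\<Sum>k<p. entries \<Sigma> i k * entries \<Omega> k j) = (if i = j then 1 else 0)"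
proof -
  have "(\<Omega> * \<Sigma>) $$ (i, j) = (1\<^sub>m p) $$ (i, j)" "(\<Sigma> * \<Omega>) $$ (i, j) = (1\<^sub>m p) $$ (i, j)"
    using pp by (auto simp: precision_pair_def)
  then show "(\<Sum>k<p. entries \<Omega> i k * entries \<Sigma> k j) = (if i = j then 1 else 0)" "(\<Sum>k<p. entries \<Sigma> i k * entries \<Omega> k j) = (if i = j then 1 else 0)"
    using assms precision_carrier by (auto simp: scalar_prod_def lessThan_atLeast0)
qed

lemma precision_apply_inverse:
  assumes "i < p"
  shows "(\<Sum>j<p. entries \<Omega> i j * (\<Sum>k<p. entries \<Sigma> j k * t k)) = t i" "(\<Sum>j<p. entries \<Sigma> i j * (\<Sum>k<p. entries \<Omega> j k * t k)) = t i"
proof -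
  have "(\<Sum>j<p. entries \<Omega> i j * (\<Sum>k<p. entries \<Sigma> j k * t k)) = (\<Sum>k<p. (\<Sum>j<p. entries \<Omega> i j * entries \<Sigma> j k) * t k)"
    unfolding sum_distrib_left sum_distrib_right by (subst sum.swap) (simp add: mult.assoc)
  then show "(\<Sum>j<p. entries \<Omega> i j * (\<Sum>k<p. entries \<Sigma> j k * t k)) = t i"
    using assms by (simp add: precision_inverse sum_lessThan_delta)
  have "(\<Sum>j<p. entries \<Sigma> i j * (\<Sum>k<p. entries \<Omega> j k * t k)) = (\<Sum>k<p. (\<Sum>j<p. entries \<Sigma> i j * entries \<Omega> j k) * t k)"
    unfolding sum_distrib_left sum_distrib_right by (subst sum.swap) (simp add: mult.assoc)
  then show "(\<Sum>j<p. entries \<Sigma> i j * (\<Sum>k<p. entries \<Omega> j k * t k)) = t i"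
    using assms by (simp add: precision_inverse sum_lessThan_delta)
qed

text \<open>The matrix \<open>\<Sigma>^T \<Omega> \<Sigma>\<close> is evaluated in two ways,
  cancelling \<open>\<Omega>\<close> against its right or its left neighbour; symmetry of
  \<open>\<Omega>\<close> makes the second cancellation possible.\<close>

lemma covariance_symmetric:
  assumes "i < p" "j < p"
  shows "entries \<Sigma> i j = entries \<Sigma> j i"
proof -
  define S where "S = (\<Sum>k<p. \<Sum>l<p. entries \<Sigma> k i * (entries \<Omega> k l * entries \<Sigma> l j))"
  have "S = (\<Sum>k<p. entries \<Sigma> k i * (if k = j then 1 else 0))"
    unfolding S_def sum_distrib_left[symmetric]
    using assms by (intro sum.cong refl) (simp add: precision_inverse)
  then have 1: "S = entries \<Sigma> j i" using assms by (simp add: sum_lessThan_delta)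
  have "S = (\<Sum>l<p. \<Sum>k<p. entries \<Sigma> k i * (entries \<Omega> k l * entries \<Sigma> l j))"
    unfolding S_def by (rule sum.swap)
  also have "\<dots> = (\<Sum>l<p. (\<Sum>k<p. entries \<Omega> l k * entries \<Sigma> k i) * entries \<Sigma> l j)"
    unfolding sum_distrib_right by (intro sum.cong refl) (simp add: precision_symmetric)
  also have "\<dots> = (\<Sum>l<p. (if l = i then 1 else 0) * entries \<Sigma> l j)"
    using assms by (intro sum.cong refl) (simp add: precision_inverse)
  finally show ?thesis using 1 assms by (simp add: sum_lessThan_delta)
qed

lemma quad_form_covariance:
  "quad_form p (entries \<Sigma>) t = quad_form p (entries \<Omega>) (\<lambda>i. \<Sum>j<p. entries \<Sigma> i j * t j)"
  unfolding quad_form_alt by (intro sum.cong refl) (subst precision_apply_inverse, simp, rule mult.commute)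

lemma quad_form_precision:
  "quad_form p (entries \<Omega>) t = quad_form p (entries \<Sigma>) (\<lambda>i. \<Sum>j<p. entries \<Omega> i j * t j)"
  unfolding quad_form_alt by (intro sum.cong refl) (subst precision_apply_inverse, simp, rule mult.commute)

lemma quad_form_precision_nonneg: "0 \<le> quad_form p (entries \<Omega>) x"
  using precision_pos_def unfolding pos_def_def
  by (cases "\<exists>i<p. x i \<noteq> 0") (auto simp: quad_form_def intro: less_imp_le)

lemma quad_form_covariance_nonneg: "0 \<le> quad_form p (entries \<Sigma>) x"
  by (simp add: quad_form_covariance quad_form_precision_nonneg)

lemma quad_form_covariance_pos:
  assumes "\<exists>i<p. t i \<noteq> 0" shows "0 < quad_form p (entries \<Sigma>) t"
proof -
  have "\<exists>i<p. (\<Sum>j<p. entries \<Sigma> i j * t j) \<noteq> 0"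
  proof (rule ccontr)
    assume "\<not> (\<exists>i<p. (\<Sum>j<p. entries \<Sigma> i j * t j) \<noteq> 0)"
    then have "t i = 0" if "i < p" for i
      using precision_apply_inverse(1)[OF that, of t] by simp
    with assms show False by auto
  qed
  then show ?thesis
    unfolding quad_form_covariance using precision_pos_def by (auto simp: pos_def_def)
qed

text \<open>This is Cauchy-Schwarz in the inner product given by \<open>\<Omega>\<close>, for the
  vectors \<open>x\<close> and \<open>\<Sigma> t\<close>, whose inner product is the sum on the
  left.\<close>

lemma precision_cauchy_schwarz:
  "(\<Sum>i<p. t i * x i)\<^sup>2 \<le> quad_form p (entries \<Sigma>) t * quad_form p (entries \<Omega>) x"
proof (cases "\<exists>i<p. t i \<noteq> 0")
  case True
  define s where "s = quad_form p (entries \<Sigma>) t"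
  define y where "y = (\<lambda>i. \<Sum>j<p. entries \<Sigma> i j * t j)"
  define b where "b = (\<Sum>i<p. t i * x i)"
  have s: "s > 0" unfolding s_def by (rule quad_form_covariance_pos[OF True])
  have "0 \<le> quad_form p (entries \<Omega>) (\<lambda>i. x i + (- b / s) * y i)" by (rule quad_form_precision_nonneg)
  also have "\<dots> = quad_form p (entries \<Omega>) x + 2 * (- b / s) * (\<Sum>i<p. x i * (\<Sum>j<p. entries \<Omega> i j * y j)) + (- b / s)\<^sup>2 * quad_form p (entries \<Omega>) y"
    by (rule quad_form_add) (rule precision_symmetric)
  also have "quad_form p (entries \<Omega>) y = s" by (simp add: s_def y_def quad_form_covariance)
  also have "(\<Sum>i<p. x i * (\<Sum>j<p. entries \<Omega> i j * y j)) = b"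
    unfolding y_def b_def by (intro sum.cong refl) (subst precision_apply_inverse, simp, rule mult.commute)
  finally have "0 \<le> quad_form p (entries \<Omega>) x - b\<^sup>2 / s"
    using s by (simp add: power2_eq_square field_simps)
  then show ?thesis using s by (simp add: b_def s_def field_simps)
next
  case False
  then show ?thesis by (simp add: quad_form_def)
qed

lemma det_covariance: "det \<Sigma> = 1 / det \<Omega>" "det \<Omega> > 0"
proof -
  have "mat p p (\<lambda>(i, j). \<Omega> $$ (i, j)) = \<Omega>" using precision_carrier by (intro eq_matI) auto
  then show pos: "det \<Omega> > 0" using gaussian_integral[OF precision_pos_def] by simp
  have "det \<Omega> * det \<Sigma> = 1"
    using det_mult[OF precision_carrier] pp by (simp add: precision_pair_def)
  with pos show "det \<Sigma> = 1 / det \<Omega>" by (simp add: field_simps)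
qed

lemma mvn_eq_density:
  "mvn p \<Sigma> = density (\<Pi>\<^sub>M j\<in>{..<p}. lborel)
    (\<lambda>x. ennreal (sqrt (det \<Omega> / (2 * pi) ^ p)) * ennreal (exp (- quad_form p (entries \<Omega>) x / 2)))"
proof -
  have inv: "the (mat_inverse \<Sigma>) = \<Omega>" using pp by (simp add: precision_pair_def)
  have "vec p x \<bullet> (\<Omega> *\<^sub>v vec p x) = quad_form p (entries \<Omega>) x" for x
    using precision_carrier by (simp add: scalar_prod_def quad_form_alt lessThan_atLeast0)
  moreover have "sqrt ((2 * pi) ^ p * det \<Sigma>) = 1 / sqrt (det \<Omega> / (2 * pi) ^ p)"
    using det_covariance by (simp add: real_sqrt_divide)
  ultimately show ?thesis
    unfolding mvn_def inv by (simp add: mult.commute ennreal_mult'')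
qed

lemma nn_integral_mvn:
  assumes [measurable]: "f \<in> borel_measurable (\<Pi>\<^sub>M j\<in>{..<p}. lborel)"
  shows "(\<integral>\<^sup>+ x. f x \<partial>mvn p \<Sigma>) = ennreal (sqrt (det \<Omega> / (2 * pi) ^ p)) *
    (\<integral>\<^sup>+ x. ennreal (exp (- quad_form p (entries \<Omega>) x / 2)) * f x \<partial>(\<Pi>\<^sub>M j\<in>{..<p}. lborel))"
  unfolding mvn_eq_density
  by (subst nn_integral_density) (auto simp: mult.assoc nn_integral_cmult)

lemma prob_space_mvn: "prob_space (mvn p \<Sigma>)"
proof (rule prob_spaceI)
  have m: "mat p p (($$) \<Omega>) = \<Omega>" using precision_carrier by (intro eq_matI) auto
  have "emeasure (mvn p \<Sigma>) (space (mvn p \<Sigma>)) = (\<integral>\<^sup>+ x. 1 \<partial>mvn p \<Sigma>)" by simp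
  also have "\<dots> = ennreal (sqrt (det \<Omega> / (2 * pi) ^ p)) * ennreal (sqrt ((2 * pi) ^ p / det \<Omega>))"
    using gaussian_integral[OF precision_pos_def] by (subst nn_integral_mvn) (auto simp: m)
  also have "\<dots> = 1"
    using det_covariance(2) by (simp add: real_sqrt_divide flip: ennreal_mult)
  finally show "emeasure (mvn p \<Sigma>) (space (mvn p \<Sigma>)) = 1" .
qed

text \<open>The exponential factor changes the precision matrix to
  \<open>\<Omega> + 2 c t t^T\<close>, so that the value is a ratio of two Gaussian normalisations,
  given by the rank-one determinant formula. The result is the Laplace transform of a scaled
  chi-square variable with one degree of freedom. Negative \<open>c\<close> is included because
  upper tails require it.\<close>

lemma mvn_laplace_square:
  assumes pos: "1 + 2 * c * quad_form p (entries \<Sigma>) t > 0"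
  shows "(\<integral>\<^sup>+ x. ennreal (exp (- c * (\<Sum>j<p. t j * x j)\<^sup>2)) \<partial>mvn p \<Sigma>) =
    ennreal (1 / sqrt (1 + 2 * c * quad_form p (entries \<Sigma>) t))"
proof -
  define s where "s = quad_form p (entries \<Sigma>) t"
  define A where "A = (\<lambda>i j. entries \<Omega> i j + 2 * c * t i * t j)"
  have qA: "quad_form p A x = quad_form p (entries \<Omega>) x + 2 * c * (\<Sum>j<p. t j * x j)\<^sup>2" for x
  proof -
    have "quad_form p A x = (\<Sum>i<p. \<Sum>j<p. entries \<Omega> i j * x i * x j + 2 * c * ((t i * x i) * (t j * x j)))"
      unfolding quad_form_def A_def by (intro sum.cong refl) (simp add: algebra_simps)
    then show ?thesis
      by (simp only: sum.distrib sum_distrib_left[symmetric] power2_eq_square sum_product quad_form_def)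
  qed
  have pd: "pos_def p A"
    unfolding pos_def_def
  proof (intro conjI allI impI)
    fix x :: "nat \<Rightarrow> real" assume x: "\<exists>i<p. x i \<noteq> 0"
    define b where "b = (\<Sum>j<p. t j * x j)"
    have xx: "quad_form p (entries \<Omega>) x > 0" using x precision_pos_def by (auto simp: pos_def_def)
    have cs: "b\<^sup>2 \<le> s * quad_form p (entries \<Omega>) x"
      unfolding b_def s_def by (rule precision_cauchy_schwarz)
    show "quad_form p A x > 0"
    proof (cases "c \<ge> 0")
      case True
      then show ?thesis using xx by (simp add: qA add_pos_nonneg)
    next
      case False
      \<comment> \<open>A negative \<open>c\<close> lowers the precision; by Cauchy-Schwarz at least
        the fraction \<open>1 + 2 * c * s\<close> of the form survives, which is positive by
        assumption.\<close>
      then have "2 * c * (s * quad_form p (entries \<Omega>) x) \<le> 2 * c * b\<^sup>2"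
        using cs by (intro mult_left_mono_neg) auto
      moreover have "0 < quad_form p (entries \<Omega>) x * (1 + 2 * c * s)"
        using xx pos by (simp add: s_def)
      ultimately show ?thesis by (simp add: qA b_def algebra_simps)
    qed
  qed (auto simp: A_def precision_symmetric)
  have m: "mat p p (($$) \<Omega>) = \<Omega>" using precision_carrier by (intro eq_matI) auto
  have detA: "det (mat p p (\<lambda>(i, j). A i j)) = det \<Omega> * (1 + 2 * c * s)"
  proof -
    have "det (mat p p (\<lambda>(i, j). entries \<Omega> i j + (2 * c * t i) * t j)) =
      det (mat p p (\<lambda>(i, j). entries \<Omega> i j)) * (1 + (\<Sum>i<p. \<Sum>j<p. entries \<Sigma> i j * t i * (2 * c * t j)))"
      by (rule det_rank_one_update) (rule precision_inverse)
    also have "(\<Sum>i<p. \<Sum>j<p. entries \<Sigma> i j * t i * (2 * c * t j)) = 2 * c * s"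
      unfolding s_def quad_form_def sum_distrib_left by (intro sum.cong refl) simp
    finally show ?thesis by (simp add: A_def m)
  qed
  have "(\<integral>\<^sup>+ x. ennreal (exp (- c * (\<Sum>j<p. t j * x j)\<^sup>2)) \<partial>mvn p \<Sigma>) =
    ennreal (sqrt (det \<Omega> / (2 * pi) ^ p)) *
    (\<integral>\<^sup>+ x. ennreal (exp (- quad_form p A x / 2)) \<partial>(\<Pi>\<^sub>M j\<in>{..<p}. lborel))"
    by (subst nn_integral_mvn)
      (auto simp: qA exp_add[symmetric] add_divide_distrib diff_divide_distrib simp flip: ennreal_mult)
  also have "\<dots> = ennreal (sqrt (det \<Omega> / (2 * pi) ^ p)) * ennreal (sqrt ((2 * pi) ^ p / (det \<Omega> * (1 + 2 * c * s))))"
    using gaussian_integral[OF pd] by (simp add: detA)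
  also have "\<dots> = ennreal (1 / sqrt (1 + 2 * c * s))"
    using det_covariance(2) pos
    by (simp add: s_def real_sqrt_divide real_sqrt_mult flip: ennreal_mult)
  finally show ?thesis by (simp add: s_def)
qed

end

section \<open>Tails of Gaussian quadratic and linear forms\<close>

text \<open>Chernoff's method needs only the Laplace transform of \<open>v\<close> times a
  chi-square variable with \<open>n\<close> degrees of freedom. Leaving \<open>S\<close> abstract
  lets design energies and noise energy share the bound.\<close>

lemma chi_square_tail:
  fixes S :: "'a \<Rightarrow> real" and v :: real and n :: nat
  assumes S [measurable]: "S \<in> borel_measurable M"
    and laplace: "\<And>c. 1 + 2 * c * v > 0 \<Longrightarrow>
      (\<integral>\<^sup>+ x. ennreal (exp (- c * S x)) \<partial>M) = ennreal ((1 / sqrt (1 + 2 * c * v)) ^ n)"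
    and v: "v > 0" and t: "0 < t" "t \<le> 1"
  shows "emeasure M {x \<in> space M. \<bar>S x - real n * v\<bar> \<ge> t * (real n * v)} \<le> ennreal (2 * exp (- (real n * t\<^sup>2 / 16)))"
proof -
  have pw: "(1 / sqrt y) ^ n = exp (- (real n / 2) * ln y)" if "y > 0" for y :: real
  proof -
    have "1 / sqrt y = exp (- (ln y / 2))"
      using that by (simp add: exp_minus inverse_eq_divide ln_sqrt[symmetric])
    then show ?thesis
      by (simp add: exp_of_nat_mult[symmetric])
  qed
  \<comment> \<open>With these multipliers the terms linear in \<open>t\<close> cancel in both
    exponents, and \<open>t \<le> 1\<close> keeps the arguments of the logarithm where its quadratic
    lower bounds hold.\<close>
  define c1 where "c1 = t / (8 * v)"
  define c2 where "c2 = t / (4 * v)"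
  have c: "c1 > 0" "c2 > 0" using v t by (auto simp: c1_def c2_def)
  have e1: "2 * c1 * v = t / 4" and e2: "2 * c2 * v = t / 2"
    using v by (auto simp: c1_def c2_def)
  have "emeasure M {x \<in> space M. S x \<ge> real n * v + t * (real n * v)} \<le>
    ennreal (exp (- c1 * (real n * v + t * (real n * v)))) * (\<integral>\<^sup>+ x\<in>space M. ennreal (exp (c1 * S x)) \<partial>M)"
    by (intro Chernoff_ineq_nn_integral_ge c) auto
  also have "(\<integral>\<^sup>+ x\<in>space M. ennreal (exp (c1 * S x)) \<partial>M) = (\<integral>\<^sup>+ x. ennreal (exp (- (- c1) * S x)) \<partial>M)"
    by (intro nn_integral_cong) simp
  also have "\<dots> = ennreal (exp (- (real n / 2) * ln (1 - t / 4)))"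
    using t e1 by (subst laplace) (auto simp: pw)
  also have "ennreal (exp (- c1 * (real n * v + t * (real n * v)))) * \<dots> =
    ennreal (exp (- c1 * (real n * v + t * (real n * v)) - (real n / 2) * ln (1 - t / 4)))"
    by (simp add: exp_diff exp_minus field_simps flip: ennreal_mult exp_add)
  also have "\<dots> \<le> ennreal (exp (- (real n * t\<^sup>2 / 16)))"
  proof -
    have "- t / 4 - 2 * (t / 4)\<^sup>2 \<le> ln (1 - t / 4)"
      using ln_one_minus_pos_lower_bound[of "t / 4"] t by simp
    then have "(real n / 2) * (- t / 4 - 2 * (t / 4)\<^sup>2) \<le> (real n / 2) * ln (1 - t / 4)"
      by (intro mult_left_mono) auto
    moreover have "c1 * (real n * v + t * (real n * v)) = real n * (1 + t) * t / 8"
      using v by (simp add: c1_def field_simps)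
    ultimately have "- c1 * (real n * v + t * (real n * v)) - (real n / 2) * ln (1 - t / 4) \<le> - (real n * t\<^sup>2 / 16)"
      by (simp add: power2_eq_square field_simps)
    then show ?thesis by (intro ennreal_leI) simp
  qed
  finally have up: "emeasure M {x \<in> space M. S x \<ge> real n * v + t * (real n * v)} \<le> ennreal (exp (- (real n * t\<^sup>2 / 16)))" .
  have "emeasure M {x \<in> space M. S x \<le> real n * v - t * (real n * v)} \<le>
    ennreal (exp (c2 * (real n * v - t * (real n * v)))) * (\<integral>\<^sup>+ x\<in>space M. ennreal (exp (- c2 * S x)) \<partial>M)"
    by (intro Chernoff_ineq_nn_integral_le c) auto
  also have "(\<integral>\<^sup>+ x\<in>space M. ennreal (exp (- c2 * S x)) \<partial>M) = (\<integral>\<^sup>+ x. ennreal (exp (- c2 * S x)) \<partial>M)"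
    by (intro nn_integral_cong) simp
  also have "\<dots> = ennreal (exp (- (real n / 2) * ln (1 + t / 2)))"
    using t e2 by (subst laplace) (auto simp: pw)
  also have "ennreal (exp (c2 * (real n * v - t * (real n * v)))) * \<dots> =
    ennreal (exp (c2 * (real n * v - t * (real n * v)) - (real n / 2) * ln (1 + t / 2)))"
    by (simp add: exp_diff exp_minus field_simps flip: ennreal_mult exp_add)
  also have "\<dots> \<le> ennreal (exp (- (real n * t\<^sup>2 / 16)))"
  proof -
    have "t / 2 - (t / 2)\<^sup>2 \<le> ln (1 + t / 2)"
      using ln_one_plus_pos_lower_bound[of "t / 2"] t by simp
    then have "(real n / 2) * (t / 2 - (t / 2)\<^sup>2) \<le> (real n / 2) * ln (1 + t / 2)"
      by (intro mult_left_mono) auto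
    moreover have "c2 * (real n * v - t * (real n * v)) = real n * (1 - t) * t / 4"
      using v by (simp add: c2_def field_simps)
    moreover have "0 \<le> real n * t\<^sup>2" by simp
    ultimately have "c2 * (real n * v - t * (real n * v)) - (real n / 2) * ln (1 + t / 2) \<le> - (real n * t\<^sup>2 / 16)"
      by (simp add: power2_eq_square field_simps)
    then show ?thesis by (intro ennreal_leI) simp
  qed
  finally have lo: "emeasure M {x \<in> space M. S x \<le> real n * v - t * (real n * v)} \<le> ennreal (exp (- (real n * t\<^sup>2 / 16)))" .
  have "emeasure M {x \<in> space M. \<bar>S x - real n * v\<bar> \<ge> t * (real n * v)} \<le>
    emeasure M ({x \<in> space M. S x \<ge> real n * v + t * (real n * v)} \<union> {x \<in> space M. S x \<le> real n * v - t * (real n * v)})"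
    by (intro emeasure_mono) auto
  also have "\<dots> \<le> emeasure M {x \<in> space M. S x \<ge> real n * v + t * (real n * v)} +
    emeasure M {x \<in> space M. S x \<le> real n * v - t * (real n * v)}"
    by (intro emeasure_subadditive) measurable
  also have "\<dots> \<le> ennreal (exp (- (real n * t\<^sup>2 / 16))) + ennreal (exp (- (real n * t\<^sup>2 / 16)))"
    by (intro add_mono up lo)
  also have "\<dots> = ennreal (2 * exp (- (real n * t\<^sup>2 / 16)))"
    by (simp flip: ennreal_plus)
  finally show ?thesis .
qed

section \<open>The standard normal law and its quantiles\<close>

abbreviation "std_normal \<equiv> density lborel (\<lambda>x. ennreal (std_normal_density x))"

interpretation std_normal: real_distribution std_normal
proof -
  interpret prob_space std_normal by (rule prob_space_normal_density) simp
  show "real_distribution std_normal" by unfold_locales auto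
qed

lemma std_normal_uminus: "distr std_normal borel uminus = std_normal"
proof -
  have "distributed std_normal lborel (\<lambda>x. x) (normal_density 0 1)"
    by (simp add: distributed_def distr_id2)
  then have "distributed std_normal lborel (\<lambda>x. 0 + -1 * x) (normal_density (0 + -1 * 0) (\<bar>-1\<bar> * 1))"
    by (rule std_normal.normal_density_affine) auto
  then have "distr std_normal lborel (\<lambda>x. - x) = std_normal" by (simp add: distributed_def)
  moreover have "distr std_normal lborel (\<lambda>x. - x) = distr std_normal borel uminus"
    by (intro distr_cong) auto
  ultimately show ?thesis by simp
qed

lemma std_normal_singleton: "measure std_normal {x} = 0"
proof -
  have "AE y in lborel. y \<in> {x} \<longrightarrow> ennreal (std_normal_density y) = 0"
    using AE_lborel_singleton[of x] by eventually_elim auto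
  then have "{x} \<in> null_sets std_normal" by (subst null_sets_density_iff) auto
  then show ?thesis by (simp add: measure_def null_setsD1)
qed

lemma std_normal_Ioc_pos: "a < b \<Longrightarrow> measure std_normal {a<..b} > 0"
proof (rule ccontr)
  assume ab: "a < b" and "\<not> measure std_normal {a<..b} > 0"
  then have "measure std_normal {a<..b} = 0"
    by (simp add: not_less measure_le_0_iff)
  then have "emeasure std_normal {a<..b} = 0"
    by (simp add: std_normal.emeasure_eq_measure)
  then have "{a<..b} \<in> null_sets std_normal" by (auto intro: null_setsI)
  then have "AE x in lborel. x \<in> {a<..b} \<longrightarrow> ennreal (std_normal_density x) = 0"
    by (subst (asm) null_sets_density_iff) auto
  then have "AE x in lborel. x \<notin> {a<..b}"
    by eventually_elim (use normal_density_pos[of 1 0] in \<open>auto simp: ennreal_eq_0_iff simp flip: not_less\<close>)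
  then have "emeasure lborel {a<..b} = 0"
    by (subst (asm) AE_iff_measurable[of "{a<..b}"]) auto
  then show False using ab by simp
qed

lemma std_normal_upper: "measure std_normal {t<..} = 1 - cdf std_normal t"
proof -
  have "{t<..} = space std_normal - {..t}" by auto
  then show ?thesis
    by (simp only: cdf_def) (subst std_normal.prob_compl, auto)
qed

text \<open>The quantile is a definite description. Existence follows from the intermediate value
  theorem, as the law has no atoms; uniqueness holds because every interval has positive
  mass.\<close>

lemma normal_upper_quantile_eq:
  assumes a: "0 < a" "a < 1"
  shows "measure std_normal {normal_upper_quantile a<..} = a"
proof -
  let ?F = "cdf std_normal"
  have cont: "isCont ?F x" for x
    using std_normal.isCont_cdf std_normal_singleton by blast
  have "eventually (\<lambda>x. ?F x > 1 - a) at_top" "eventually (\<lambda>x. ?F x < 1 - a) at_bot"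
    using order_tendstoD(1)[OF std_normal.cdf_lim_at_top_prob, of "1 - a"]
      order_tendstoD(2)[OF std_normal.cdf_lim_at_bot, of "1 - a"] a by auto
  then obtain u l where u: "?F u > 1 - a" and l: "?F l < 1 - a"
    by (meson eventually_happens' trivial_limit_at_top_linorder trivial_limit_at_bot_linorder)
  have "l \<le> u" using std_normal.cdf_nondecreasing[of u l] u l by linarith
  then obtain t where t: "?F t = 1 - a"
    using IVT[of ?F l "1 - a" u] u l cont by force
  have uniq: "s = t" if "measure std_normal {s<..} = a" for s
  proof -
    have s: "?F s = 1 - a" using that by (simp add: std_normal_upper)
    have lt: "?F x < ?F y" if "x < y" for x y
      using std_normal.cdf_diff_eq[OF that] std_normal_Ioc_pos[OF that] by simp
    show ?thesis using lt[of s t] lt[of t s] s t by fastforce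
  qed
  show ?thesis
    unfolding normal_upper_quantile_def
    by (rule theI2[of _ t]) (use t uniq in \<open>auto simp: std_normal_upper\<close>)
qed

lemma std_normal_lower: "measure std_normal {..<- t} = measure std_normal {t<..}"
proof -
  have "measure (distr std_normal borel uminus) {t<..} = measure std_normal (uminus -` {t<..} \<inter> space std_normal)"
    by (intro measure_distr) auto
  also have "uminus -` {t<..} \<inter> space std_normal = {..<- t}" by auto
  finally show ?thesis by (simp add: std_normal_uminus)
qed

text \<open>By symmetry the mass below a negative quantile \<open>t\<close> equals the mass above
  \<open>- t\<close>, which is strictly less than the mass \<open>a\<close> above \<open>t\<close>.
  Then \<open>1 - a < a\<close>, against \<open>a \<le> 1 / 2\<close>.\<close>

lemma normal_upper_quantile_nonneg:
  assumes a: "0 < a" "a \<le> 1 / 2"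
  shows "normal_upper_quantile a \<ge> 0"
proof (rule ccontr)
  define t where "t = normal_upper_quantile a"
  assume "\<not> normal_upper_quantile a \<ge> 0"
  then have t: "t < 0" by (simp add: t_def)
  have 1: "measure std_normal {t<..} = a" unfolding t_def using a by (intro normal_upper_quantile_eq) auto
  have 2: "measure std_normal {..<- (- t)} = measure std_normal {- t<..}" by (rule std_normal_lower)
  have 3: "measure std_normal {..t} = measure std_normal {..<t}"
  proof -
    have "{..t} = {..<t} \<union> {t}" by auto
    then show ?thesis
      using std_normal.finite_measure_Union[of "{..<t}" "{t}"] std_normal_singleton[of t] by simp
  qed
  have 4: "measure std_normal {t<..} = measure std_normal {t<..- t} + measure std_normal {- t<..}"
  proof -
    have "{t<..} = {t<..- t} \<union> {- t<..}" "{t<..- t} \<inter> {- t<..} = {}" using t by auto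
    then show ?thesis
      using std_normal.finite_measure_Union[of "{t<..- t}" "{- t<..}"] by simp
  qed
  have 5: "measure std_normal {t<..- t} > 0" using t by (intro std_normal_Ioc_pos) auto
  show False
    using 1 2 3 4 5 std_normal_upper[of t] a by (simp add: cdf_def)
qed

lemma std_normal_central:
  assumes a: "0 < a" "a < 1"
  shows "measure std_normal {x. \<bar>x\<bar> \<le> normal_upper_quantile (a / 2)} = 1 - a"
proof -
  define z where "z = normal_upper_quantile (a / 2)"
  have z: "z \<ge> 0" unfolding z_def using a by (intro normal_upper_quantile_nonneg) auto
  have u: "measure std_normal {z<..} = a / 2"
    unfolding z_def using a by (intro normal_upper_quantile_eq) auto
  have "{x. \<bar>x\<bar> \<le> z} = space std_normal - ({..<- z} \<union> {z<..})" by auto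
  then have "measure std_normal {x. \<bar>x\<bar> \<le> z} = 1 - measure std_normal ({..<- z} \<union> {z<..})"
    by (simp only:) (subst std_normal.prob_compl, auto)
  also have "measure std_normal ({..<- z} \<union> {z<..}) = measure std_normal {..<- z} + measure std_normal {z<..}"
    using z by (intro std_normal.finite_measure_Union) auto
  finally show ?thesis by (simp add: u std_normal_lower z_def[symmetric])
qed

lemma std_normal_mgf: "(\<integral>\<^sup>+ x. ennreal (exp (c * x)) \<partial>std_normal) = ennreal (exp (c\<^sup>2 / 2))"
proof -
  have e: "std_normal_density x * exp (c * x) = exp (c\<^sup>2 / 2) * normal_density c 1 x" for x
    by (simp add: normal_density_def exp_add[symmetric] power2_eq_square field_simps)
  have "(\<integral>\<^sup>+ x. ennreal (exp (c * x)) \<partial>std_normal) =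
    (\<integral>\<^sup>+ x. ennreal (exp (c\<^sup>2 / 2)) * ennreal (normal_density c 1 x) \<partial>lborel)"
    by (subst nn_integral_density) (auto simp: e simp flip: ennreal_mult)
  also have "\<dots> = ennreal (exp (c\<^sup>2 / 2)) * (\<integral>\<^sup>+ x. ennreal (normal_density c 1 x) \<partial>lborel)"
    by (rule nn_integral_cmult) auto
  also have "(\<integral>\<^sup>+ x. ennreal (normal_density c 1 x) \<partial>lborel) = 1"
    using prob_space.emeasure_space_1[OF prob_space_normal_density[of 1 c]] by (auto simp: emeasure_density)
  finally show ?thesis by simp
qed

lemma std_normal_tail:
  assumes t: "t > 0"
  shows "emeasure std_normal {x. \<bar>x\<bar> \<ge> t} \<le> ennreal (2 * exp (- (t\<^sup>2 / 2)))"
proof -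
  have "emeasure std_normal {x \<in> space std_normal. x \<ge> t} \<le>
    ennreal (exp (- t * t)) * (\<integral>\<^sup>+ x\<in>space std_normal. ennreal (exp (t * x)) \<partial>std_normal)"
    using t by (intro Chernoff_ineq_nn_integral_ge) auto
  also have "\<dots> = ennreal (exp (- (t\<^sup>2 / 2)))"
    by (simp add: std_normal_mgf power2_eq_square flip: ennreal_mult exp_add)
  finally have up: "emeasure std_normal {x. x \<ge> t} \<le> ennreal (exp (- (t\<^sup>2 / 2)))" by simp
  have "emeasure std_normal {x \<in> space std_normal. x \<le> - t} \<le>
    ennreal (exp (t * (- t))) * (\<integral>\<^sup>+ x\<in>space std_normal. ennreal (exp (- t * x)) \<partial>std_normal)"
    using t by (intro Chernoff_ineq_nn_integral_le) auto
  also have "\<dots> = ennreal (exp (- (t\<^sup>2 / 2)))"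
    using std_normal_mgf[of "- t"] by (simp add: power2_eq_square flip: ennreal_mult exp_add)
  finally have lo: "emeasure std_normal {x. x \<le> - t} \<le> ennreal (exp (- (t\<^sup>2 / 2)))" by simp
  have "emeasure std_normal {x. \<bar>x\<bar> \<ge> t} \<le> emeasure std_normal ({x. x \<ge> t} \<union> {x. x \<le> - t})"
    by (intro emeasure_mono) auto
  also have "\<dots> \<le> emeasure std_normal {x. x \<ge> t} + emeasure std_normal {x. x \<le> - t}"
    by (intro emeasure_subadditive) auto
  also have "\<dots> \<le> ennreal (exp (- (t\<^sup>2 / 2))) + ennreal (exp (- (t\<^sup>2 / 2)))" by (intro add_mono up lo)
  finally show ?thesis by (simp flip: ennreal_plus)
qed

section \<open>Linear forms in Gaussian noise\<close>

lemma PiM_density: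
  fixes f :: "'a::euclidean_space \<Rightarrow> real"
  assumes I: "finite I" and f [measurable]: "f \<in> borel_measurable borel" and f0: "\<And>x. f x \<ge> 0"
    and prob: "prob_space (density lborel f)"
  shows "density (\<Pi>\<^sub>M i\<in>I. lborel) (\<lambda>x. ennreal (\<Prod>i\<in>I. f (x i))) = (\<Pi>\<^sub>M i\<in>I. density lborel f)"
proof -
  interpret prob_space "density lborel f" by fact
  interpret D: product_sigma_finite "\<lambda>_. density lborel f" by standard
  interpret L: product_sigma_finite "\<lambda>_. lborel :: 'a measure" by standard
  show ?thesis
  proof (rule D.PiM_eqI[OF I])
    show "sets (density (\<Pi>\<^sub>M i\<in>I. lborel) (\<lambda>x. ennreal (\<Prod>i\<in>I. f (x i)))) = sets (\<Pi>\<^sub>M i\<in>I. density lborel f)"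
      by (simp cong: sets_PiM_cong)
    fix A assume A: "\<And>i. i \<in> I \<Longrightarrow> A i \<in> sets (density lborel f)"
    then have [measurable]: "\<And>i. i \<in> I \<Longrightarrow> A i \<in> sets borel" by simp
    have P: "Pi\<^sub>E I A \<in> sets (\<Pi>\<^sub>M i\<in>I. lborel)" using I by (intro sets_PiM_I_finite) auto
    have "emeasure (density (\<Pi>\<^sub>M i\<in>I. lborel) (\<lambda>x. ennreal (\<Prod>i\<in>I. f (x i)))) (Pi\<^sub>E I A) =
      (\<integral>\<^sup>+ x. ennreal (\<Prod>i\<in>I. f (x i)) * indicator (Pi\<^sub>E I A) x \<partial>(\<Pi>\<^sub>M i\<in>I. lborel))"
      using P by (subst emeasure_density) auto
    also have "\<dots> = (\<integral>\<^sup>+ x. (\<Prod>i\<in>I. ennreal (f (x i)) * indicator (A i) (x i)) \<partial>(\<Pi>\<^sub>M i\<in>I. lborel))"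
    proof (rule nn_integral_cong)
      fix x assume x: "x \<in> space (\<Pi>\<^sub>M i\<in>I. lborel :: 'a measure)"
      have "indicator (Pi\<^sub>E I A) x = (\<Prod>i\<in>I. indicator (A i) (x i) :: ennreal)"
        using x I by (auto simp: indicator_def space_PiM PiE_def Pi_def)
      then show "ennreal (\<Prod>i\<in>I. f (x i)) * indicator (Pi\<^sub>E I A) x =
        (\<Prod>i\<in>I. ennreal (f (x i)) * indicator (A i) (x i))"
        using f0 by (simp add: prod.distrib prod_ennreal)
    qed
    also have "\<dots> = (\<Prod>i\<in>I. \<integral>\<^sup>+ x. ennreal (f x) * indicator (A i) x \<partial>lborel)"
      by (rule L.product_nn_integral_prod) (use I in auto)
    also have "\<dots> = (\<Prod>i\<in>I. emeasure (density lborel f) (A i))"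
      by (intro prod.cong refl) (subst emeasure_density, auto)
    finally show "emeasure (density (\<Pi>\<^sub>M i\<in>I. lborel) (\<lambda>x. ennreal (\<Prod>i\<in>I. f (x i)))) (Pi\<^sub>E I A) =
      (\<Prod>i\<in>I. emeasure (density lborel f) (A i))" .
  qed
qed

lemma precision_pair_scalar:
  assumes \<sigma>: "\<sigma> > (0::real)"
  shows "precision_pair n ((1 / \<sigma>\<^sup>2) \<cdot>\<^sub>m 1\<^sub>m n) (\<sigma>\<^sup>2 \<cdot>\<^sub>m 1\<^sub>m n)"
    and "quad_form n (\<lambda>i j. ((1 / \<sigma>\<^sup>2) \<cdot>\<^sub>m 1\<^sub>m n) $$ (i, j)) x = (\<Sum>i<n. (x i)\<^sup>2) / \<sigma>\<^sup>2"
    and "quad_form n (\<lambda>i j. (\<sigma>\<^sup>2 \<cdot>\<^sub>m 1\<^sub>m n) $$ (i, j)) x = \<sigma>\<^sup>2 * (\<Sum>i<n. (x i)\<^sup>2)"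
proof -
  have q: "quad_form n (\<lambda>i j. (c \<cdot>\<^sub>m 1\<^sub>m n) $$ (i, j)) x = c * (\<Sum>i<n. (x i)\<^sup>2)" for c :: real and x
  proof -
    have "(\<Sum>j<n. (c \<cdot>\<^sub>m 1\<^sub>m n) $$ (i, j) * x j) = c * x i" if "i < n" for i
    proof -
      have "(\<Sum>j<n. (c \<cdot>\<^sub>m 1\<^sub>m n) $$ (i, j) * x j) = (\<Sum>j<n. c * ((if i = j then 1 else 0) * x j))"
        using that by (intro sum.cong) auto
      then show ?thesis using that by (simp add: sum_lessThan_delta flip: sum_distrib_left)
    qed
    then show ?thesis
      by (simp add: quad_form_alt sum_distrib_left power2_eq_square mult_ac)
  qed
  have m: "((1 / \<sigma>\<^sup>2) \<cdot>\<^sub>m 1\<^sub>m n) * (\<sigma>\<^sup>2 \<cdot>\<^sub>m 1\<^sub>m n) = 1\<^sub>m n" "(\<sigma>\<^sup>2 \<cdot>\<^sub>m 1\<^sub>m n) * ((1 / \<sigma>\<^sup>2) \<cdot>\<^sub>m 1\<^sub>m n) = 1\<^sub>m n"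
    using \<sigma> by (auto simp: mult_smult_assoc_mat[of _ n n _ n] mult_smult_distrib[of _ n n _ n])
  have "pos_def n (\<lambda>i j. ((1 / \<sigma>\<^sup>2) \<cdot>\<^sub>m 1\<^sub>m n) $$ (i, j))"
    unfolding pos_def_def q
  proof (intro conjI allI impI)
    fix x :: "nat \<Rightarrow> real" assume "\<exists>i<n. x i \<noteq> 0"
    then have "(\<Sum>i<n. (x i)\<^sup>2) > 0" by (auto intro: sum_pos2)
    then show "1 / \<sigma>\<^sup>2 * (\<Sum>i<n. (x i)\<^sup>2) > 0" using \<sigma> by simp
  qed auto
  moreover have "mat_inverse (\<sigma>\<^sup>2 \<cdot>\<^sub>m 1\<^sub>m n) = Some ((1 / \<sigma>\<^sup>2) \<cdot>\<^sub>m 1\<^sub>m n)"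
    by (rule mat_inverse_SomeI) (use m in auto)
  ultimately show "precision_pair n ((1 / \<sigma>\<^sup>2) \<cdot>\<^sub>m 1\<^sub>m n) (\<sigma>\<^sup>2 \<cdot>\<^sub>m 1\<^sub>m n)"
    using m by (simp add: precision_pair_def)
  show "quad_form n (\<lambda>i j. ((1 / \<sigma>\<^sup>2) \<cdot>\<^sub>m 1\<^sub>m n) $$ (i, j)) x = (\<Sum>i<n. (x i)\<^sup>2) / \<sigma>\<^sup>2"
    "quad_form n (\<lambda>i j. (\<sigma>\<^sup>2 \<cdot>\<^sub>m 1\<^sub>m n) $$ (i, j)) x = \<sigma>\<^sup>2 * (\<Sum>i<n. (x i)\<^sup>2)"
    unfolding q by auto
qed

text \<open>The joint density factorises for scalar covariance. As a product measure the noise law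
  has independent coordinates, which is what sums of normals and products of Laplace transforms
  require.\<close>

lemma mvn_scalar_eq_PiM:
  assumes \<sigma>: "\<sigma> > 0"
  shows "mvn n (\<sigma>\<^sup>2 \<cdot>\<^sub>m 1\<^sub>m n) = (\<Pi>\<^sub>M i\<in>{..<n}. density lborel (normal_density 0 \<sigma>))"
proof -
  note pp = precision_pair_scalar[OF \<sigma>, of n]
  have det: "det ((1 / \<sigma>\<^sup>2) \<cdot>\<^sub>m 1\<^sub>m n) = (1 / \<sigma>\<^sup>2) ^ n" by (simp add: det_smult)
  have "(\<Prod>i<n. normal_density 0 \<sigma> (x i)) =
    sqrt ((1 / \<sigma>\<^sup>2) ^ n / (2 * pi) ^ n) * exp (- ((\<Sum>i<n. (x i)\<^sup>2) / \<sigma>\<^sup>2) / 2)" for x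
  proof -
    have "(\<Prod>i<n. normal_density 0 \<sigma> (x i)) = (\<Prod>i<n. (1 / sqrt (2 * pi * \<sigma>\<^sup>2)) * exp (- ((x i)\<^sup>2 / \<sigma>\<^sup>2 / 2)))"
      by (intro prod.cong) (auto simp: normal_density_def)
    also have "\<dots> = (1 / sqrt (2 * pi * \<sigma>\<^sup>2)) ^ n * exp (\<Sum>i<n. - ((x i)\<^sup>2 / \<sigma>\<^sup>2 / 2))"
      by (simp only: prod.distrib prod_constant card_lessThan exp_sum finite_lessThan)
    also have "(1 / sqrt (2 * pi * \<sigma>\<^sup>2)) ^ n = sqrt ((1 / \<sigma>\<^sup>2) ^ n / (2 * pi) ^ n)"
    proof -
      have "(1 / \<sigma>\<^sup>2) ^ n / (2 * pi) ^ n = (1 / (2 * pi * \<sigma>\<^sup>2)) ^ n"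
        by (simp add: power_divide power_mult_distrib)
      then show ?thesis by (simp only: real_sqrt_power real_sqrt_divide real_sqrt_one)
    qed
    also have "(\<Sum>i<n. - ((x i)\<^sup>2 / \<sigma>\<^sup>2 / 2)) = - ((\<Sum>i<n. (x i)\<^sup>2) / \<sigma>\<^sup>2) / 2"
      by (simp add: sum_negf sum_divide_distrib)
    finally show ?thesis .
  qed
  then have "mvn n (\<sigma>\<^sup>2 \<cdot>\<^sub>m 1\<^sub>m n) = density (\<Pi>\<^sub>M i\<in>{..<n}. lborel) (\<lambda>x. ennreal (\<Prod>i<n. normal_density 0 \<sigma> (x i)))"
    unfolding mvn_eq_density[OF pp(1)] pp(2) det
    by (simp add: ennreal_mult'')
  also have "\<dots> = (\<Pi>\<^sub>M i\<in>{..<n}. density lborel (normal_density 0 \<sigma>))"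
    by (rule PiM_density) (use \<sigma> in \<open>auto intro: prob_space_normal_density\<close>)
  finally show ?thesis .
qed

lemma distr_linear_normal:
  assumes \<sigma>: "\<sigma> > 0" and a: "\<exists>i<n. a i \<noteq> 0"
  shows "distr (mvn n (\<sigma>\<^sup>2 \<cdot>\<^sub>m 1\<^sub>m n)) borel (\<lambda>e. (\<Sum>i<n. a i * e i) / (\<sigma> * L2_set a {..<n})) = std_normal"
proof -
  define D where "D = density lborel (\<lambda>x. ennreal (normal_density 0 \<sigma> x))"
  define P where "P = (\<Pi>\<^sub>M i\<in>{..<n}. D)"
  have D: "prob_space D" unfolding D_def using \<sigma> by (rule prob_space_normal_density)
  interpret P: prob_space P unfolding P_def by (intro prob_space_PiM D)
  have setsD [measurable_cong]: "sets D = sets borel" by (simp add: D_def)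
  \<comment> \<open>A vanishing coefficient would contribute a degenerate normal, which the theorem
    on sums of independent normals excludes.\<close>
  define I where "I = {i \<in> {..<n}. a i \<noteq> 0}"
  have I: "finite I" "I \<noteq> {}" using a by (auto simp: I_def)
  have n: "{..<n} \<noteq> {}" using a by auto
  have comp: "distr P borel (\<lambda>x. x i) = D" if "i < n" for i
  proof -
    have "distr P borel (\<lambda>x. x i) = distr P D (\<lambda>x. x i)" by (intro distr_cong) (auto simp: setsD)
    also have "\<dots> = D" unfolding P_def using that D by (intro distr_PiM_component) auto
    finally show ?thesis .
  qed
  have mcomp [measurable]: "(\<lambda>x. x i) \<in> borel_measurable P" if "i < n" for i
    using that unfolding P_def by (intro measurable_PiM_component_rev measurable_component_singleton) (auto simp: setsD cong: measurable_cong_sets)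
  have "P.indep_vars (\<lambda>_. borel) (\<lambda>i x. x i) {..<n}"
  proof (subst P.indep_vars_iff_distr_eq_PiM'[OF n])
    have "distr P (\<Pi>\<^sub>M i\<in>{..<n}. borel) (\<lambda>x. \<lambda>i\<in>{..<n}. x i) = distr P P (\<lambda>x. x)"
      by (intro distr_cong) (auto simp: P_def setsD space_PiM PiE_def extensional_restrict cong: sets_PiM_cong)
    also have "\<dots> = P" by (rule distr_id2) auto
    also have "P = (\<Pi>\<^sub>M i\<in>{..<n}. distr P borel (\<lambda>x. x i))"
      unfolding P_def by (intro PiM_cong) (auto simp: comp[unfolded P_def])
    finally show "distr P (\<Pi>\<^sub>M i\<in>{..<n}. borel) (\<lambda>x. \<lambda>i\<in>{..<n}. x i) = (\<Pi>\<^sub>M i\<in>{..<n}. distr P borel (\<lambda>x. x i))" .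
  qed (use mcomp in auto)
  then have "P.indep_vars (\<lambda>_. borel) (\<lambda>i x. x i) I"
    by (rule P.indep_vars_subset) (auto simp: I_def)
  then have ind: "P.indep_vars (\<lambda>_. borel) (\<lambda>i x. a i * x i) I"
    using P.indep_vars_compose2[of "\<lambda>_. borel" "\<lambda>i x. x i" I "\<lambda>i x. a i * x" "\<lambda>_. borel"] by simp
  have nd: "distributed P lborel (\<lambda>x. a i * x i) (normal_density 0 (\<bar>a i\<bar> * \<sigma>))" if "i \<in> I" for i
  proof -
    have i: "i < n" "a i \<noteq> 0" using that by (auto simp: I_def)
    have "distr P lborel (\<lambda>x. x i) = distr P borel (\<lambda>x. x i)" by (intro distr_cong) auto
    then have "distributed P lborel (\<lambda>x. x i) (normal_density 0 \<sigma>)"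
      using i by (simp add: distributed_def comp D_def)
    then have "distributed P lborel (\<lambda>x. 0 + a i * x i) (normal_density (0 + a i * 0) (\<bar>a i\<bar> * \<sigma>))"
      using \<sigma> i by (intro P.normal_density_affine) auto
    then show ?thesis by simp
  qed
  have pos: "0 < \<bar>a i\<bar> * \<sigma>" if "i \<in> I" for i using that \<sigma> by (auto simp: I_def)
  have "distributed P lborel (\<lambda>x. \<Sum>i\<in>I. a i * x i) (normal_density (\<Sum>i\<in>I. 0) (sqrt (\<Sum>i\<in>I. (\<bar>a i\<bar> * \<sigma>)\<^sup>2)))"
    by (rule P.sum_indep_normal[OF I ind pos nd])
  also have "(\<lambda>x. \<Sum>i\<in>I. a i * x i) = (\<lambda>x. \<Sum>i<n. a i * x i)"
    by (intro ext sum.mono_neutral_left) (auto simp: I_def)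
  also have "(\<Sum>i\<in>I. (\<bar>a i\<bar> * \<sigma>)\<^sup>2) = (\<Sum>i<n. (\<bar>a i\<bar> * \<sigma>)\<^sup>2)"
    by (intro sum.mono_neutral_left) (auto simp: I_def)
  also have "sqrt (\<Sum>i<n. (\<bar>a i\<bar> * \<sigma>)\<^sup>2) = \<sigma> * L2_set a {..<n}"
    using \<sigma> by (simp add: L2_set_def power_mult_distrib sum_distrib_right[symmetric] real_sqrt_mult)
  finally have dist: "distributed P lborel (\<lambda>x. \<Sum>i<n. a i * x i) (normal_density 0 (\<sigma> * L2_set a {..<n}))"
    by simp
  have L: "L2_set a {..<n} > 0"
    using a by (auto simp: L2_set_def intro: sum_pos2)
  define c where "c = 1 / (\<sigma> * L2_set a {..<n})"
  have c: "c > 0" using L \<sigma> by (simp add: c_def)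
  have "distributed P lborel (\<lambda>x. 0 + c * (\<Sum>i<n. a i * x i)) (normal_density (0 + c * 0) (\<bar>c\<bar> * (\<sigma> * L2_set a {..<n})))"
    using L \<sigma> c by (intro P.normal_density_affine[OF dist]) auto
  moreover have "\<bar>c\<bar> * (\<sigma> * L2_set a {..<n}) = 1" using c L \<sigma> by (simp add: c_def)
  ultimately have "distr P lborel (\<lambda>x. c * (\<Sum>i<n. a i * x i)) = std_normal"
    by (simp add: distributed_def)
  moreover have "distr P lborel (\<lambda>x. c * (\<Sum>i<n. a i * x i)) = distr P borel (\<lambda>e. (\<Sum>i<n. a i * e i) / (\<sigma> * L2_set a {..<n}))"
    by (intro distr_cong) (auto simp: c_def)
  ultimately show ?thesis
    using mvn_scalar_eq_PiM[OF \<sigma>, of n] by (simp add: P_def D_def)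
qed

lemma measurable_mvn_coordinate [measurable]: "i < n \<Longrightarrow> (\<lambda>x. x i) \<in> borel_measurable (mvn n S)"
  using measurable_component_singleton[of i "{..<n}" "\<lambda>_. borel :: real measure"]
  by (simp add: measurable_cong_sets[OF sets_mvn refl])

text \<open>An inequality rather than an equality, because the event is certain when all
  coefficients vanish. This happens in particular when \<open>uhat\<close> is the zero vector for
  lack of a feasible direction.\<close>

lemma mvn_linear_central:
  assumes \<sigma>: "\<sigma> > 0" and \<alpha>: "0 < \<alpha>" "\<alpha> < 1"
  shows "emeasure (mvn n (\<sigma>\<^sup>2 \<cdot>\<^sub>m 1\<^sub>m n)) {e \<in> space (mvn n (\<sigma>\<^sup>2 \<cdot>\<^sub>m 1\<^sub>m n)).
    \<bar>\<Sum>i<n. a i * e i\<bar> \<le> \<sigma> * L2_set a {..<n} * normal_upper_quantile (\<alpha> / 2)} \<ge> ennreal (1 - \<alpha>)"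
proof (cases "\<exists>i<n. a i \<noteq> 0")
  case True
  let ?M = "mvn n (\<sigma>\<^sup>2 \<cdot>\<^sub>m 1\<^sub>m n)" and ?z = "normal_upper_quantile (\<alpha> / 2)"
  have L: "L2_set a {..<n} > 0"
    using True by (auto simp: L2_set_def intro: sum_pos2)
  have "emeasure std_normal {x. \<bar>x\<bar> \<le> ?z} = ennreal (1 - \<alpha>)"
    by (simp add: std_normal.emeasure_eq_measure std_normal_central \<alpha>)
  also have "emeasure std_normal {x. \<bar>x\<bar> \<le> ?z} =
    emeasure ?M ((\<lambda>e. (\<Sum>i<n. a i * e i) / (\<sigma> * L2_set a {..<n})) -` {x. \<bar>x\<bar> \<le> ?z} \<inter> space ?M)"
    unfolding distr_linear_normal[OF \<sigma> True, symmetric] by (rule emeasure_distr) auto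
  also have "(\<lambda>e. (\<Sum>i<n. a i * e i) / (\<sigma> * L2_set a {..<n})) -` {x. \<bar>x\<bar> \<le> ?z} \<inter> space ?M =
    {e \<in> space ?M. \<bar>\<Sum>i<n. a i * e i\<bar> \<le> \<sigma> * L2_set a {..<n} * ?z}"
    using L \<sigma> by (auto simp: abs_divide field_simps)
  finally show ?thesis by simp
next
  case False
  interpret prob_space "mvn n (\<sigma>\<^sup>2 \<cdot>\<^sub>m 1\<^sub>m n)" by (rule prob_space_mvn[OF precision_pair_scalar(1)[OF \<sigma>]])
  have "L2_set a {..<n} = 0" "\<And>e. (\<Sum>i<n. a i * e i) = 0" using False by (auto simp: L2_set_def)
  then show ?thesis using \<alpha> by (simp add: emeasure_space_1)
qed

text \<open>The strict inequality in the event makes it empty when all coefficients vanish, so that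
  no column of the design has to be excluded.\<close>

lemma mvn_linear_tail:
  assumes \<sigma>: "\<sigma> > 0" and t: "t > 0"
  shows "emeasure (mvn n (\<sigma>\<^sup>2 \<cdot>\<^sub>m 1\<^sub>m n)) {e \<in> space (mvn n (\<sigma>\<^sup>2 \<cdot>\<^sub>m 1\<^sub>m n)).
    \<bar>\<Sum>i<n. a i * e i\<bar> > \<sigma> * L2_set a {..<n} * t} \<le> ennreal (2 * exp (- (t\<^sup>2 / 2)))"
proof (cases "\<exists>i<n. a i \<noteq> 0")
  case True
  let ?M = "mvn n (\<sigma>\<^sup>2 \<cdot>\<^sub>m 1\<^sub>m n)"
  have L: "L2_set a {..<n} > 0"
    using True by (auto simp: L2_set_def intro: sum_pos2)
  have "emeasure ?M {e \<in> space ?M. \<bar>\<Sum>i<n. a i * e i\<bar> > \<sigma> * L2_set a {..<n} * t} \<le>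
    emeasure ?M ((\<lambda>e. (\<Sum>i<n. a i * e i) / (\<sigma> * L2_set a {..<n})) -` {x. \<bar>x\<bar> \<ge> t} \<inter> space ?M)"
    using L \<sigma> by (intro emeasure_mono measurable_sets_borel) (auto simp: abs_divide field_simps)
  also have "\<dots> = emeasure std_normal {x. \<bar>x\<bar> \<ge> t}"
    unfolding distr_linear_normal[OF \<sigma> True, symmetric] by (rule emeasure_distr[symmetric]) auto
  also have "\<dots> \<le> ennreal (2 * exp (- (t\<^sup>2 / 2)))" by (rule std_normal_tail[OF t])
  finally show ?thesis .
next
  case False
  then have "L2_set a {..<n} = 0" "\<And>e. (\<Sum>i<n. a i * e i) = 0" by (auto simp: L2_set_def)
  then show ?thesis by simp
qed

section \<open>Maurey's empirical method\<close>

lemma exists_le_weighted_mean: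
  fixes f q :: "'k \<Rightarrow> real"
  assumes K: "finite K" and q: "\<And>a. a \<in> K \<Longrightarrow> q a \<ge> 0" "(\<Sum>a\<in>K. q a) = 1"
  shows "\<exists>a\<in>K. f a \<le> (\<Sum>a\<in>K. q a * f a)"
proof (rule ccontr)
  define m where "m = (\<Sum>a\<in>K. q a * f a)"
  assume "\<not> ?thesis"
  then have gt: "f a > m" if "a \<in> K" for a using that by (auto simp: m_def not_le)
  obtain b where b: "b \<in> K" "q b \<noteq> 0" using q(2) by (metis sum.neutral zero_neq_one)
  have "(\<Sum>a\<in>K. q a * (f a - m)) > 0"
    by (rule sum_pos2[OF K b(1)]) (use b q gt in \<open>auto simp: less_le\<close>)
  moreover have "(\<Sum>a\<in>K. q a * (f a - m)) = m - (\<Sum>a\<in>K. q a) * m"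
    by (simp add: right_diff_distrib sum_subtractf sum_distrib_right m_def)
  ultimately show False by (simp add: q(2))
qed

text \<open>Maurey's empirical method, derandomised by conditional expectations: the right-hand side is
  the mean of the quadratic form when the summands are drawn independently with law \<open>q\<close>.\<close>

lemma maurey_greedy:
  fixes A :: "nat \<Rightarrow> nat \<Rightarrow> real" and z :: "'k \<Rightarrow> nat \<Rightarrow> real"
  assumes sym: "\<And>i j. i < p \<Longrightarrow> j < p \<Longrightarrow> A i j = A j i"
    and K: "finite K" and q: "\<And>a. a \<in> K \<Longrightarrow> q a \<ge> 0" "(\<Sum>a\<in>K. q a) = 1"
  defines "m \<equiv> \<lambda>i. \<Sum>a\<in>K. q a * z a i"
  shows "\<exists>xs. length xs = M \<and> set xs \<subseteq> K \<and>
    quad_form p A (\<lambda>i. S i + (\<Sum>a\<leftarrow>xs. z a i)) \<le>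
      quad_form p A S + 2 * real M * (\<Sum>i<p. S i * (\<Sum>j<p. A i j * m j))
      + real M * (real M - 1) * quad_form p A m + real M * (\<Sum>a\<in>K. q a * quad_form p A (z a))"
proof (induction M arbitrary: S)
  case 0
  show ?case by (intro exI[of _ "[]"]) simp
next
  case (Suc M)
  define B where "B = (\<lambda>x y. \<Sum>i<p. x i * (\<Sum>j<p. A i j * y j))"
  define T where "T = (\<Sum>a\<in>K. q a * quad_form p A (z a))"
  \<comment> \<open>The induction hypothesis applied to the start \<open>S + z a\<close>: the
    conditional mean of the final value after the next summand \<open>a\<close> has been drawn. Its
    average over \<open>a\<close> is the bound for one summand more.\<close>
  define f where "f = (\<lambda>a. quad_form p A (\<lambda>i. S i + z a i) + 2 * real M * B (\<lambda>i. S i + z a i) m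
    + real M * (real M - 1) * quad_form p A m + real M * T)"
  have Q: "quad_form p A (\<lambda>i. S i + z a i) = quad_form p A S + 2 * B S (z a) + quad_form p A (z a)" for a
    using quad_form_add[OF sym, where x = S and c = 1 and y = "z a"] by (simp add: B_def)
  have B: "B (\<lambda>i. S i + z a i) m = B S m + B (z a) m" for a
    by (simp add: B_def distrib_right sum.distrib)
  have BS: "(\<Sum>a\<in>K. q a * B S (z a)) = B S m"
  proof -
    have "(\<Sum>a\<in>K. q a * B S (z a)) = (\<Sum>a\<in>K. \<Sum>i<p. \<Sum>j<p. S i * (A i j * (q a * z a j)))"
      by (simp add: B_def sum_distrib_left mult_ac)
    also have "\<dots> = (\<Sum>i<p. \<Sum>j<p. \<Sum>a\<in>K. S i * (A i j * (q a * z a j)))"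
      by (subst sum.swap) (intro sum.cong refl, rule sum.swap)
    finally show ?thesis by (simp add: B_def m_def sum_distrib_left)
  qed
  have Bz: "(\<Sum>a\<in>K. q a * B (z a) m) = quad_form p A m"
  proof -
    have "(\<Sum>a\<in>K. q a * B (z a) m) = (\<Sum>a\<in>K. \<Sum>i<p. q a * z a i * (\<Sum>j<p. A i j * m j))"
      by (simp add: B_def sum_distrib_left mult_ac)
    also have "\<dots> = (\<Sum>i<p. \<Sum>a\<in>K. q a * z a i * (\<Sum>j<p. A i j * m j))"
      by (rule sum.swap)
    finally show ?thesis by (simp add: quad_form_alt m_def sum_distrib_right)
  qed
  have "\<exists>a\<in>K. f a \<le> (\<Sum>a\<in>K. q a * f a)"
    by (rule exists_le_weighted_mean[OF K q])
  then obtain a where a: "a \<in> K" "f a \<le> (\<Sum>a\<in>K. q a * f a)" by blast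
  have "(\<Sum>a\<in>K. q a * f a) = (\<Sum>a\<in>K. q a * (quad_form p A S + 2 * real M * B S m + real M * (real M - 1) * quad_form p A m + real M * T)
      + 2 * (q a * B S (z a)) + q a * quad_form p A (z a) + 2 * real M * (q a * B (z a) m))"
    by (intro sum.cong refl) (simp add: f_def Q B algebra_simps)
  also have "\<dots> = (quad_form p A S + 2 * real M * B S m + real M * (real M - 1) * quad_form p A m + real M * T)
      + 2 * B S m + T + 2 * real M * quad_form p A m"
    by (simp only: sum.distrib sum_distrib_left[symmetric] sum_distrib_right[symmetric] q(2) BS Bz T_def mult_1)
  also have "\<dots> = quad_form p A S + 2 * real (Suc M) * B S m
      + real (Suc M) * (real (Suc M) - 1) * quad_form p A m + real (Suc M) * T"
    by (simp add: algebra_simps)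
  finally have fa: "f a \<le> quad_form p A S + 2 * real (Suc M) * B S m
      + real (Suc M) * (real (Suc M) - 1) * quad_form p A m + real (Suc M) * T" using a by simp
  obtain xs where xs: "length xs = M" "set xs \<subseteq> K"
    "quad_form p A (\<lambda>i. (S i + z a i) + (\<Sum>a\<leftarrow>xs. z a i)) \<le> f a"
    using Suc.IH[of "\<lambda>i. S i + z a i"] unfolding f_def B_def T_def by blast
  show ?case
    using xs a fa by (intro exI[of _ "a # xs"]) (simp add: add.assoc B_def T_def)
qed

text \<open>Pairs of a coordinate and a sign are drawn with replacement, so repetitions count. Lists
  of fixed length record them, and the union bound needs only the number of such lists.\<close>

definition signed_unit_sum :: "(nat \<times> real) list \<Rightarrow> nat \<Rightarrow> real" where
  "signed_unit_sum xs j = (\<Sum>(k, s)\<leftarrow>xs. if j = k then s else 0)"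

text \<open>The vector \<open>v\<close> is the mean of signed unit vectors scaled by its l1 norm,
  drawn with weights proportional to the absolute entries. For a sum of \<open>N\<close> draws the
  mean of the form is \<open>N * (N - 1)\<close> times its value at \<open>v\<close> plus a diagonal
  part of at most \<open>N * W\<close> times the squared l1 norm. Some draw does not exceed the
  mean, and on draws the form is nonnegative.\<close>

lemma quad_form_lower_bound_maurey:
  fixes A :: "nat \<Rightarrow> nat \<Rightarrow> real"
  assumes sym: "\<And>i j. i < p \<Longrightarrow> j < p \<Longrightarrow> A i j = A j i"
    and nonneg: "\<And>xs. length xs = N \<Longrightarrow> set xs \<subseteq> {..<p} \<times> {-1, 1} \<Longrightarrow> 0 \<le> quad_form p A (signed_unit_sum xs)"
    and diag: "\<And>j. j < p \<Longrightarrow> A j j \<le> W" and N: "N \<ge> 1"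
  shows "- (W * (\<Sum>j<p. \<bar>v j\<bar>)\<^sup>2) \<le> (real N - 1) * quad_form p A v"
proof (cases "(\<Sum>j<p. \<bar>v j\<bar>) = 0")
  case True
  then have "\<forall>j<p. v j = 0" by (subst (asm) sum_nonneg_eq_0_iff) auto
  then have "quad_form p A v = 0" by (simp add: quad_form_def)
  then show ?thesis using True by simp
next
  case False
  define V where "V = (\<Sum>j<p. \<bar>v j\<bar>)"
  have V: "V > 0" using False by (simp add: V_def less_le sum_nonneg)
  define sg where "sg = (\<lambda>j. if v j \<ge> 0 then 1 else -1 :: real)"
  define z where "z = (\<lambda>k j. V * (if j = k then sg k else 0))"
  define q where "q = (\<lambda>j. \<bar>v j\<bar> / V)"
  define m where "m = (\<lambda>i. \<Sum>a<p. q a * z a i)"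
  have q: "(\<Sum>a<p. q a) = 1" using V by (simp add: q_def V_def flip: sum_divide_distrib)
  have q0: "q a \<ge> 0" for a using V by (simp add: q_def)
  have m: "m i = v i" if "i < p" for i
  proof -
    have "m i = (\<Sum>a<p. (q a * V * sg a) * (if i = a then 1 else 0))"
      unfolding m_def z_def by (intro sum.cong) auto
    also have "\<dots> = q i * V * sg i" using that by (rule sum_lessThan_delta)
    also have "\<dots> = v i" using V by (simp add: q_def sg_def)
    finally show ?thesis .
  qed
  obtain xs where xs: "length xs = N" "set xs \<subseteq> {..<p}"
    "quad_form p A (\<lambda>i. 0 + (\<Sum>a\<leftarrow>xs. z a i)) \<le>
      quad_form p A (\<lambda>i. 0) + 2 * real N * (\<Sum>i<p. 0 * (\<Sum>j<p. A i j * m j))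
      + real N * (real N - 1) * quad_form p A m + real N * (\<Sum>a<p. q a * quad_form p A (z a))"
    using maurey_greedy[where p=p and A=A and K="{..<p}" and q=q and z=z and M=N and S="\<lambda>_. 0", OF sym finite_lessThan q0 q]
    unfolding m_def by blast
  define ys where "ys = map (\<lambda>k. (k, sg k)) xs"
  have ys: "(\<Sum>a\<leftarrow>xs. z a i) = V * signed_unit_sum ys i" for i
    unfolding ys_def signed_unit_sum_def z_def by (simp add: sum_list_const_mult o_def)
  have qz: "quad_form p A (z a) = V\<^sup>2 * A a a" if "a < p" for a
  proof -
    have "(\<Sum>j<p. A i j * z a j) = A i a * V * sg a" for i
    proof -
      have "(\<Sum>j<p. A i j * z a j) = (\<Sum>j<p. (A i j * V * sg a) * (if j = a then 1 else 0))"
        unfolding z_def by (intro sum.cong) auto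
      then show ?thesis using that by (simp only: sum_lessThan_delta)
    qed
    then have "quad_form p A (z a) = (\<Sum>i<p. (V * sg a * (A i a * V * sg a)) * (if i = a then 1 else 0))"
      unfolding quad_form_alt by (intro sum.cong) (auto simp: z_def)
    also have "\<dots> = V * sg a * (A a a * V * sg a)" using that by (rule sum_lessThan_delta)
    finally show ?thesis by (simp add: sg_def power2_eq_square)
  qed
  have "quad_form p A (\<lambda>i. V * signed_unit_sum ys i) = V\<^sup>2 * quad_form p A (signed_unit_sum ys)"
    unfolding quad_form_def sum_distrib_left by (intro sum.cong refl) (simp add: power2_eq_square)
  moreover have "0 \<le> quad_form p A (signed_unit_sum ys)"
    using xs by (intro nonneg) (auto simp: ys_def sg_def split: if_splits)
  ultimately have "0 \<le> quad_form p A (\<lambda>i. 0 + (\<Sum>a\<leftarrow>xs. z a i))"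
    by (simp add: ys)
  also note xs(3)
  also have "quad_form p A (\<lambda>i. 0) = 0" by (simp add: quad_form_def)
  also have "quad_form p A m = quad_form p A v" by (rule quad_form_cong) (rule m)
  also have "(\<Sum>a<p. q a * quad_form p A (z a)) \<le> (\<Sum>a<p. q a * (V\<^sup>2 * W))"
    using q0 by (intro sum_mono mult_left_mono) (auto simp: qz diag mult_left_mono)
  also have "(\<Sum>a<p. q a * (V\<^sup>2 * W)) = V\<^sup>2 * W" by (simp add: q flip: sum_distrib_right)
  finally have "0 \<le> real N * ((real N - 1) * quad_form p A v + V\<^sup>2 * W)"
    using N by (simp add: algebra_simps)
  then have "0 \<le> (real N - 1) * quad_form p A v + V\<^sup>2 * W" using N by (simp add: zero_le_mult_iff)
  then show ?thesis by (simp add: V_def mult.commute)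
qed

section \<open>The square-root Lasso\<close>

lemma L2_set_power2: "(L2_set f A)\<^sup>2 = (\<Sum>i\<in>A. (f i)\<^sup>2)"
  by (simp add: L2_set_def sum_nonneg)

lemma sum_le_sqrt_card_L2_set:
  assumes "finite J" "real (card J) \<le> K"
  shows "(\<Sum>j\<in>J. \<bar>f j\<bar>) \<le> sqrt K * L2_set f J"
proof -
  have "(\<Sum>j\<in>J. \<bar>1\<bar> * \<bar>f j\<bar>) \<le> L2_set (\<lambda>_. 1) J * L2_set f J" by (rule L2_set_mult_ineq)
  also have "L2_set (\<lambda>_. 1::real) J \<le> sqrt K" using assms by (simp add: L2_set_def)
  then have "L2_set (\<lambda>_. 1) J * L2_set f J \<le> sqrt K * L2_set f J" by (rule mult_right_mono) simp
  finally show ?thesis by simp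
qed

text \<open>The noise level \<open>404 / 406 = (405 - 1) / (405 + 1)\<close> is the one that yields the cone constant
  405 of the interval.\<close>

locale square_root_lasso =
  fixes n p :: nat and X :: "nat \<Rightarrow> nat \<Rightarrow> real" and e \<beta> b w :: "nat \<Rightarrow> real" and l s :: real and J :: "nat set"
  assumes n: "n > 0" and l: "l > 0" and s: "s > 0"
    and s_def: "s = L2_set e {..<n} / sqrt (real n)"
    and w: "\<And>j. j < p \<Longrightarrow> w j \<ge> 0"
    and J: "J \<subseteq> {..<p}" "\<And>j. j < p \<Longrightarrow> j \<notin> J \<Longrightarrow> \<beta> j = 0"
    and basic: "L2_set (\<lambda>i. e i - (\<Sum>j<p. X i j * (b j - \<beta> j))) {..<n} / sqrt (real n) + l * (\<Sum>j<p. w j * \<bar>b j\<bar>)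
      \<le> s + l * (\<Sum>j<p. w j * \<bar>\<beta> j\<bar>)"
    and noise: "\<And>j. j < p \<Longrightarrow> \<bar>\<Sum>i<n. X i j * e i\<bar> \<le> 404 / 406 * l * s * real n * w j"
begin

definition "h j = b j - \<beta> j"
definition "Xh i = (\<Sum>j<p. X i j * h j)"
definition "a = L2_set Xh {..<n} / sqrt (real n)"
definition "resid = L2_set (\<lambda>i. e i - Xh i) {..<n} / sqrt (real n)"
definition "H = (\<Sum>j\<in>J. w j * \<bar>h j\<bar>)"
definition "Hc = (\<Sum>j\<in>{..<p} - J. w j * \<bar>h j\<bar>)"
definition "P = (\<Sum>i<n. e i * Xh i) / real n"

lemma nonneg: "a \<ge> 0" "resid \<ge> 0" "H \<ge> 0" "Hc \<ge> 0"
  using w J by (auto simp: a_def resid_def H_def Hc_def intro!: sum_nonneg divide_nonneg_nonneg)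

lemma sum_split: "(\<Sum>j<p. f j) = (\<Sum>j\<in>J. f j) + (\<Sum>j\<in>{..<p} - J. f j)" for f :: "nat \<Rightarrow> real"
  using J by (simp add: sum.subset_diff add.commute)

lemma sum_wh: "(\<Sum>j<p. w j * \<bar>h j\<bar>) = H + Hc"
  by (simp add: sum_split H_def Hc_def)

lemma cross_term: "\<bar>P\<bar> \<le> 404 / 406 * l * s * (H + Hc)"
proof -
  have "(\<Sum>i<n. e i * Xh i) = (\<Sum>j<p. h j * (\<Sum>i<n. X i j * e i))"
    unfolding Xh_def sum_distrib_left by (subst sum.swap) (simp add: mult_ac)
  also have "\<bar>\<dots>\<bar> \<le> (\<Sum>j<p. \<bar>h j * (\<Sum>i<n. X i j * e i)\<bar>)" by (rule sum_abs)
  also have "\<dots> \<le> (\<Sum>j<p. \<bar>h j\<bar> * (404 / 406 * l * s * real n * w j))"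
    unfolding abs_mult by (intro sum_mono mult_left_mono noise) auto
  also have "\<dots> = 404 / 406 * l * s * real n * (H + Hc)"
    unfolding sum_wh[symmetric] sum_distrib_left by (intro sum.cong) auto
  finally have "\<bar>\<Sum>i<n. e i * Xh i\<bar> \<le> 404 / 406 * l * s * (H + Hc) * real n" by (simp add: mult_ac)
  then show ?thesis using n by (simp add: P_def abs_divide field_simps)
qed

lemma resid_power2: "resid\<^sup>2 = s\<^sup>2 - 2 * P + a\<^sup>2"
proof -
  have "(\<Sum>i<n. (e i - Xh i)\<^sup>2) = (\<Sum>i<n. (e i)\<^sup>2) - 2 * (\<Sum>i<n. e i * Xh i) + (\<Sum>i<n. (Xh i)\<^sup>2)"
    by (simp add: power2_diff sum.distrib sum_subtractf sum_distrib_left mult_ac)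
  then show ?thesis
    using n by (simp add: resid_def s_def P_def a_def power_divide L2_set_power2 add_divide_distrib diff_divide_distrib)
qed

text \<open>The penalty difference is split over \<open>J\<close>: on \<open>J\<close> the triangle
  inequality costs \<open>H\<close>, and off \<open>J\<close>, where \<open>\<beta>\<close>
  vanishes, all of \<open>Hc\<close> is gained.\<close>

lemma basic': "resid + l * Hc \<le> s + l * H"
proof -
  have "(\<Sum>j<p. w j * \<bar>\<beta> j\<bar>) - (\<Sum>j<p. w j * \<bar>b j\<bar>) = (\<Sum>j<p. w j * (\<bar>\<beta> j\<bar> - \<bar>b j\<bar>))"
    by (simp add: right_diff_distrib sum_subtractf)
  also have "\<dots> = (\<Sum>j\<in>J. w j * (\<bar>\<beta> j\<bar> - \<bar>b j\<bar>)) + (\<Sum>j\<in>{..<p} - J. w j * (\<bar>\<beta> j\<bar> - \<bar>b j\<bar>))"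
    by (rule sum_split)
  also have "\<dots> \<le> H + (- Hc)"
    unfolding H_def Hc_def sum_negf[symmetric]
  proof (intro add_mono sum_mono)
    fix j assume "j \<in> J"
    then show "w j * (\<bar>\<beta> j\<bar> - \<bar>b j\<bar>) \<le> w j * \<bar>h j\<bar>"
      using w J(1) by (intro mult_left_mono) (auto simp: h_def)
  next
    fix j assume "j \<in> {..<p} - J"
    then show "w j * (\<bar>\<beta> j\<bar> - \<bar>b j\<bar>) \<le> - (w j * \<bar>h j\<bar>)"
      using J(2) by (simp add: h_def)
  qed
  finally have "l * ((\<Sum>j<p. w j * \<bar>\<beta> j\<bar>) - (\<Sum>j<p. w j * \<bar>b j\<bar>)) \<le> l * (H - Hc)"
    using l by (intro mult_left_mono) auto
  then show ?thesis
    using basic by (simp add: resid_def Xh_def h_def algebra_simps)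
qed

text \<open>Convexity of the residual norm gives the cone condition without any knowledge of the
  size of the residual at the minimiser.\<close>

lemma cone: "Hc \<le> 405 * H"
proof -
  have "(\<Sum>i<n. e i * (e i - Xh i)) \<le> (\<Sum>i<n. \<bar>e i\<bar> * \<bar>e i - Xh i\<bar>)"
    by (intro sum_mono) (simp flip: abs_mult)
  also have "\<dots> \<le> L2_set e {..<n} * L2_set (\<lambda>i. e i - Xh i) {..<n}" by (rule L2_set_mult_ineq)
  also have "\<dots> = real n * (s * resid)" using n by (simp add: s_def resid_def field_simps)
  finally have "(\<Sum>i<n. e i * (e i - Xh i)) / real n \<le> s * resid" using n by (simp add: field_simps)
  moreover have "(\<Sum>i<n. e i * (e i - Xh i)) / real n = s\<^sup>2 - P"
    using n by (simp add: s_def P_def power_divide L2_set_power2 right_diff_distrib sum_subtractf diff_divide_distrib flip: power2_eq_square)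
  moreover have "s * resid \<le> s * (s + l * (H - Hc))"
    using s basic' by (intro mult_left_mono) (auto simp: algebra_simps)
  moreover have "P \<le> 404 / 406 * l * s * (H + Hc)" using cross_term by linarith
  ultimately have "s\<^sup>2 - 404 / 406 * l * s * (H + Hc) \<le> s * (s + l * (H - Hc))"
    by linarith
  also have "\<dots> = s\<^sup>2 + s * l * (H - Hc)" by (simp add: power2_eq_square algebra_simps)
  finally have "0 \<le> s * l * (H - Hc) + 404 / 406 * l * s * (H + Hc)" by linarith
  \<comment> \<open>The coefficients are \<open>810 = 406 + 404\<close> and
    \<open>2 = 406 - 404\<close>; their quotient is the cone constant 405.\<close>
  also have "\<dots> = s * l / 406 * (810 * H - 2 * Hc)" by (simp add: algebra_simps)
  finally show ?thesis using mult_pos_pos[OF s l] by (simp add: zero_le_mult_iff)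
qed

lemma resid_close: "\<bar>resid - s\<bar> \<le> a"
proof -
  have "L2_set e {..<n} \<le> L2_set (\<lambda>i. e i - Xh i) {..<n} + L2_set Xh {..<n}"
    using L2_set_triangle_ineq[of "\<lambda>i. e i - Xh i" Xh "{..<n}"] by simp
  moreover have "L2_set (\<lambda>i. e i - Xh i) {..<n} \<le> L2_set e {..<n} + L2_set Xh {..<n}"
    using L2_set_triangle_ineq[of e "\<lambda>i. - Xh i" "{..<n}"] by (simp add: L2_set_def)
  ultimately show ?thesis
    using n by (simp add: resid_def s_def a_def abs_le_iff divide_right_mono flip: diff_divide_distrib add_divide_distrib)
qed

context
  fixes W \<kappa> K :: real
  assumes W: "\<And>j. j < p \<Longrightarrow> w j \<le> W" "W > 0" and \<kappa>: "\<kappa> > 0" and K: "real (card J) \<le> K"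
    and re: "\<kappa> * L2_set h J \<le> a" and small: "l * W * sqrt K / \<kappa> \<le> 1 / 10 ^ 6"
begin

lemma H_le: "H \<le> W * sqrt K / \<kappa> * a"
proof -
  have fin: "finite J" using J(1) finite_subset by blast
  have "H \<le> (\<Sum>j\<in>J. W * \<bar>h j\<bar>)"
    unfolding H_def using W J by (intro sum_mono mult_right_mono) auto
  also have "\<dots> = W * (\<Sum>j\<in>J. \<bar>h j\<bar>)" by (simp add: sum_distrib_left)
  also have "\<dots> \<le> W * (sqrt K * L2_set h J)"
    using W fin K by (intro mult_left_mono sum_le_sqrt_card_L2_set) auto
  also have "\<dots> \<le> W * (sqrt K * (a / \<kappa>))"
    using W \<kappa> re K by (intro mult_left_mono) (auto simp: field_simps)
  finally show ?thesis by (simp add: mult_ac)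
qed

text \<open>Squaring the basic inequality and expanding the residual gives a quadratic inequality
  for \<open>a\<close>. The coefficient \<open>810 = 2 + 808\<close> collects the penalty term and,
  by the cone condition, twice the noise term; the smallness assumption absorbs the square of
  \<open>l * H\<close> and raises 810 to 811.\<close>

lemma prediction_error: "a \<le> 811 * s * (l * W * sqrt K / \<kappa>)"
proof -
  define g where "g = l * W * sqrt K / \<kappa>"
  have K0: "K \<ge> 0" using K by linarith
  have g: "0 \<le> g" "g \<le> 1 / 10 ^ 6" using small l W \<kappa> K0 by (auto simp: g_def)
  have lH: "l * H \<le> g * a" using mult_left_mono[OF H_le, of l] l by (simp add: g_def mult_ac)
  have lH0: "0 \<le> l * H" using l nonneg by simp
  have "resid \<le> s + l * H" using basic' nonneg l by (smt (verit) mult_nonneg_nonneg)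
  then have "resid\<^sup>2 \<le> (s + l * H)\<^sup>2" using nonneg by (intro power_mono) auto
  moreover have "2 * P \<le> 808 * s * (l * H)"
  proof -
    have "P \<le> 404 / 406 * l * s * (H + Hc)" using cross_term by linarith
    also have "\<dots> \<le> 404 / 406 * l * s * (406 * H)"
      using cone l s by (intro mult_left_mono) auto
    finally show ?thesis by (simp add: mult_ac)
  qed
  ultimately have "a\<^sup>2 \<le> 810 * s * (l * H) + (l * H)\<^sup>2"
    using resid_power2 by (simp add: power2_eq_square algebra_simps)
  also have "\<dots> \<le> 810 * s * (g * a) + (g * a)\<^sup>2"
    using lH lH0 s by (intro add_mono mult_left_mono power_mono) auto
  finally have "a * a \<le> a * (810 * s * g + g\<^sup>2 * a)"
    by (simp add: power2_eq_square algebra_simps)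
  then have le: "a \<le> 810 * s * g + g\<^sup>2 * a"
    using nonneg s g by (cases "a = 0") (auto simp: mult_le_cancel_left)
  have "g\<^sup>2 \<le> 1 / 10 ^ 6 * (1 / 10 ^ 6)" unfolding power2_eq_square using g by (intro mult_mono) auto
  then have "g\<^sup>2 * a \<le> 1 / 10 ^ 12 * a" using nonneg by (intro mult_right_mono) auto
  with le have "a * (1 - 1 / 10 ^ 12) \<le> 810 * s * g" by (simp add: algebra_simps)
  moreover have "a * (810 / 811) \<le> a * (1 - 1 / 10 ^ 12)" using nonneg by (intro mult_left_mono) auto
  ultimately show ?thesis by (simp add: g_def)
qed

text \<open>The prediction error is below a thousandth of the noise level, so the residual norm,
  which becomes the scale estimate, is close to the noise level. The lower bound also excludes
  interpolation.\<close>

lemma resid_bounds: "999 / 1000 * s \<le> resid" "resid \<le> 1001 / 1000 * s"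
proof -
  have "811 * s * (l * W * sqrt K / \<kappa>) \<le> 811 * s * (1 / 10 ^ 6)"
    using small s by (intro mult_left_mono) auto
  then have "a \<le> s / 1000" using prediction_error s by simp
  then show "999 / 1000 * s \<le> resid" "resid \<le> 1001 / 1000 * s"
    using resid_close by auto
qed

text \<open>The constant is \<open>406 * 811\<close>: the cone condition bounds the full norm by
  \<open>406 * H\<close>, and the prediction error contributes 811.\<close>

lemma weighted_l1_error: "(\<Sum>j<p. w j * \<bar>h j\<bar>) \<le> 329266 * s * l * W\<^sup>2 * K / \<kappa>\<^sup>2"
proof -
  have K0: "K \<ge> 0" using K by linarith
  have "(\<Sum>j<p. w j * \<bar>h j\<bar>) \<le> 406 * H" using sum_wh cone by simp
  also have "\<dots> \<le> 406 * (W * sqrt K / \<kappa> * (811 * s * (l * W * sqrt K / \<kappa>)))"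
    using H_le prediction_error W K0 \<kappa>
    by (intro mult_left_mono order_trans[OF H_le] mult_left_mono) auto
  also have "\<dots> = 329266 * s * l * W\<^sup>2 * (sqrt K * sqrt K) / \<kappa>\<^sup>2"
    by (simp add: power2_eq_square)
  finally show ?thesis using K0 by simp
qed

end

end

section \<open>From the scaled Lasso to the square-root Lasso\<close>

lemma norm_l2_eq_L2_set: "norm_l2 v = L2_set (($) v) {..<dim_vec v}"
  by (simp add: norm_l2_def L2_set_def scalar_prod_def power2_eq_square lessThan_atLeast0)

lemma norm_l2_nonneg [simp]: "norm_l2 v \<ge> 0"
  by (simp add: norm_l2_eq_L2_set)

lemma mult_mat_vec_index:
  "X \<in> carrier_mat n p \<Longrightarrow> v \<in> carrier_vec p \<Longrightarrow> i < n \<Longrightarrow> (X *\<^sub>v v) $ i = (\<Sum>j<p. X $$ (i, j) * v $ j)"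
  by (simp add: scalar_prod_def lessThan_atLeast0)

lemma exists_square_root_lasso_minimiser:
  fixes X :: "nat \<Rightarrow> nat \<Rightarrow> real" and y w :: "nat \<Rightarrow> real" and n p :: nat and l :: real
  assumes n: "n > 0" and l: "l > 0" and w: "\<And>j. j < p \<Longrightarrow> w j > 0"
  defines "f \<equiv> \<lambda>b. L2_set (\<lambda>i. y i - (\<Sum>j<p. X i j * b j)) {..<n} / sqrt (real n) + l * (\<Sum>j<p. w j * \<bar>b j\<bar>)"
  shows "\<exists>b. \<forall>c. f b \<le> f c"
proof -
  \<comment> \<open>Positive weights make the penalty coercive: a competitor no worse than zero has
    its coordinate \<open>j\<close> bounded by \<open>f 0 / (l * w j)\<close>. The sum of these
    bounds is one radius for all coordinates.\<close>
  define R where "R = (\<Sum>j<p. f (\<lambda>_. 0) / (l * w j))"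
  let ?K = "{x :: nat \<Rightarrow> real. (\<forall>i<p. \<bar>x i\<bar> \<le> R) \<and> (\<forall>i\<ge>p. x i = 0)}"
  have f_ge: "l * (w j * \<bar>b j\<bar>) \<le> f b" if "j < p" for b j
  proof -
    have "w j * \<bar>b j\<bar> \<le> (\<Sum>j<p. w j * \<bar>b j\<bar>)"
      using that by (intro member_le_sum) (auto simp: less_imp_le w)
    then have "l * (w j * \<bar>b j\<bar>) \<le> l * (\<Sum>j<p. w j * \<bar>b j\<bar>)" using l by simp
    then show ?thesis by (simp add: f_def add_increasing)
  qed
  have f0: "f (\<lambda>_. 0) \<ge> 0" by (simp add: f_def)
  have R: "f (\<lambda>_. 0) / (l * w j) \<le> R" if "j < p" for j
    unfolding R_def using that f0 l
    by (intro member_le_sum[of j "{..<p}" "\<lambda>j. f (\<lambda>_. 0) / (l * w j)"]) (auto intro!: divide_nonneg_nonneg mult_nonneg_nonneg simp: w less_imp_le)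
  have R0: "R \<ge> 0"
    unfolding R_def using f0 l by (intro sum_nonneg) (auto intro!: divide_nonneg_nonneg mult_nonneg_nonneg simp: w less_imp_le)
  have cont: "continuous_on ?K f"
    unfolding f_def L2_set_def using n by (intro continuous_intros) auto
  have z: "(\<lambda>_. 0) \<in> ?K" using R0 by simp
  then have "?K \<noteq> {}" by (metis (no_types) empty_iff)
  then have "\<exists>b\<in>?K. \<forall>c\<in>?K. f b \<le> f c"
    by (intro continuous_attains_inf compact_box_fun cont)
  then obtain b where b: "b \<in> ?K" "\<And>c. c \<in> ?K \<Longrightarrow> f b \<le> f c" by (elim bexE) (rule that, assumption, drule (1) bspec, assumption)
  have "f b \<le> f c" for c
  proof (cases "f c \<le> f (\<lambda>_. 0)")
    case True
    define c' where "c' = (\<lambda>j. if j < p then c j else 0)"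
    have "\<bar>c j\<bar> \<le> R" if "j < p" for j
    proof -
      have "l * (w j * \<bar>c j\<bar>) \<le> f (\<lambda>_. 0)" using f_ge[OF that, of c] True by simp
      then have "\<bar>c j\<bar> \<le> f (\<lambda>_. 0) / (l * w j)" using l w[OF that] by (simp add: field_simps)
      then show ?thesis using R[OF that] by simp
    qed
    then have "f b \<le> f c'" by (intro b) (auto simp: c'_def)
    also have "f c' = f c" unfolding f_def c'_def by simp
    finally show ?thesis .
  next
    case False
    then show ?thesis using b(2)[OF z] by simp
  qed
  then show ?thesis by blast
qed

text \<open>For fixed \<open>b\<close> the minimum over the scale is \<open>Q b + pen b\<close>,
  attained at the scale \<open>Q b\<close> provided that this is positive. The hypothesis
  \<open>pos\<close> supplies positivity at every vector no worse than \<open>\<beta>\<close>; this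
  places a minimiser inside the open domain and thereby makes the prescribed statistic a
  minimiser.\<close>

lemma scaled_lasso_minimiser:
  fixes bhat :: "real vec \<Rightarrow> real mat \<Rightarrow> real vec" and shat :: "real vec \<Rightarrow> real mat \<Rightarrow> real"
  assumes sl: "scaled_lasso n p bhat shat"
    and X: "X \<in> carrier_mat n p" and y: "y \<in> carrier_vec n" and \<beta>: "\<beta> \<in> carrier_vec p"
    and n: "n > 0" and p: "p \<ge> 2" and col: "\<And>j. j < p \<Longrightarrow> norm_l2 (col X j) > 0"
  defines "Q \<equiv> \<lambda>b. norm_l2 (y - X *\<^sub>v b) / sqrt (real n)"
    and "pen \<equiv> \<lambda>b. sqrt (2.05 * ln (real p) / real n) * (\<Sum>j<p. norm_l2 (col X j) / sqrt (real n) * \<bar>b $ j\<bar>)"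
  assumes pos: "\<And>b. b \<in> carrier_vec p \<Longrightarrow> Q b + pen b \<le> Q \<beta> + pen \<beta> \<Longrightarrow> Q b > 0"
  shows "bhat y X \<in> carrier_vec p" "Q (bhat y X) + pen (bhat y X) \<le> Q \<beta> + pen \<beta>" "shat y X = Q (bhat y X)"
proof -
  define F where "F = scaled_lasso_objective n p y X"
  define D where "D = (\<lambda>(b :: real vec, s). b \<in> carrier_vec p \<and> s > (0::real))"
  have F: "F (b, s) = (Q b)\<^sup>2 / (2 * s) + s / 2 + pen b" for b s
    using n by (simp add: F_def scaled_lasso_objective_def Q_def pen_def power_divide)
  have F_ge: "Q b + pen b \<le> F (b, s)" if "s > 0" for b s
  proof -
    have "0 \<le> (Q b - s)\<^sup>2" by simp
    then have "2 * s * Q b \<le> (Q b)\<^sup>2 + s\<^sup>2" by (simp add: power2_diff mult_ac)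
    then show ?thesis using that by (simp add: F field_simps power2_eq_square)
  qed
  have F_eq: "F (b, Q b) = Q b + pen b" if "Q b > 0" for b
    using that by (simp add: F power2_eq_square)
  have "\<exists>b0. \<forall>c. L2_set (\<lambda>i. y $ i - (\<Sum>j<p. X $$ (i, j) * b0 j)) {..<n} / sqrt (real n)
      + sqrt (2.05 * ln (real p) / real n) * (\<Sum>j<p. norm_l2 (col X j) / sqrt (real n) * \<bar>b0 j\<bar>) \<le>
    L2_set (\<lambda>i. y $ i - (\<Sum>j<p. X $$ (i, j) * c j)) {..<n} / sqrt (real n)
      + sqrt (2.05 * ln (real p) / real n) * (\<Sum>j<p. norm_l2 (col X j) / sqrt (real n) * \<bar>c j\<bar>)"
    by (rule exists_square_root_lasso_minimiser) (use n p col in auto)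
  then obtain b0 where b0: "L2_set (\<lambda>i. y $ i - (\<Sum>j<p. X $$ (i, j) * b0 j)) {..<n} / sqrt (real n)
      + sqrt (2.05 * ln (real p) / real n) * (\<Sum>j<p. norm_l2 (col X j) / sqrt (real n) * \<bar>b0 j\<bar>) \<le>
    L2_set (\<lambda>i. y $ i - (\<Sum>j<p. X $$ (i, j) * c j)) {..<n} / sqrt (real n)
      + sqrt (2.05 * ln (real p) / real n) * (\<Sum>j<p. norm_l2 (col X j) / sqrt (real n) * \<bar>c j\<bar>)" for c
    by blast
  have QL: "Q v = L2_set (\<lambda>i. y $ i - (\<Sum>j<p. X $$ (i, j) * v $ j)) {..<n} / sqrt (real n)" if "v \<in> carrier_vec p" for v
    unfolding Q_def norm_l2_eq_L2_set using X y that
    by (auto simp: mult_mat_vec_index simp del: index_mult_mat_vec intro!: arg_cong2[where f="(/)"] L2_set_cong)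
  define v where "v = vec p b0"
  have v: "v \<in> carrier_vec p" by (simp add: v_def)
  have vmin: "Q v + pen v \<le> Q c + pen c" if "c \<in> carrier_vec p" for c
    using b0[of "($) c"] by (simp add: QL v that pen_def) (simp add: v_def)
  have Qv: "Q v > 0" by (intro pos v vmin \<beta>)
  have "is_arg_min F D (v, Q v)"
    unfolding is_arg_min_linorder
  proof (intro conjI allI impI)
    show "D (v, Q v)" using v Qv by (simp add: D_def)
    fix a assume a: "D a"
    obtain b s where bs: "a = (b, s)" by force
    show "F (v, Q v) \<le> F a"
      using a vmin[of b] F_ge[of s b] F_eq[OF Qv] by (simp add: bs D_def)
  qed
  moreover have "D (bhat y X, shat y X) \<and> ((\<exists>a. is_arg_min F D a) \<longrightarrow> is_arg_min F D (bhat y X, shat y X))"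
    using sl X y unfolding scaled_lasso_def F_def D_def Let_def by blast
  ultimately have D: "D (bhat y X, shat y X)" and am: "\<And>a. D a \<Longrightarrow> F (bhat y X, shat y X) \<le> F a"
    unfolding is_arg_min_linorder by blast+
  define b s where "b = bhat y X" and "s = shat y X"
  have bs: "b \<in> carrier_vec p" "s > 0" using D by (auto simp: D_def b_def s_def)
  have Q\<beta>: "Q \<beta> > 0" by (intro pos \<beta>) simp
  have "F (b, s) \<le> F (\<beta>, Q \<beta>)" unfolding b_def s_def using Q\<beta> \<beta> by (intro am) (simp add: D_def)
  then have g: "Q b + pen b \<le> Q \<beta> + pen \<beta>" using F_ge[OF bs(2), of b] F_eq[OF Q\<beta>] by simp
  have Qb: "Q b > 0" by (intro pos bs g)
  \<comment> \<open>Comparison with the best scale for the same coefficients forces equality in the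
    inequality of arithmetic and geometric means, hence \<open>s = Q b\<close>.\<close>
  have "F (b, s) \<le> F (b, Q b)" unfolding b_def s_def using Qb bs by (intro am) (simp add: D_def b_def)
  then have "(Q b)\<^sup>2 / (2 * s) + s / 2 \<le> Q b" using F_eq[OF Qb] by (simp add: F)
  then have "(Q b)\<^sup>2 + s\<^sup>2 \<le> 2 * s * Q b" using bs by (simp add: field_simps power2_eq_square)
  then have "(Q b - s)\<^sup>2 \<le> 0" by (simp add: power2_diff mult_ac)
  then show "bhat y X \<in> carrier_vec p" "Q (bhat y X) + pen (bhat y X) \<le> Q \<beta> + pen \<beta>" "shat y X = Q (bhat y X)"
    using g bs by (auto simp: b_def s_def)
qed

section \<open>Measurability of the interval\<close>

lemma scalar_prod_sum: "v \<in> carrier_vec p \<Longrightarrow> u \<bullet> v = (\<Sum>j<p. u $ j * v $ j)"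
  by (auto simp: scalar_prod_def lessThan_atLeast0)

lemma sample_cov_mult_index:
  assumes X: "X \<in> carrier_mat n p" and u: "u \<in> carrier_vec p" and j: "j < p"
  shows "(sample_cov n X *\<^sub>v u) $ j = (\<Sum>i<n. X $$ (i, j) * (\<Sum>k<p. X $$ (i, k) * u $ k)) / real n"
proof -
  have "(sample_cov n X *\<^sub>v u) $ j = (\<Sum>k<p. (1 / real n * (\<Sum>i<n. X $$ (i, j) * X $$ (i, k))) * u $ k)"
    using X u j by (auto simp: sample_cov_def scalar_prod_def lessThan_atLeast0 intro!: sum.cong)
  also have "\<dots> = (\<Sum>k<p. \<Sum>i<n. X $$ (i, j) * (X $$ (i, k) * u $ k)) / real n"
    unfolding sum_divide_distrib sum_distrib_left sum_distrib_right by (intro sum.cong refl) simp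
  also have "(\<Sum>k<p. \<Sum>i<n. X $$ (i, j) * (X $$ (i, k) * u $ k)) = (\<Sum>i<n. X $$ (i, j) * (\<Sum>k<p. X $$ (i, k) * u $ k))"
    unfolding sum_distrib_left by (rule sum.swap)
  finally show ?thesis .
qed

lemma sample_cov_carrier: "X \<in> carrier_mat n p \<Longrightarrow> sample_cov n X \<in> carrier_mat p p"
  by (auto simp: sample_cov_def)

lemma sample_cov_quadratic:
  assumes X: "X \<in> carrier_mat n p" and u: "u \<in> carrier_vec p"
  shows "u \<bullet> (sample_cov n X *\<^sub>v u) = (\<Sum>i<n. (\<Sum>k<p. X $$ (i, k) * u $ k)\<^sup>2) / real n"
proof -
  have "u \<bullet> (sample_cov n X *\<^sub>v u) = (\<Sum>j<p. u $ j * (sample_cov n X *\<^sub>v u) $ j)"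
    by (rule scalar_prod_sum[OF mult_mat_vec_carrier[OF sample_cov_carrier[OF X] u]])
  also have "\<dots> = (\<Sum>j<p. \<Sum>i<n. (u $ j * X $$ (i, j)) * (\<Sum>k<p. X $$ (i, k) * u $ k)) / real n"
    unfolding sum_divide_distrib
    by (intro sum.cong refl) (simp add: sample_cov_mult_index[OF X u] sum_divide_distrib sum_distrib_left mult.assoc)
  also have "(\<Sum>j<p. \<Sum>i<n. (u $ j * X $$ (i, j)) * (\<Sum>k<p. X $$ (i, k) * u $ k)) =
    (\<Sum>i<n. (\<Sum>k<p. X $$ (i, k) * u $ k)\<^sup>2)"
    unfolding power2_eq_square
    by (subst sum.swap) (intro sum.cong refl, simp add: sum_distrib_left sum_distrib_right mult_ac)
  finally show ?thesis .
qed

lemma debiased_estimate_eq: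
  assumes X: "X \<in> carrier_mat n p" and u: "u \<in> carrier_vec p" and b: "b \<in> carrier_vec p" and y: "y \<in> carrier_vec n"
  shows "debiased_estimate n \<xi> y X b u = (\<Sum>j<p. \<xi> $ j * b $ j)
    + (\<Sum>j<p. u $ j * (\<Sum>i<n. X $$ (i, j) * (y $ i - (\<Sum>k<p. X $$ (i, k) * b $ k)))) / real n"
proof -
  have c: "((1 / real n) \<cdot>\<^sub>v (transpose_mat X *\<^sub>v (y - X *\<^sub>v b))) $ j =
    (\<Sum>i<n. X $$ (i, j) * (y $ i - (\<Sum>k<p. X $$ (i, k) * b $ k))) / real n" if "j < p" for j
    using X u b y that by (auto simp: scalar_prod_def lessThan_atLeast0 sum_divide_distrib intro!: sum.cong)
  have "(\<Sum>j<p. u $ j * ((1 / real n) \<cdot>\<^sub>v (transpose_mat X *\<^sub>v (y - X *\<^sub>v b))) $ j) =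
    (\<Sum>j<p. u $ j * (\<Sum>i<n. X $$ (i, j) * (y $ i - (\<Sum>k<p. X $$ (i, k) * b $ k)))) / real n"
    unfolding sum_divide_distrib by (intro sum.cong refl) (simp del: index_smult_vec add: c)
  moreover have "(1 / real n) \<cdot>\<^sub>v (transpose_mat X *\<^sub>v (y - X *\<^sub>v b)) \<in> carrier_vec p"
  proof -
    have "transpose_mat X *\<^sub>v (y - X *\<^sub>v b) \<in> carrier_vec p"
      by (rule mult_mat_vec_carrier[of _ p n]) (use X y b in auto)
    then show ?thesis by simp
  qed
  ultimately show ?thesis
    unfolding debiased_estimate_def by (simp only: scalar_prod_sum[OF b] scalar_prod_sum)
qed

section \<open>The restricted eigenvalue as a countable infimum\<close>

lemma norm_restrict:
  assumes "J \<subseteq> {..<p}" "\<delta> \<in> carrier_vec p"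
  shows "norm_l2 (vec_restrict \<delta> J) = L2_set (($) \<delta>) J" "norm_l1 (vec_restrict \<delta> J) = (\<Sum>j\<in>J. \<bar>\<delta> $ j\<bar>)"
proof -
  have "L2_set (($) (vec_restrict \<delta> J)) {..<p} = L2_set (($) \<delta>) J"
    unfolding L2_set_def using assms
    by (intro arg_cong[where f=sqrt] sum.mono_neutral_cong_right) (auto simp: vec_restrict_def)
  then show "norm_l2 (vec_restrict \<delta> J) = L2_set (($) \<delta>) J"
    using assms by (simp add: norm_l2_eq_L2_set vec_restrict_def)
  show "norm_l1 (vec_restrict \<delta> J) = (\<Sum>j\<in>J. \<bar>\<delta> $ j\<bar>)"
    unfolding norm_l1_def using assms
    by (intro sum.mono_neutral_cong_right) (auto simp: vec_restrict_def)
qed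

text \<open>Functions replace vectors because their product topology provides the countable dense
  set used for measurability.\<close>

definition re_cone :: "nat \<Rightarrow> nat \<Rightarrow> real \<Rightarrow> (nat set \<times> (nat \<Rightarrow> real)) set" where
  "re_cone p k \<alpha> = {(J, d). J \<subseteq> {..<p} \<and> card J \<le> k \<and> (\<exists>j<p. d j \<noteq> 0) \<and>
    (\<Sum>j\<in>{..<p} - J. \<bar>d j\<bar>) \<le> \<alpha> * (\<Sum>j\<in>J. \<bar>d j\<bar>)}"

definition re_ratio :: "nat \<Rightarrow> nat \<Rightarrow> (nat \<Rightarrow> nat \<Rightarrow> real) \<Rightarrow> nat set \<times> (nat \<Rightarrow> real) \<Rightarrow> real" where
  "re_ratio n p x = (\<lambda>(J, d). L2_set (\<lambda>i. \<Sum>j<p. x i j * d j) {..<n} / (sqrt (real n) * L2_set d J))"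

lemma re_ratio_nonneg: "re_ratio n p x c \<ge> 0"
  by (cases c) (simp add: re_ratio_def)

lemma restricted_eigenvalue_eq:
  assumes X: "X \<in> carrier_mat n p"
  shows "restricted_eigenvalue n p X k \<alpha> = Inf (re_ratio n p (\<lambda>i j. X $$ (i, j)) ` re_cone p k \<alpha>)"
proof -
  have norm: "norm_l2 (X *\<^sub>v \<delta>) = L2_set (\<lambda>i. \<Sum>j<p. X $$ (i, j) * \<delta> $ j) {..<n}" if "\<delta> \<in> carrier_vec p" for \<delta>
    unfolding norm_l2_eq_L2_set using X that
    by (auto simp: mult_mat_vec_index simp del: index_mult_mat_vec intro!: L2_set_cong)
  have "{norm_l2 (X *\<^sub>v \<delta>) / (sqrt (real n) * norm_l2 (vec_restrict \<delta> J)) | J \<delta>.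
       J \<subseteq> {..<p} \<and> card J \<le> k \<and> \<delta> \<in> carrier_vec p \<and> \<delta> \<noteq> 0\<^sub>v p \<and>
       norm_l1 (vec_restrict \<delta> ({..<p} - J)) \<le> \<alpha> * norm_l1 (vec_restrict \<delta> J)} =
    re_ratio n p (\<lambda>i j. X $$ (i, j)) ` re_cone p k \<alpha>" (is "?L = ?R")
  proof (intro subset_antisym subsetI)
    fix r assume "r \<in> ?L"
    then obtain J \<delta> where r: "r = norm_l2 (X *\<^sub>v \<delta>) / (sqrt (real n) * norm_l2 (vec_restrict \<delta> J))"
      and J: "J \<subseteq> {..<p}" "card J \<le> k" and \<delta>: "\<delta> \<in> carrier_vec p" "\<delta> \<noteq> 0\<^sub>v p"
      and c: "norm_l1 (vec_restrict \<delta> ({..<p} - J)) \<le> \<alpha> * norm_l1 (vec_restrict \<delta> J)" by blast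
    have "\<exists>j<p. \<delta> $ j \<noteq> 0" using \<delta> by (metis carrier_vecD eq_vecI index_zero_vec)
    then have "(J, ($) \<delta>) \<in> re_cone p k \<alpha>" using J c \<delta> norm_restrict(2)[OF Diff_subset \<delta>(1), of J]
      by (simp add: re_cone_def norm_restrict)
    moreover have "r = re_ratio n p (\<lambda>i j. X $$ (i, j)) (J, ($) \<delta>)"
      using J \<delta> by (simp add: r re_ratio_def norm norm_restrict)
    ultimately show "r \<in> ?R" by blast
  next
    fix r assume "r \<in> ?R"
    then obtain J d where r: "r = re_ratio n p (\<lambda>i j. X $$ (i, j)) (J, d)" and c: "(J, d) \<in> re_cone p k \<alpha>" by auto
    define \<delta> where "\<delta> = vec p d"
    have J: "J \<subseteq> {..<p}" "card J \<le> k" using c by (auto simp: re_cone_def)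
    obtain j where j: "j < p" "d j \<noteq> 0" using c by (auto simp: re_cone_def)
    have \<delta>: "\<delta> \<in> carrier_vec p" by (simp add: \<delta>_def)
    have "\<delta> $ j \<noteq> 0" using j by (simp add: \<delta>_def)
    then have \<delta>0: "\<delta> \<noteq> 0\<^sub>v p" using j by auto
    have L: "L2_set (($) \<delta>) J = L2_set d J" "(\<Sum>j\<in>J. \<bar>\<delta> $ j\<bar>) = (\<Sum>j\<in>J. \<bar>d j\<bar>)"
      "(\<Sum>j\<in>{..<p} - J. \<bar>\<delta> $ j\<bar>) = (\<Sum>j\<in>{..<p} - J. \<bar>d j\<bar>)"
      using J by (auto simp: \<delta>_def intro!: L2_set_cong sum.cong)
    have "r = norm_l2 (X *\<^sub>v \<delta>) / (sqrt (real n) * norm_l2 (vec_restrict \<delta> J))"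
      using J \<delta> by (simp add: r re_ratio_def norm norm_restrict L) (simp add: \<delta>_def)
    moreover have "norm_l1 (vec_restrict \<delta> ({..<p} - J)) \<le> \<alpha> * norm_l1 (vec_restrict \<delta> J)"
      using c J \<delta> norm_restrict(2)[OF Diff_subset \<delta>, of J] by (simp add: norm_restrict L re_cone_def)
    ultimately show "r \<in> ?L" using J \<delta> \<delta>0 by blast
  qed
  then show ?thesis unfolding restricted_eigenvalue_def by simp
qed

lemma bdd_below_re_ratio: "bdd_below (re_ratio n p x ` C)"
  by (intro bdd_belowI2[of _ 0] re_ratio_nonneg)

text \<open>If \<open>d\<close> vanished on \<open>J\<close>, the cone inequality would force it to
  vanish elsewhere as well. Hence the ratios in the restricted eigenvalue never have denominator
  zero for \<open>n \<ge> 1\<close>.\<close>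

lemma re_cone_restrict_pos:
  assumes "(J, d) \<in> re_cone p k \<alpha>"
  shows "(\<Sum>j\<in>J. \<bar>d j\<bar>) > 0" "L2_set d J > 0"
proof -
  have J: "finite J" "J \<subseteq> {..<p}" using assms finite_subset by (auto simp: re_cone_def)
  have "\<exists>j\<in>J. d j \<noteq> 0"
  proof (rule ccontr)
    assume "\<not> (\<exists>j\<in>J. d j \<noteq> 0)"
    then have "(\<Sum>j\<in>J. \<bar>d j\<bar>) = 0" by simp
    then have "(\<Sum>j\<in>{..<p} - J. \<bar>d j\<bar>) \<le> 0" using assms by (simp add: re_cone_def)
    then have "(\<Sum>j\<in>{..<p} - J. \<bar>d j\<bar>) = 0" by (intro antisym) (auto intro: sum_nonneg)
    then have "\<forall>j\<in>{..<p} - J. d j = 0" by (subst (asm) sum_nonneg_eq_0_iff) auto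
    with \<open>\<not> (\<exists>j\<in>J. d j \<noteq> 0)\<close> assms show False by (auto simp: re_cone_def)
  qed
  then obtain j where j: "j \<in> J" "d j \<noteq> 0" by blast
  show "(\<Sum>j\<in>J. \<bar>d j\<bar>) > 0" using j J by (intro sum_pos2[of _ j]) auto
  have "(\<Sum>j\<in>J. (d j)\<^sup>2) > 0" using j J by (intro sum_pos2[of _ j]) auto
  then show "L2_set d J > 0" by (simp add: L2_set_def)
qed

lemma re_cone_nonempty:
  assumes "p \<ge> 1" "k \<ge> 1" "\<alpha> \<ge> 0"
  shows "re_cone p k \<alpha> \<noteq> {}"
proof -
  have "({0}, \<lambda>j. if j = 0 then 1 else 0) \<in> re_cone p k \<alpha>"
    using assms by (auto simp: re_cone_def intro!: exI[of _ 0] order_trans[OF eq_refl[OF sum.neutral]])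
  then show ?thesis by blast
qed

text \<open>With both inequalities strict the set of admissible \<open>d\<close> is open, so a dense
  set meets it as soon as it is nonempty. The cone itself is closed off by a weak inequality, and a
  point on its boundary first has to be moved inside.\<close>

lemma Inf_re_ratio_less_iff:
  fixes D :: "(nat \<Rightarrow> real) set"
  assumes n: "n \<ge> 1" and p: "p \<ge> 1" and k: "k \<ge> 1" and \<alpha>: "\<alpha> > 0"
    and dense: "\<And>U. open U \<Longrightarrow> U \<noteq> {} \<Longrightarrow> \<exists>d\<in>D. d \<in> U"
  shows "Inf (re_ratio n p x ` re_cone p k \<alpha>) < c \<longleftrightarrow>
    (\<exists>J\<in>{J. J \<subseteq> {..<p} \<and> card J \<le> k}. \<exists>d\<in>D. (\<Sum>j\<in>{..<p} - J. \<bar>d j\<bar>) < \<alpha> * (\<Sum>j\<in>J. \<bar>d j\<bar>) \<and>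
      L2_set (\<lambda>i. \<Sum>j<p. x i j * d j) {..<n} < c * (sqrt (real n) * L2_set d J))" (is "?L \<longleftrightarrow> ?R")
proof
  assume ?R
  then obtain J d where J: "J \<subseteq> {..<p}" "card J \<le> k"
    and s: "(\<Sum>j\<in>{..<p} - J. \<bar>d j\<bar>) < \<alpha> * (\<Sum>j\<in>J. \<bar>d j\<bar>)"
    and lt: "L2_set (\<lambda>i. \<Sum>j<p. x i j * d j) {..<n} < c * (sqrt (real n) * L2_set d J)" by blast
  have "0 \<le> (\<Sum>j\<in>{..<p} - J. \<bar>d j\<bar>)" by (intro sum_nonneg) auto
  then have "0 < \<alpha> * (\<Sum>j\<in>J. \<bar>d j\<bar>)" using s by linarith
  then have "(\<Sum>j\<in>J. \<bar>d j\<bar>) \<noteq> 0" by (metis less_irrefl mult_zero_right)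
  then have "\<exists>j\<in>J. d j \<noteq> 0" by (metis abs_zero sum.neutral)
  then have C: "(J, d) \<in> re_cone p k \<alpha>" using J s by (auto simp: re_cone_def)
  have "Inf (re_ratio n p x ` re_cone p k \<alpha>) \<le> re_ratio n p x (J, d)"
    by (intro cINF_lower bdd_below_re_ratio C)
  also have "\<dots> < c" using lt re_cone_restrict_pos[OF C] n by (simp add: re_ratio_def field_simps)
  finally show ?L .
next
  assume ?L
  moreover have "re_ratio n p x ` re_cone p k \<alpha> \<noteq> {}" using re_cone_nonempty[OF p k] \<alpha> by simp
  ultimately obtain J d where C: "(J, d) \<in> re_cone p k \<alpha>" and lt: "re_ratio n p x (J, d) < c"
    by (metis (no_types, lifting) cInf_lessD imageE surj_pair)
  have J: "J \<subseteq> {..<p}" "card J \<le> k" using C by (auto simp: re_cone_def)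
  note pos = re_cone_restrict_pos[OF C]
  \<comment> \<open>Shrinking the coordinates off \<open>J\<close> makes the cone inequality strict
    while both norms on \<open>J\<close> stay fixed; by continuity the strict ratio bound survives
    for small \<open>t\<close>.\<close>
  define dt where "dt = (\<lambda>t j. if j \<in> J then d j else (1 - t) * d j :: real)"
  define T where "T = {t. L2_set (\<lambda>i. \<Sum>j<p. x i j * dt t j) {..<n} < c * (sqrt (real n) * L2_set d J)}"
  have cont_dt: "continuous_on UNIV (\<lambda>t. dt t j)" for j
    unfolding dt_def by (cases "j \<in> J") (auto intro!: continuous_intros)
  have "open T"
    unfolding T_def L2_set_def by (intro open_Collect_less continuous_intros cont_dt)
  moreover have "dt 0 = d" by (auto simp: dt_def)
  then have "0 \<in> T" using lt pos n by (simp add: T_def re_ratio_def field_simps)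
  ultimately obtain \<epsilon> where \<epsilon>: "\<epsilon> > 0" "ball 0 \<epsilon> \<subseteq> T" by (meson openE)
  define t where "t = min (\<epsilon> / 2) 1"
  have t: "0 < t" "t \<le> 1" using \<epsilon> by (auto simp: t_def)
  have "t \<in> ball 0 \<epsilon>" using \<epsilon> t by (auto simp: t_def dist_real_def)
  then have tT: "t \<in> T" using \<epsilon> by blast
  have dJ: "(\<Sum>j\<in>J. \<bar>dt t j\<bar>) = (\<Sum>j\<in>J. \<bar>d j\<bar>)" "L2_set (dt t) J = L2_set d J"
    by (auto simp: dt_def intro!: sum.cong L2_set_cong)
  have "(\<Sum>j\<in>{..<p} - J. \<bar>dt t j\<bar>) = (1 - t) * (\<Sum>j\<in>{..<p} - J. \<bar>d j\<bar>)"
    using t unfolding sum_distrib_left by (intro sum.cong) (auto simp: dt_def abs_mult)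
  also have "\<dots> \<le> (1 - t) * (\<alpha> * (\<Sum>j\<in>J. \<bar>d j\<bar>))"
    using C t by (intro mult_left_mono) (auto simp: re_cone_def)
  also have "\<dots> < 1 * (\<alpha> * (\<Sum>j\<in>J. \<bar>d j\<bar>))"
    using t pos \<alpha> by (intro mult_strict_right_mono) auto
  finally have s: "(\<Sum>j\<in>{..<p} - J. \<bar>dt t j\<bar>) < \<alpha> * (\<Sum>j\<in>J. \<bar>dt t j\<bar>)" by (simp add: dJ)
  define U where "U = {d. (\<Sum>j\<in>{..<p} - J. \<bar>d j\<bar>) < \<alpha> * (\<Sum>j\<in>J. \<bar>d j\<bar>)} \<inter>
    {d. L2_set (\<lambda>i. \<Sum>j<p. x i j * d j) {..<n} < c * (sqrt (real n) * L2_set d J)}"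
  have "open U"
    unfolding U_def L2_set_def by (intro open_Int open_Collect_less continuous_intros)
  moreover have "dt t \<in> U" using s tT by (simp add: U_def T_def dJ)
  ultimately obtain d' where "d' \<in> D" "d' \<in> U" using dense[of U] by blast
  then show ?R using J by (auto simp: U_def)
qed

section \<open>Statistics as measurable functions of the sample\<close>

lemma design_carrier: "design n p z \<in> carrier_mat n p"
  by (simp add: design_def)

lemma design_index: "i < n \<Longrightarrow> j < p \<Longrightarrow> design n p z $$ (i, j) = snd z i j"
  by (simp add: design_def)

lemma response_carrier: "response n z \<in> carrier_vec n"
  by (simp add: response_def)

lemma measurable_sample_response: "i < n \<Longrightarrow> (\<lambda>z. fst z i) \<in> borel_measurable (sample_space n p)"
  unfolding sample_space_def by measurable

lemma measurable_sample_design: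
  assumes "i < n" "j < p"
  shows "(\<lambda>z. snd z i j) \<in> borel_measurable (sample_space n p)"
proof -
  have "(\<lambda>z. snd z i) \<in> sample_space n p \<rightarrow>\<^sub>M (\<Pi>\<^sub>M j\<in>{..<p}. borel :: real measure)"
    unfolding sample_space_def using assms
    by (intro measurable_compose[OF measurable_snd] measurable_component_singleton) auto
  from measurable_compose[OF this measurable_component_singleton, of j] assms show ?thesis by simp
qed

lemma col_norm_eq: "X \<in> carrier_mat n p \<Longrightarrow> j < p \<Longrightarrow> norm_l2 (col X j) = L2_set (\<lambda>i. X $$ (i, j)) {..<n}"
  unfolding norm_l2_eq_L2_set by (auto intro!: L2_set_cong)

lemma projection_directionD:
  assumes pd: "projection_direction n p M1 \<xi> uhat" and X: "X \<in> carrier_mat n p"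
  shows "uhat X \<in> carrier_vec p"
    and "v \<in> projection_feasible n p M1 \<xi> X \<Longrightarrow> uhat X \<in> projection_feasible n p M1 \<xi> X"
    and "v \<in> projection_feasible n p M1 \<xi> X \<Longrightarrow>
      uhat X \<bullet> (sample_cov n X *\<^sub>v uhat X) \<le> v \<bullet> (sample_cov n X *\<^sub>v v)"
proof -
  have u: "if projection_feasible n p M1 \<xi> X = {} then uhat X = 0\<^sub>v p
        else is_arg_min (\<lambda>u. u \<bullet> (sample_cov n X *\<^sub>v u))
               (\<lambda>u. u \<in> projection_feasible n p M1 \<xi> X) (uhat X)"
    using pd X unfolding projection_direction_def by blast
  show feas: "uhat X \<in> projection_feasible n p M1 \<xi> X" if "v \<in> projection_feasible n p M1 \<xi> X" for v
    using u that by (auto simp: is_arg_min_linorder split: if_splits)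
  show "uhat X \<bullet> (sample_cov n X *\<^sub>v uhat X) \<le> v \<bullet> (sample_cov n X *\<^sub>v v)" if "v \<in> projection_feasible n p M1 \<xi> X"
    using u that by (auto simp: is_arg_min_linorder split: if_splits)
  show "uhat X \<in> carrier_vec p"
  proof (cases "projection_feasible n p M1 \<xi> X = {}")
    case True
    then show ?thesis using u by simp
  next
    case False
    then show ?thesis using feas by (auto simp: projection_feasible_def)
  qed
qed

context
  fixes n p :: nat
begin

lemmas sample_measurable [measurable] = measurable_sample_response[of _ n p] measurable_sample_design[of _ n _ p]

lemma measurable_design_col_norm [measurable]:
  assumes "j < p"
  shows "(\<lambda>z. norm_l2 (col (design n p z) j)) \<in> borel_measurable (sample_space n p)"
proof -
  have "(\<lambda>z. norm_l2 (col (design n p z) j)) = (\<lambda>z. sqrt (\<Sum>i<n. (snd z i j)\<^sup>2))"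
    using assms by (auto simp: col_norm_eq[OF design_carrier] L2_set_def design_index)
  then show ?thesis using assms by simp
qed

lemma measurable_min_col_norm [measurable]: "(\<lambda>z. min_col_norm (design n p z)) \<in> borel_measurable (sample_space n p)"
  unfolding min_col_norm_def by (simp add: design_def[THEN arg_cong[where f=dim_col]])

lemma measurable_max_col_norm [measurable]: "(\<lambda>z. max_col_norm (design n p z)) \<in> borel_measurable (sample_space n p)"
  unfolding max_col_norm_def by (simp add: design_def[THEN arg_cong[where f=dim_col]])

lemma min_max_col_norm:
  assumes "p \<ge> 1"
  shows "min_col_norm (design n p z) \<ge> 0" "min_col_norm (design n p z) \<le> max_col_norm (design n p z)"
proof -
  have d: "dim_col (design n p z) = p" by (simp add: design_def)
  show "min_col_norm (design n p z) \<ge> 0"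
    unfolding min_col_norm_def d using assms by (subst Min_ge_iff) (auto simp: lessThan_empty_iff)
  have "min_col_norm (design n p z) \<le> norm_l2 (col (design n p z) 0)"
    unfolding min_col_norm_def d using assms by (intro Min_le) auto
  also have "\<dots> \<le> max_col_norm (design n p z)"
    unfolding max_col_norm_def d using assms by (intro Max_ge) auto
  finally show "min_col_norm (design n p z) \<le> max_col_norm (design n p z)" .
qed

text \<open>Where a column vanishes the cone has no interior, but there \<^const>\<open>C1_const\<close> is infinite
  whatever the restricted eigenvalue is.\<close>

lemma measurable_restricted_eigenvalue:
  assumes n: "n \<ge> 1" and p: "p \<ge> 1" and k: "k \<ge> 1"
  shows "(\<lambda>z. if min_col_norm (design n p z) = 0 then 0 else restricted_eigenvalue n p (design n p z) k
    (405 * (max_col_norm (design n p z) / min_col_norm (design n p z)))) \<in> borel_measurable (sample_space n p)"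
    (is "?R \<in> _")
proof (unfold borel_measurable_iff_less, intro allI)
  fix c :: real
  let ?S = "sample_space n p"
  obtain D :: "(nat \<Rightarrow> real) set" where D: "countable D" "\<And>U. open U \<Longrightarrow> U \<noteq> {} \<Longrightarrow> \<exists>d\<in>D. d \<in> U"
    by (rule countable_dense_setE) blast
  \<comment> \<open>The condition \<open>?P\<close> is measurable in the sample for fixed
    \<open>J\<close> and \<open>d\<close>; only finitely many \<open>J\<close> and countably many
    \<open>d\<close> occur.\<close>
  let ?Js = "{J. J \<subseteq> {..<p} \<and> card J \<le> k}"
  let ?P = "\<lambda>J d z. (\<Sum>j\<in>{..<p} - J. \<bar>d j\<bar>) < 405 * (max_col_norm (design n p z) / min_col_norm (design n p z)) * (\<Sum>j\<in>J. \<bar>d j\<bar>) \<and>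
      sqrt (\<Sum>i<n. (\<Sum>j<p. snd z i j * d j)\<^sup>2) < c * (sqrt (real n) * L2_set d J)"
  have eq: "?R z < c \<longleftrightarrow> (if min_col_norm (design n p z) = 0 then 0 < c else (\<exists>J\<in>?Js. \<exists>d\<in>D. ?P J d z))" for z
  proof (cases "min_col_norm (design n p z) = 0")
    case False
    define \<alpha> where "\<alpha> = 405 * (max_col_norm (design n p z) / min_col_norm (design n p z))"
    have \<alpha>: "\<alpha> > 0" using min_max_col_norm[OF p, of z] False by (simp add: \<alpha>_def)
    have "(\<lambda>i. \<Sum>j<p. design n p z $$ (i, j) * d j) i = (\<Sum>j<p. snd z i j * d j)" if "i < n" for i d
      using that by (simp add: design_index)
    then have L: "L2_set (\<lambda>i. \<Sum>j<p. design n p z $$ (i, j) * d j) {..<n} = sqrt (\<Sum>i<n. (\<Sum>j<p. snd z i j * d j)\<^sup>2)" for d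
      unfolding L2_set_def by simp
    show ?thesis
      using Inf_re_ratio_less_iff[OF n p k \<alpha> D(2), of "\<lambda>i j. design n p z $$ (i, j)" c] False
      by (simp add: restricted_eigenvalue_eq[OF design_carrier] L \<alpha>_def)
  qed simp
  have P: "{z \<in> space ?S. ?P J d z} \<in> sets ?S" for J d
  proof -
    define f where "f = (\<lambda>z. 405 * (max_col_norm (design n p z) / min_col_norm (design n p z)) * (\<Sum>j\<in>J. \<bar>d j\<bar>))"
    define g where "g = (\<lambda>z :: sample. sqrt (\<Sum>i<n. (\<Sum>j<p. snd z i j * d j)\<^sup>2))"
    have [measurable]: "f \<in> borel_measurable ?S" unfolding f_def by measurable
    have [measurable]: "g \<in> borel_measurable ?S" unfolding g_def by measurable
    have "{z \<in> space ?S. (\<Sum>j\<in>{..<p} - J. \<bar>d j\<bar>) < f z \<and> g z < c * (sqrt (real n) * L2_set d J)} \<in> sets ?S"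
      by measurable
    then show ?thesis by (simp only: f_def g_def)
  qed
  have fin: "finite ?Js" by (rule finite_subset[of _ "Pow {..<p}"]) auto
  define E where "E = {z \<in> space ?S. \<exists>J\<in>?Js. \<exists>d\<in>D. ?P J d z}"
  have [measurable]: "E \<in> sets ?S"
    unfolding E_def by (intro sets.sets_Collect_finite_Ex[OF _ fin] sets.sets_Collect_countable_Ex'[OF _ D(1)] P)
  have [measurable]: "{z \<in> space ?S. min_col_norm (design n p z) = 0} \<in> sets ?S" by measurable
  have "{z \<in> space ?S. if min_col_norm (design n p z) = 0 then 0 < c else (\<exists>J\<in>?Js. \<exists>d\<in>D. ?P J d z)} =
    (if 0 < c then {z \<in> space ?S. min_col_norm (design n p z) = 0} else {}) \<union>
    (E - {z \<in> space ?S. min_col_norm (design n p z) = 0})"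
    by (simp only: E_def) (auto split: if_splits)
  also have "\<dots> \<in> sets ?S" by auto
  finally have "{z \<in> space ?S. if min_col_norm (design n p z) = 0 then 0 < c else (\<exists>J\<in>?Js. \<exists>d\<in>D. ?P J d z)} \<in> sets ?S" .
  then show "{z \<in> space ?S. ?R z < c} \<in> sets ?S" unfolding eq .
qed

lemma measurable_C1_const:
  assumes n: "n \<ge> 1" and p: "p \<ge> 1" and k: "k \<ge> 1" and M1: "M1 > 0"
  shows "(\<lambda>z. C1_const M1 n p (design n p z) k) \<in> borel_measurable (sample_space n p)"
proof -
  let ?R = "\<lambda>z. if min_col_norm (design n p z) = 0 then 0 else restricted_eigenvalue n p (design n p z) k
    (405 * (max_col_norm (design n p z) / min_col_norm (design n p z)))"
  note [measurable] = measurable_restricted_eigenvalue[OF n p k]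
  have "C1_const M1 n p (design n p z) k = (if min_col_norm (design n p z) = 0 then \<infinity> else
    ereal (7000 * M1\<^sup>2 * sqrt (real n)) / ereal (min_col_norm (design n p z))
     * max (ereal 1.25) (ereal (912 * (max_col_norm (design n p z))\<^sup>2) / ereal (real n * (?R z)\<^sup>2)))" for z
  proof (cases "min_col_norm (design n p z) = 0")
    case True
    have "ereal (7000 * M1\<^sup>2 * sqrt (real n)) / ereal 0 = \<infinity>"
      using n M1 by (simp add: divide_ereal_def)
    moreover have "\<infinity> * max (ereal 1.25) x = \<infinity>" for x
    proof -
      have "max (ereal 1.25) x > 0" by (simp add: less_max_iff_disj)
      then show ?thesis by simp
    qed
    ultimately show ?thesis unfolding C1_const_def True by (simp only: simp_thms if_True)
  qed (simp add: C1_const_def)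
  then show ?thesis by simp
qed

lemma measurable_conf_int:
  fixes bhat :: "real vec \<Rightarrow> real mat \<Rightarrow> real vec" and shat :: "real vec \<Rightarrow> real mat \<Rightarrow> real"
    and uhat :: "real mat \<Rightarrow> real vec"
  assumes n: "n \<ge> 1" and p: "p \<ge> 1" and k: "k \<ge> 1" and M1: "M1 > 0"
    and sl: "scaled_lasso n p bhat shat" and pd: "projection_direction n p M1 \<xi> uhat"
  shows "{z \<in> space (sample_space n p). c \<in> conf_int \<alpha> M1 n p k \<xi> bhat shat uhat z} \<in> sets (sample_space n p)"
    and "(\<lambda>z. interval_length (conf_int \<alpha> M1 n p k \<xi> bhat shat uhat z)) \<in> borel_measurable (sample_space n p)"
proof -
  let ?S = "sample_space n p"
  define b where "b = (\<lambda>z. bhat (response n z) (design n p z))"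
  define s where "s = (\<lambda>z. shat (response n z) (design n p z))"
  define u where "u = (\<lambda>z. uhat (design n p z))"
  have b_carrier: "b z \<in> carrier_vec p" for z
    using sl response_carrier[of n z] design_carrier[of n p z] unfolding scaled_lasso_def b_def Let_def by auto
  have u_carrier: "u z \<in> carrier_vec p" for z
    unfolding u_def by (rule projection_directionD(1)[OF pd design_carrier])
  have [measurable]: "(\<lambda>z. b z $ j) \<in> borel_measurable ?S" if "j < p" for j
    using sl that by (simp add: scaled_lasso_def b_def)
  have [measurable]: "s \<in> borel_measurable ?S"
    using sl by (simp add: scaled_lasso_def s_def)
  have [measurable]: "(\<lambda>z. u z $ j) \<in> borel_measurable ?S" if "j < p" for j
    using pd that by (simp add: projection_direction_def u_def)
  define \<mu> where "\<mu> = (\<lambda>z. debiased_estimate n \<xi> (response n z) (design n p z) (b z) (u z))"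
  have \<mu>: "\<mu> z = (\<Sum>j<p. \<xi> $ j * b z $ j) +
    (\<Sum>j<p. u z $ j * (\<Sum>i<n. snd z i j * (fst z i - (\<Sum>k<p. snd z i k * b z $ k)))) / real n" for z
    unfolding \<mu>_def debiased_estimate_eq[OF design_carrier u_carrier b_carrier response_carrier]
    by (simp add: design_index) (simp add: response_def)
  have [measurable]: "\<mu> \<in> borel_measurable ?S"
    unfolding \<mu>[abs_def] by measurable
  define v where "v = (\<lambda>z. u z \<bullet> (sample_cov n (design n p z) *\<^sub>v u z))"
  have v: "v z = (\<Sum>i<n. (\<Sum>k<p. snd z i k * u z $ k)\<^sup>2) / real n" for z
    unfolding v_def sample_cov_quadratic[OF design_carrier u_carrier] by (simp add: design_index)
  have [measurable]: "v \<in> borel_measurable ?S"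
    unfolding v[abs_def] by measurable
  define C where "C = (\<lambda>z. C1_const M1 n p (design n p z) k)"
  have [measurable]: "C \<in> borel_measurable ?S"
    unfolding C_def by (rule measurable_C1_const[OF n p k M1])
  define \<rho> where "\<rho> = (\<lambda>z. half_width \<alpha> M1 n p k \<xi> (design n p z) (s z) (u z))"
  have [measurable]: "\<rho> \<in> borel_measurable ?S"
    unfolding \<rho>_def half_width_def v_def[symmetric, THEN fun_cong] C_def[symmetric, THEN fun_cong] by measurable
  have "{z \<in> space ?S. c \<in> conf_int \<alpha> M1 n p k \<xi> bhat shat uhat z} =
    {z \<in> space ?S. (s z \<le> ln (real p) \<longrightarrow> \<mu> z - \<rho> z \<le> c \<and> c \<le> \<mu> z + \<rho> z) \<and> (\<not> s z \<le> ln (real p) \<longrightarrow> c = 0)}"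
    by (auto simp: conf_int_def Let_def \<mu>_def \<rho>_def s_def b_def u_def split: if_splits)
  also have "\<dots> \<in> sets ?S" by measurable
  finally show "{z \<in> space ?S. c \<in> conf_int \<alpha> M1 n p k \<xi> bhat shat uhat z} \<in> sets ?S" .
  \<comment> \<open>For negative \<open>\<rho>\<close> the interval is empty and its length is the
    fixed number \<open>Sup {} - Inf {}\<close>, so that the case distinction stays
    measurable.\<close>
  have "interval_length (conf_int \<alpha> M1 n p k \<xi> bhat shat uhat z) =
    (if s z \<le> ln (real p) then if 0 \<le> \<rho> z then 2 * \<rho> z else Sup {} - Inf {} else 0)" for z
    by (simp add: conf_int_def Let_def \<mu>_def[symmetric] \<rho>_def[symmetric] s_def[symmetric] b_def[symmetric] u_def[symmetric]
        interval_length_def)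
      (simp add: \<mu>_def \<rho>_def s_def b_def u_def)
  then show "(\<lambda>z. interval_length (conf_int \<alpha> M1 n p k \<xi> bhat shat uhat z)) \<in> borel_measurable ?S"
    by simp
qed

end

text \<open>The second entry of the minimum is the fallback that caps the width on every sample; off
  the good event it is the only control of the length.\<close>

lemma half_width_bounds:
  assumes X: "X \<in> carrier_mat n p" and u: "u \<in> carrier_vec p" and s: "s \<ge> 0"
    and n: "n \<ge> 1" and p: "p \<ge> 2" and z: "normal_upper_quantile (\<alpha> / 2) \<ge> 0"
  shows "0 \<le> half_width \<alpha> M1 n p k \<xi> X s u"
    and "half_width \<alpha> M1 n p k \<xi> X s u \<le>
      norm_l2 \<xi> * s * (ln (real p) * (real k * ln (real p) / real n + 1 / sqrt (real n)))"
proof -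
  define first where "first = ereal (1.01 * sqrt (u \<bullet> (sample_cov n X *\<^sub>v u) / (real n * (norm_l2 \<xi>)\<^sup>2))
      * normal_upper_quantile (\<alpha> / 2)) + C1_const M1 n p X k * ereal (real k * ln (real p) / real n)"
  define second where "second = ln (real p) * (1 / sqrt (real n) + real k * ln (real p) / real n)"
  have lp: "ln (real p) \<ge> 0" using p by simp
  have dim: "dim_col X = p" using X by simp
  have "{..<p} \<noteq> {}" using p by (auto simp: lessThan_empty_iff)
  then have "min_col_norm X \<ge> 0"
    unfolding min_col_norm_def dim by (subst Min_ge_iff) auto
  then have "C1_const M1 n p X k \<ge> 0"
    unfolding C1_const_def by (intro ereal_0_le_mult zero_le_divide_ereal) (auto simp: le_max_iff_disj)
  moreover have "0 \<le> sqrt (u \<bullet> (sample_cov n X *\<^sub>v u) / (real n * (norm_l2 \<xi>)\<^sup>2))"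
    unfolding sample_cov_quadratic[OF X u] by (auto intro!: divide_nonneg_nonneg sum_nonneg)
  ultimately have "0 \<le> first"
    unfolding first_def using lp z by (intro add_nonneg_nonneg ereal_0_le_mult) auto
  moreover have s0: "0 \<le> second" unfolding second_def using lp by (intro mult_nonneg_nonneg add_nonneg_nonneg) auto
  \<comment> \<open>The entry \<open>first\<close> may be infinite, for instance when a column
    vanishes; the minimum is finite because \<open>second\<close> is real.\<close>
  ultimately have "0 \<le> real_of_ereal (min first (ereal second))" "real_of_ereal (min first (ereal second)) \<le> second"
    by (cases first; simp add: min_def)+
  then show "0 \<le> half_width \<alpha> M1 n p k \<xi> X s u"
    "half_width \<alpha> M1 n p k \<xi> X s u \<le> norm_l2 \<xi> * s * (ln (real p) * (real k * ln (real p) / real n + 1 / sqrt (real n)))"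
    unfolding half_width_def first_def[symmetric] second_def[symmetric] using s
    by (auto intro!: mult_nonneg_nonneg mult_left_mono simp: second_def add.commute)
qed

section \<open>Gaussian designs\<close>

text \<open>The squared norm of the design matrix applied to \<open>t\<close>, that is,
  \<open>n\<close> times the sample second moment in this direction.\<close>

definition energy :: "nat \<Rightarrow> nat \<Rightarrow> (nat \<Rightarrow> nat \<Rightarrow> real) \<Rightarrow> (nat \<Rightarrow> real) \<Rightarrow> real" where
  "energy n p x t = (\<Sum>i<n. (\<Sum>j<p. t j * x i j)\<^sup>2)"

definition design_law :: "nat \<Rightarrow> nat \<Rightarrow> real mat \<Rightarrow> (nat \<Rightarrow> nat \<Rightarrow> real) measure" where
  "design_law n p \<Sigma> = (\<Pi>\<^sub>M i\<in>{..<n}. mvn p \<Sigma>)"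

lemma sets_design_law: "sets (design_law n p \<Sigma>) = sets (\<Pi>\<^sub>M i\<in>{..<n}. \<Pi>\<^sub>M j\<in>{..<p}. borel)"
  unfolding design_law_def by (intro sets_PiM_cong refl sets_mvn)

lemma measurable_design_law_entry:
  assumes "i < n" "j < p"
  shows "(\<lambda>x. x i j) \<in> borel_measurable (design_law n p \<Sigma>)"
proof -
  have "(\<lambda>x. x i) \<in> (\<Pi>\<^sub>M i\<in>{..<n}. \<Pi>\<^sub>M j\<in>{..<p}. borel) \<rightarrow>\<^sub>M (\<Pi>\<^sub>M j\<in>{..<p}. borel :: real measure)"
    using assms by (intro measurable_component_singleton) auto
  from measurable_compose[OF this measurable_component_singleton, of j]
  show ?thesis using assms by (simp add: measurable_cong_sets[OF sets_design_law refl])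
qed

lemma measurable_energy [measurable]: "(\<lambda>x. energy n p x t) \<in> borel_measurable (design_law n p \<Sigma>)"
proof -
  note [measurable] = measurable_design_law_entry[of _ n _ p \<Sigma>]
  show ?thesis unfolding energy_def by measurable
qed

lemma emeasure_exists_le:
  assumes I: "finite I" and P: "\<And>i. i \<in> I \<Longrightarrow> {x \<in> space M. P i x} \<in> sets M"
    and c: "\<And>i. i \<in> I \<Longrightarrow> emeasure M {x \<in> space M. P i x} \<le> ennreal c" and "c \<ge> 0"
  shows "emeasure M {x \<in> space M. \<exists>i\<in>I. P i x} \<le> ennreal (real (card I) * c)"
proof -
  have "{x \<in> space M. \<exists>i\<in>I. P i x} = (\<Union>i\<in>I. {x \<in> space M. P i x})" by auto
  also have "emeasure M \<dots> \<le> (\<Sum>i\<in>I. emeasure M {x \<in> space M. P i x})"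
    using I P by (intro emeasure_subadditive_finite) auto
  also have "\<dots> \<le> (\<Sum>i\<in>I. ennreal c)" by (intro sum_mono c)
  also have "\<dots> = ennreal (real (card I) * c)"
    using \<open>c \<ge> 0\<close> by (simp add: ennreal_mult' ennreal_of_nat_eq_real_of_nat)
  finally show ?thesis .
qed

context
  fixes n p :: nat and \<Omega> \<Sigma> :: "real mat"
  assumes pp: "precision_pair p \<Omega> \<Sigma>"
begin


lemma prob_space_design_law: "prob_space (design_law n p \<Sigma>)"
  unfolding design_law_def by (intro prob_space_PiM prob_space_mvn[OF pp])

text \<open>The rows are independent and identically distributed, so the exponential of the sum
  integrates to the \<open>n\<close>-th power of the transform for one row.\<close>

lemma energy_laplace:
  assumes "1 + 2 * c * quad_form p (entries \<Sigma>) t > 0"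
  shows "(\<integral>\<^sup>+ x. ennreal (exp (- c * energy n p x t)) \<partial>design_law n p \<Sigma>) =
    ennreal ((1 / sqrt (1 + 2 * c * quad_form p (entries \<Sigma>) t)) ^ n)"
proof -
  interpret prob_space "mvn p \<Sigma>" by (rule prob_space_mvn[OF pp])
  interpret product_sigma_finite "\<lambda>_::nat. mvn p \<Sigma>" by standard
  have "(\<integral>\<^sup>+ x. ennreal (exp (- c * energy n p x t)) \<partial>design_law n p \<Sigma>) =
    (\<integral>\<^sup>+ x. (\<Prod>i\<in>{..<n}. (\<lambda>y. ennreal (exp (- c * (\<Sum>j<p. t j * y j)\<^sup>2))) (x i)) \<partial>design_law n p \<Sigma>)"
    by (intro nn_integral_cong)
      (simp add: energy_def sum_distrib_left prod_ennreal flip: exp_sum sum_negf)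
  also have "\<dots> = (\<Prod>i\<in>{..<n}. \<integral>\<^sup>+ y. ennreal (exp (- c * (\<Sum>j<p. t j * y j)\<^sup>2)) \<partial>mvn p \<Sigma>)"
    unfolding design_law_def
    by (rule product_nn_integral_prod) auto
  also have "\<dots> = ennreal ((1 / sqrt (1 + 2 * c * quad_form p (entries \<Sigma>) t)) ^ n)"
    using assms by (simp add: mvn_laplace_square[OF pp, simplified] ennreal_power)
  finally show ?thesis .
qed

text \<open>The strict inequality makes the event empty in the zero direction, to which the
  chi-square bound, with its positive scale, does not apply.\<close>

lemma energy_tail:
  assumes \<tau>: "0 < \<tau>" "\<tau> \<le> 1"
  shows "emeasure (design_law n p \<Sigma>) {x \<in> space (design_law n p \<Sigma>).
    \<bar>energy n p x t - real n * quad_form p (entries \<Sigma>) t\<bar> > \<tau> * (real n * quad_form p (entries \<Sigma>) t)} \<le> ennreal (2 * exp (- (real n * \<tau>\<^sup>2 / 16)))"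
proof (cases "\<exists>j<p. t j \<noteq> 0")
  case True
  let ?M = "design_law n p \<Sigma>"
  have "emeasure ?M {x \<in> space ?M. \<bar>energy n p x t - real n * quad_form p (entries \<Sigma>) t\<bar> > \<tau> * (real n * quad_form p (entries \<Sigma>) t)} \<le>
    emeasure ?M {x \<in> space ?M. \<bar>energy n p x t - real n * quad_form p (entries \<Sigma>) t\<bar> \<ge> \<tau> * (real n * quad_form p (entries \<Sigma>) t)}"
    by (intro emeasure_mono) auto
  also have "\<dots> \<le> ennreal (2 * exp (- (real n * \<tau>\<^sup>2 / 16)))"
    by (intro chi_square_tail energy_laplace quad_form_covariance_pos[OF pp True] \<tau>) auto
  finally show ?thesis .
next
  case False
  then have "energy n p x t = 0" "quad_form p (entries \<Sigma>) t = 0" for x by (auto simp: energy_def quad_form_def)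
  then show ?thesis by simp
qed

end

lemma noise_energy_tail:
  assumes \<sigma>: "\<sigma> > 0" and \<tau>: "0 < \<tau>" "\<tau> \<le> 1"
  shows "emeasure (mvn n (\<sigma>\<^sup>2 \<cdot>\<^sub>m 1\<^sub>m n)) {e \<in> space (mvn n (\<sigma>\<^sup>2 \<cdot>\<^sub>m 1\<^sub>m n)).
    \<bar>(\<Sum>i<n. (e i)\<^sup>2) - real n * \<sigma>\<^sup>2\<bar> > \<tau> * (real n * \<sigma>\<^sup>2)} \<le> ennreal (2 * exp (- (real n * \<tau>\<^sup>2 / 16)))"
proof -
  let ?M = "mvn n (\<sigma>\<^sup>2 \<cdot>\<^sub>m 1\<^sub>m n)"
  let ?D = "density lborel (\<lambda>x. ennreal (normal_density 0 \<sigma> x))"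
  interpret prob_space ?D using \<sigma> by (rule prob_space_normal_density)
  interpret product_sigma_finite "\<lambda>_::nat. ?D" by standard
  have one: "(\<integral>\<^sup>+ x. ennreal (exp (- c * x\<^sup>2)) \<partial>?D) = ennreal (1 / sqrt (1 + 2 * c * \<sigma>\<^sup>2))"
    if c: "1 + 2 * c * \<sigma>\<^sup>2 > 0" for c
  proof -
    define a where "a = 1 / \<sigma>\<^sup>2 + 2 * c"
    have a: "a = (1 + 2 * c * \<sigma>\<^sup>2) / \<sigma>\<^sup>2" using \<sigma> by (simp add: a_def field_simps)
    have a0: "a > 0" using c \<sigma> by (simp add: a)
    have "normal_density 0 \<sigma> x * exp (- c * x\<^sup>2) = 1 / sqrt (2 * pi * \<sigma>\<^sup>2) * exp (- (a * (x + 0)\<^sup>2) / 2)" for x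
      using \<sigma> by (simp add: normal_density_def a_def exp_add[symmetric] field_simps)
    then have "(\<integral>\<^sup>+ x. ennreal (exp (- c * x\<^sup>2)) \<partial>?D) =
      (\<integral>\<^sup>+ x. ennreal (1 / sqrt (2 * pi * \<sigma>\<^sup>2)) * ennreal (exp (- (a * (x + 0)\<^sup>2) / 2)) \<partial>lborel)"
      by (subst nn_integral_density) (auto simp flip: ennreal_mult)
    also have "\<dots> = ennreal (1 / sqrt (2 * pi * \<sigma>\<^sup>2)) * ennreal (sqrt (2 * pi / a))"
      by (subst nn_integral_cmult) (simp_all only: nn_integral_gaussian[OF a0], simp)
    also have "\<dots> = ennreal (1 / sqrt (1 + 2 * c * \<sigma>\<^sup>2))"
      using \<sigma> c by (simp add: a real_sqrt_divide real_sqrt_mult flip: ennreal_mult)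
    finally show ?thesis .
  qed
  have "emeasure ?M {e \<in> space ?M. \<bar>(\<Sum>i<n. (e i)\<^sup>2) - real n * \<sigma>\<^sup>2\<bar> > \<tau> * (real n * \<sigma>\<^sup>2)} \<le>
    emeasure ?M {e \<in> space ?M. \<bar>(\<Sum>i<n. (e i)\<^sup>2) - real n * \<sigma>\<^sup>2\<bar> \<ge> \<tau> * (real n * \<sigma>\<^sup>2)}"
    by (intro emeasure_mono) auto
  also have "\<dots> \<le> ennreal (2 * exp (- (real n * \<tau>\<^sup>2 / 16)))"
  proof (intro chi_square_tail \<tau>)
    show "0 < \<sigma>\<^sup>2" using \<sigma> by simp
    fix c assume c: "1 + 2 * c * \<sigma>\<^sup>2 > 0"
    have "(\<integral>\<^sup>+ e. ennreal (exp (- c * (\<Sum>i<n. (e i)\<^sup>2))) \<partial>?M) =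
      (\<integral>\<^sup>+ e. (\<Prod>i\<in>{..<n}. (\<lambda>y. ennreal (exp (- c * y\<^sup>2))) (e i)) \<partial>?M)"
      by (intro nn_integral_cong) (simp add: sum_distrib_left prod_ennreal flip: exp_sum sum_negf)
    also have "\<dots> = (\<Prod>i\<in>{..<n}. \<integral>\<^sup>+ y. ennreal (exp (- c * y\<^sup>2)) \<partial>?D)"
      unfolding mvn_scalar_eq_PiM[OF \<sigma>] by (rule product_nn_integral_prod) auto
    also have "\<dots> = ennreal ((1 / sqrt (1 + 2 * c * \<sigma>\<^sup>2)) ^ n)"
      unfolding one[OF c] using c by (simp add: ennreal_power)
    finally show "(\<integral>\<^sup>+ e. ennreal (exp (- c * (\<Sum>i<n. (e i)\<^sup>2))) \<partial>?M) = ennreal ((1 / sqrt (1 + 2 * c * \<sigma>\<^sup>2)) ^ n)" .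
  qed measurable
  finally show ?thesis .
qed

abbreviation unit_fun :: "nat \<Rightarrow> nat \<Rightarrow> real" where
  "unit_fun j \<equiv> \<lambda>i. if i = j then 1 else 0"

lemma energy_unit_fun: "j < p \<Longrightarrow> energy n p x (unit_fun j) = (\<Sum>i<n. (x i j)\<^sup>2)"
  unfolding energy_def by (simp add: sum_lessThan_delta)

lemma quad_form_unit_fun: "j < p \<Longrightarrow> quad_form p A (unit_fun j) = A j j"
  unfolding quad_form_alt by (simp add: sum_lessThan_delta)

lemma energy_add:
  "energy n p x (\<lambda>i. s i + c * t i) = energy n p x s
    + 2 * c * (\<Sum>i<n. (\<Sum>j<p. s j * x i j) * (\<Sum>j<p. t j * x i j)) + c\<^sup>2 * energy n p x t"
proof -
  have "(\<Sum>j<p. (s j + c * t j) * x i j) = (\<Sum>j<p. s j * x i j) + c * (\<Sum>j<p. t j * x i j)" for i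
    by (simp add: distrib_right sum.distrib sum_distrib_left mult.assoc)
  then have "energy n p x (\<lambda>i. s i + c * t i) = (\<Sum>i<n. (\<Sum>j<p. s j * x i j)\<^sup>2
    + 2 * c * ((\<Sum>j<p. s j * x i j) * (\<Sum>j<p. t j * x i j)) + c\<^sup>2 * (\<Sum>j<p. t j * x i j)\<^sup>2)"
    unfolding energy_def by (intro sum.cong refl) (simp only: power2_sum power_mult_distrib, simp)
  then show ?thesis
    unfolding energy_def by (simp only: sum.distrib sum_distrib_left[symmetric])
qed

lemma quad_form_scale: "quad_form p A (\<lambda>i. c * t i) = c\<^sup>2 * quad_form p A t"
  unfolding quad_form_def sum_distrib_left by (intro sum.cong refl) (simp add: power2_eq_square)

section \<open>Consequences of two-sided spectral bounds\<close>

locale precision_bounds =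
  fixes p :: nat and \<Omega> \<Sigma> :: "real mat" and M1 :: real
  assumes pp: "precision_pair p \<Omega> \<Sigma>" and M1: "M1 > 1"
    and lower: "\<And>x. 1 / M1 * (\<Sum>i<p. (x i)\<^sup>2) \<le> quad_form p (entries \<Omega>) x"
    and upper: "\<And>x. quad_form p (entries \<Omega>) x \<le> M1 * (\<Sum>i<p. (x i)\<^sup>2)"
begin

text \<open>With \<open>y = \<Sigma> x\<close>, Young's inequality bounds \<open>x y\<close> by half
  of \<open>y^2 / M1 + M1 x^2\<close>, and the lower bound on \<open>\<Omega>\<close> at
  \<open>y\<close> returns half of the form itself, which is absorbed on the left.\<close>

lemma covariance_upper: "quad_form p (entries \<Sigma>) x \<le> M1 * (\<Sum>i<p. (x i)\<^sup>2)"
proof -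
  define y where "y = (\<lambda>i. \<Sum>j<p. entries \<Sigma> i j * x j)"
  have q: "quad_form p (entries \<Sigma>) x = (\<Sum>i<p. x i * y i)" by (simp add: quad_form_alt y_def)
  have "quad_form p (entries \<Sigma>) x = quad_form p (entries \<Omega>) y"
    unfolding y_def by (rule quad_form_covariance[OF pp])
  then have l: "1 / M1 * (\<Sum>i<p. (y i)\<^sup>2) \<le> quad_form p (entries \<Sigma>) x" using lower[of y] by simp
  have "x i * y i \<le> (1 / M1 * (y i)\<^sup>2 + M1 * (x i)\<^sup>2) / 2" for i
  proof -
    have "0 \<le> (y i - M1 * x i)\<^sup>2 / M1" using M1 by simp
    also have "\<dots> = 1 / M1 * (y i)\<^sup>2 + M1 * (x i)\<^sup>2 - 2 * (x i * y i)"
      using M1 by (simp add: power2_eq_square field_simps)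
    finally show ?thesis by simp
  qed
  then have "(\<Sum>i<p. x i * y i) \<le> (\<Sum>i<p. (1 / M1 * (y i)\<^sup>2 + M1 * (x i)\<^sup>2) / 2)" by (intro sum_mono)
  also have "\<dots> = (1 / M1 * (\<Sum>i<p. (y i)\<^sup>2) + M1 * (\<Sum>i<p. (x i)\<^sup>2)) / 2"
    by (simp add: sum.distrib sum_distrib_left flip: sum_divide_distrib)
  finally show ?thesis using l q by simp
qed

text \<open>Cauchy-Schwarz at the pair \<open>x\<close>, \<open>x\<close> bounds the fourth power of
  the Euclidean norm by the product of the two forms, and the form of \<open>\<Omega>\<close> is at
  most \<open>M1\<close> times the squared norm.\<close>

lemma covariance_lower: "1 / M1 * (\<Sum>i<p. (x i)\<^sup>2) \<le> quad_form p (entries \<Sigma>) x"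
proof (cases "(\<Sum>i<p. (x i)\<^sup>2) = 0")
  case True
  then show ?thesis using quad_form_covariance_nonneg[OF pp, of x] by simp
next
  case False
  define N where "N = (\<Sum>i<p. (x i)\<^sup>2)"
  have N: "N > 0" using False by (simp add: N_def less_le sum_nonneg)
  have "N\<^sup>2 \<le> quad_form p (entries \<Sigma>) x * quad_form p (entries \<Omega>) x"
    using precision_cauchy_schwarz[OF pp, of x x] by (simp add: N_def power2_eq_square)
  also have "\<dots> \<le> quad_form p (entries \<Sigma>) x * (M1 * N)"
    unfolding N_def by (intro mult_left_mono upper quad_form_covariance_nonneg[OF pp])
  finally have "N * N \<le> N * (quad_form p (entries \<Sigma>) x * M1)" by (simp add: power2_eq_square mult_ac)
  then have "N \<le> quad_form p (entries \<Sigma>) x * M1" using N by (simp add: mult_le_cancel_left)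
  then show ?thesis using M1 by (simp add: N_def field_simps)
qed

lemma variance_bounds: "j < p \<Longrightarrow> 1 / M1 \<le> entries \<Sigma> j j" "j < p \<Longrightarrow> entries \<Sigma> j j \<le> M1"
proof -
  assume j: "j < p"
  have "(\<Sum>i<p. (unit_fun j i)\<^sup>2) = 1" using j by (simp add: if_distrib[where f="\<lambda>x. x\<^sup>2"] cong: if_cong)
  then show "1 / M1 \<le> entries \<Sigma> j j" "entries \<Sigma> j j \<le> M1"
    using covariance_lower[of "unit_fun j"] covariance_upper[of "unit_fun j"] j by (simp_all add: quad_form_unit_fun)
qed

end

text \<open>All randomness of the design is confined to this event at finitely many directions.
  Being relative, the deviation is unaffected by nonzero rescaling of \<open>t\<close>.\<close>

definition relative_dev :: "nat \<Rightarrow> nat \<Rightarrow> real mat \<Rightarrow> real \<Rightarrow> (nat \<Rightarrow> real) \<Rightarrow> (nat \<Rightarrow> nat \<Rightarrow> real) \<Rightarrow> bool" where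
  "relative_dev n p \<Sigma> \<tau> t x \<longleftrightarrow>
    \<bar>energy n p x t - real n * quad_form p (entries \<Sigma>) t\<bar> > \<tau> * (real n * quad_form p (entries \<Sigma>) t)"

context precision_bounds
begin

context
  fixes n :: nat and x :: "nat \<Rightarrow> nat \<Rightarrow> real"
  assumes n: "n \<ge> 1"
begin

lemma energy_half_bounds:
  assumes "\<not> relative_dev n p \<Sigma> (1 / 2) t x"
  shows "energy n p x t \<ge> real n / (2 * M1) * (\<Sum>i<p. (t i)\<^sup>2)"
    "energy n p x t \<le> 3 / 2 * real n * quad_form p (entries \<Sigma>) t"
proof -
  define v where "v = quad_form p (entries \<Sigma>) t"
  have d: "\<bar>energy n p x t - real n * v\<bar> \<le> 1 / 2 * (real n * v)"
    using assms by (simp add: relative_dev_def v_def not_less)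
  then show "energy n p x t \<le> 3 / 2 * real n * quad_form p (entries \<Sigma>) t" unfolding v_def by linarith
  have "real n / 2 * (1 / M1 * (\<Sum>i<p. (t i)\<^sup>2)) \<le> real n / 2 * v"
    unfolding v_def by (intro mult_left_mono covariance_lower) simp
  moreover have "real n / 2 * (1 / M1 * (\<Sum>i<p. (t i)\<^sup>2)) = real n / (2 * M1) * (\<Sum>i<p. (t i)\<^sup>2)" by simp
  ultimately show "energy n p x t \<ge> real n / (2 * M1) * (\<Sum>i<p. (t i)\<^sup>2)" using d by linarith
qed

lemma column_energy_bounds:
  assumes "j < p" "\<not> relative_dev n p \<Sigma> (1 / 2) (unit_fun j) x"
  shows "real n / (2 * M1) \<le> (\<Sum>i<n. (x i j)\<^sup>2)" "(\<Sum>i<n. (x i j)\<^sup>2) \<le> 3 / 2 * M1 * real n"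
proof -
  have "(\<Sum>i<p. (unit_fun j i)\<^sup>2) = 1" using assms by (simp add: if_distrib[where f="\<lambda>x. x\<^sup>2"] cong: if_cong)
  then show "real n / (2 * M1) \<le> (\<Sum>i<n. (x i j)\<^sup>2)"
    using energy_half_bounds(1)[OF assms(2)] assms(1) by (simp add: energy_unit_fun)
  have "(\<Sum>i<n. (x i j)\<^sup>2) \<le> 3 / 2 * real n * entries \<Sigma> j j"
    using energy_half_bounds(2)[OF assms(2)] assms(1) by (simp add: energy_unit_fun quad_form_unit_fun)
  also have "\<dots> \<le> 3 / 2 * real n * M1" using variance_bounds(2)[OF assms(1)] by (intro mult_left_mono) auto
  finally show "(\<Sum>i<n. (x i j)\<^sup>2) \<le> 3 / 2 * M1 * real n" by (simp add: mult_ac)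
qed

text \<open>Maurey's bound is applied with \<open>L * k + 1\<close> draws, so that the factor
  \<open>N - 1\<close> equals \<open>L * k\<close>. On the cone the l1 norm is at most
  \<open>703 * M1 * sqrt k\<close> times the norm on \<open>J\<close>, so \<open>k\<close> cancels
  and the loss is at most \<open>l^2 / (4 * M1)\<close> by the choice of \<open>L\<close>: half of
  the available \<open>l^2 / (2 * M1)\<close>.\<close>

lemma restricted_eigenvalue_lower:
  fixes k L :: nat and \<alpha> :: real
  assumes k: "k \<ge> 1" and L: "real L \<ge> 6 * 703\<^sup>2 * M1 ^ 4" and \<alpha>: "1 + \<alpha> \<le> 703 * M1" "\<alpha> \<ge> 0"
    and cols: "\<And>j. j < p \<Longrightarrow> \<not> relative_dev n p \<Sigma> (1 / 2) (unit_fun j) x"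
    and sums: "\<And>xs. length xs = L * k + 1 \<Longrightarrow> set xs \<subseteq> {..<p} \<times> {-1, 1} \<Longrightarrow>
      \<not> relative_dev n p \<Sigma> (1 / 2) (signed_unit_sum xs) x"
    and c: "(J, d) \<in> re_cone p k \<alpha>"
  shows "re_ratio n p x (J, d) \<ge> 1 / (2 * sqrt M1)"
proof -
  \<comment> \<open>Subtracting half of the guaranteed curvature \<open>1 / M1\<close> turns the
    lower bound for signed sums into nonnegativity, the form in which Maurey's method takes
    it.\<close>
  define A where "A = (\<lambda>i j. (\<Sum>r<n. x r i * x r j) / real n - 1 / (2 * M1) * (if i = j then 1 else 0))"
  have A: "quad_form p A v = energy n p x v / real n - 1 / (2 * M1) * (\<Sum>i<p. (v i)\<^sup>2)" for v
  proof -
    have "quad_form p A v = (\<Sum>i<p. \<Sum>j<p. (\<Sum>r<n. (v i * x r i) * (v j * x r j)) / real n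
        - 1 / (2 * M1) * v i * (v j * (if i = j then 1 else 0)))"
      unfolding quad_form_def A_def
      by (intro sum.cong refl) (simp add: algebra_simps sum_distrib_left sum_distrib_right)
    also have "\<dots> = (\<Sum>i<p. \<Sum>j<p. \<Sum>r<n. (v i * x r i) * (v j * x r j)) / real n
        - (\<Sum>i<p. 1 / (2 * M1) * v i * (\<Sum>j<p. v j * (if i = j then 1 else 0)))"
      by (simp only: sum_subtractf sum_divide_distrib sum_distrib_left)
    also have "(\<Sum>i<p. 1 / (2 * M1) * v i * (\<Sum>j<p. v j * (if i = j then 1 else 0))) = 1 / (2 * M1) * (\<Sum>i<p. (v i)\<^sup>2)"
    proof -
      have "(\<Sum>i<p. 1 / (2 * M1) * v i * (\<Sum>j<p. v j * (if i = j then 1 else 0))) = (\<Sum>i<p. 1 / (2 * M1) * (v i)\<^sup>2)"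
        by (intro sum.cong refl) (simp add: sum_lessThan_delta power2_eq_square)
      then show ?thesis by (simp only: sum_distrib_left)
    qed
    also have "(\<Sum>i<p. \<Sum>j<p. \<Sum>r<n. (v i * x r i) * (v j * x r j)) = (\<Sum>r<n. \<Sum>i<p. \<Sum>j<p. (v i * x r i) * (v j * x r j))"
      by (subst sum.swap[of _ "{..<p}" "{..<n}"], subst (2) sum.swap) (rule refl)
    also have "\<dots> = energy n p x v" by (simp add: energy_def power2_eq_square sum_product)
    finally show ?thesis .
  qed
  have "- (3 / 2 * M1 * (\<Sum>j<p. \<bar>d j\<bar>)\<^sup>2) \<le> (real (L * k + 1) - 1) * quad_form p A d"
  proof (rule quad_form_lower_bound_maurey)
    show "A i j = A j i" for i j by (simp add: A_def mult.commute)
    show "A j j \<le> 3 / 2 * M1" if "j < p" for j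
    proof -
      have "A j j \<le> (\<Sum>r<n. (x r j)\<^sup>2) / real n" using M1 by (simp add: A_def power2_eq_square)
      also have "\<dots> \<le> 3 / 2 * M1" using column_energy_bounds(2)[OF that cols[OF that]] n by (simp add: field_simps)
      finally show ?thesis .
    qed
    fix xs :: "(nat \<times> real) list" assume "length xs = L * k + 1" "set xs \<subseteq> {..<p} \<times> {-1, 1}"
    then have "real n / (2 * M1) * (\<Sum>i<p. (signed_unit_sum xs i)\<^sup>2) \<le> energy n p x (signed_unit_sum xs)"
      by (intro energy_half_bounds(1) sums)
    then show "0 \<le> quad_form p A (signed_unit_sum xs)"
      using n M1 by (simp add: A field_simps)
  qed auto
  then have m: "- (3 / 2 * M1 * (\<Sum>j<p. \<bar>d j\<bar>)\<^sup>2) \<le> real L * real k * quad_form p A d" by simp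
  have J: "J \<subseteq> {..<p}" "card J \<le> k" "finite J" using c finite_subset by (auto simp: re_cone_def)
  define l where "l = L2_set d J"
  have l: "l > 0" unfolding l_def by (rule re_cone_restrict_pos[OF c])
  have "(\<Sum>j<p. \<bar>d j\<bar>) = (\<Sum>j\<in>J. \<bar>d j\<bar>) + (\<Sum>j\<in>{..<p} - J. \<bar>d j\<bar>)"
    using J by (simp add: sum.subset_diff add.commute)
  also have "\<dots> \<le> (1 + \<alpha>) * (\<Sum>j\<in>J. \<bar>d j\<bar>)" using c by (simp add: re_cone_def algebra_simps)
  also have "\<dots> \<le> (703 * M1) * (sqrt (real k) * l)"
    unfolding l_def using \<alpha> J M1 by (intro mult_mono sum_le_sqrt_card_L2_set) (auto intro: sum_nonneg)
  finally have "(\<Sum>j<p. \<bar>d j\<bar>)\<^sup>2 \<le> ((703 * M1) * (sqrt (real k) * l))\<^sup>2"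
    by (intro power_mono) (auto intro: sum_nonneg)
  also have "\<dots> = 703\<^sup>2 * M1\<^sup>2 * (real k * l\<^sup>2)" by (simp add: power_mult_distrib)
  finally have d1: "(\<Sum>j<p. \<bar>d j\<bar>)\<^sup>2 \<le> 703\<^sup>2 * M1\<^sup>2 * (real k * l\<^sup>2)" .
  have "3 / 2 * M1 * (\<Sum>j<p. \<bar>d j\<bar>)\<^sup>2 \<le> 3 / 2 * M1 * (703\<^sup>2 * M1\<^sup>2 * (real k * l\<^sup>2))"
    using M1 d1 by (intro mult_left_mono) auto
  also have "\<dots> = (6 * 703\<^sup>2 * M1 ^ 4) * (real k * l\<^sup>2 / (4 * M1))"
    using M1 by (simp add: power2_eq_square power4_eq_xxxx field_simps)
  also have "\<dots> \<le> real L * (real k * l\<^sup>2 / (4 * M1))"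
    using M1 L by (intro mult_right_mono) auto
  finally have "- (real L * real k * (l\<^sup>2 / (4 * M1))) \<le> real L * real k * quad_form p A d" using m by (simp add: mult.assoc)
  then have "real L * real k * (- (l\<^sup>2 / (4 * M1))) \<le> real L * real k * quad_form p A d" by simp
  moreover have Lpos: "real L > 0"
  proof -
    have "0 < 6 * 703\<^sup>2 * M1 ^ 4" using M1 by simp
    then show ?thesis using L by linarith
  qed
  moreover have "0 < real L * real k" using Lpos k by simp
  ultimately have "- (l\<^sup>2 / (4 * M1)) \<le> quad_form p A d"
    by (simp only: mult_le_cancel_left_pos)
  moreover have "l\<^sup>2 \<le> (\<Sum>i<p. (d i)\<^sup>2)"
    unfolding l_def L2_set_power2 using J by (intro sum_mono2) auto
  then have "1 / (2 * M1) * l\<^sup>2 \<le> 1 / (2 * M1) * (\<Sum>i<p. (d i)\<^sup>2)" using M1 by (intro mult_left_mono) auto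
  ultimately have "l\<^sup>2 / (4 * M1) \<le> energy n p x d / real n" using M1 by (simp add: A field_simps)
  then have "(l / (2 * sqrt M1))\<^sup>2 \<le> energy n p x d / real n"
    using M1 by (simp add: power_divide power_mult_distrib)
  then have "l / (2 * sqrt M1) \<le> sqrt (energy n p x d / real n)" by (rule real_le_rsqrt)
  also have "\<dots> = L2_set (\<lambda>i. \<Sum>j<p. x i j * d j) {..<n} / sqrt (real n)"
    by (simp add: energy_def L2_set_def real_sqrt_divide mult.commute)
  finally show ?thesis using l n M1 by (simp add: re_ratio_def l_def[symmetric] field_simps)
qed

text \<open>Polarisation: the coordinate direction \<open>e\<close> and the direction
  \<open>h\<close> of \<open>\<Omega>\<xi>\<close>, both scaled to unit variance, have cross
  covariance proportional to \<open>\<xi> j\<close>, and the energies of \<open>e + h\<close> and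
  \<open>e - h\<close> differ by four times their cross product. Undoing the scaling costs at most
  \<open>M1\<close> times the norm of \<open>\<xi>\<close>.\<close>

lemma projection_feasibility:
  fixes \<xi> :: "nat \<Rightarrow> real"
  assumes \<xi>: "\<exists>i<p. \<xi> i \<noteq> 0" and j: "j < p" and \<tau>: "\<tau> \<ge> 0"
  defines "g \<equiv> \<lambda>i. \<Sum>k<p. entries \<Omega> i k * \<xi> k"
  defines "q \<equiv> quad_form p (entries \<Omega>) \<xi>"
  assumes dev: "\<And>s. s \<in> {-1, 1} \<Longrightarrow> \<not> relative_dev n p \<Sigma> \<tau>
      (\<lambda>i. 1 / sqrt (entries \<Sigma> j j) * unit_fun j i + s * (1 / sqrt q * g i)) x"
  shows "\<bar>(\<Sum>i<n. x i j * (\<Sum>k<p. g k * x i k)) / real n - \<xi> j\<bar> \<le> \<tau> * M1 * L2_set \<xi> {..<p}"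
proof -
  define a where "a = entries \<Sigma> j j"
  have a: "a > 0" "a \<le> M1"
  proof -
    have "0 < 1 / M1" using M1 by simp
    then show "a > 0" using variance_bounds(1)[OF j] unfolding a_def by linarith
    show "a \<le> M1" using variance_bounds(2)[OF j] by (simp add: a_def)
  qed
  have q: "q > 0" using precision_pos_def[OF pp] \<xi> by (simp add: pos_def_def q_def)
  have q_le: "q \<le> M1 * (L2_set \<xi> {..<p})\<^sup>2" using upper[of \<xi>] by (simp add: q_def L2_set_power2)
  define e where "e = (\<lambda>i. 1 / sqrt a * unit_fun j i)"
  define h where "h = (\<lambda>i. 1 / sqrt q * g i)"
  have g\<xi>: "(\<Sum>k<p. entries \<Sigma> i k * g k) = \<xi> i" if "i < p" for i
    unfolding g_def using that by (rule precision_apply_inverse(2)[OF pp])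
  have qg: "quad_form p (entries \<Sigma>) g = q"
    unfolding q_def g_def by (rule quad_form_precision[OF pp, symmetric])
  have qe: "quad_form p (entries \<Sigma>) e = 1"
    unfolding e_def quad_form_scale using a by (simp add: quad_form_unit_fun j a_def power_divide)
  have qh: "quad_form p (entries \<Sigma>) h = 1"
    unfolding h_def quad_form_scale qg using q by (simp add: power_divide)
  have cross: "(\<Sum>i<p. e i * (\<Sum>k<p. entries \<Sigma> i k * h k)) = \<xi> j / (sqrt a * sqrt q)"
  proof -
    have "(\<Sum>i<p. e i * (\<Sum>k<p. entries \<Sigma> i k * h k)) = (\<Sum>i<p. (\<xi> i / (sqrt a * sqrt q)) * unit_fun j i)"
    proof (intro sum.cong refl)
      fix i assume "i \<in> {..<p}"
      then have "(\<Sum>k<p. entries \<Sigma> i k * h k) = 1 / sqrt q * \<xi> i"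
        by (simp add: h_def g\<xi>[symmetric] sum_distrib_left mult_ac)
      then show "e i * (\<Sum>k<p. entries \<Sigma> i k * h k) = (\<xi> i / (sqrt a * sqrt q)) * unit_fun j i"
        by (simp add: e_def)
    qed
    also have "\<dots> = \<xi> j / (sqrt a * sqrt q)" by (rule sum_lessThan_delta(1)[OF j])
    finally show ?thesis .
  qed
  have v: "quad_form p (entries \<Sigma>) (\<lambda>i. e i + s * h i) = 1 + 2 * s * (\<xi> j / (sqrt a * sqrt q)) + s\<^sup>2" for s
    using quad_form_add[of p "entries \<Sigma>" e s h]
    by (simp add: qe qh cross covariance_symmetric[OF pp])
  have E: "energy n p x (\<lambda>i. e i + s * h i) = energy n p x e
    + 2 * s * ((\<Sum>i<n. x i j * (\<Sum>k<p. g k * x i k)) / (sqrt a * sqrt q)) + s\<^sup>2 * energy n p x h" for s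
  proof -
    have "(\<Sum>k<p. e k * x i k) = x i j / sqrt a" for i
    proof -
      have "(\<Sum>k<p. e k * x i k) = (\<Sum>k<p. (x i k / sqrt a) * unit_fun j k)"
        unfolding e_def by (intro sum.cong refl) auto
      also have "\<dots> = x i j / sqrt a" by (rule sum_lessThan_delta(1)[OF j])
      finally show ?thesis .
    qed
    note eh = this
    have hh: "(\<Sum>k<p. h k * x i k) = (\<Sum>k<p. g k * x i k) / sqrt q" for i
      by (simp add: h_def sum_divide_distrib)
    have "(\<Sum>i<n. (\<Sum>k<p. e k * x i k) * (\<Sum>k<p. h k * x i k)) =
      (\<Sum>i<n. x i j * (\<Sum>k<p. g k * x i k)) / (sqrt a * sqrt q)"
      unfolding eh hh by (subst sum_divide_distrib) (intro sum.cong refl, simp only: times_divide_times_eq)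
    then show ?thesis unfolding energy_add by simp
  qed
  define R where "R = (\<Sum>i<n. x i j * (\<Sum>k<p. g k * x i k)) / (sqrt a * sqrt q)"
  define r where "r = \<xi> j / (sqrt a * sqrt q)"
  have d: "\<bar>energy n p x (\<lambda>i. e i + s * h i) - real n * quad_form p (entries \<Sigma>) (\<lambda>i. e i + s * h i)\<bar>
      \<le> \<tau> * (real n * quad_form p (entries \<Sigma>) (\<lambda>i. e i + s * h i))" if "s \<in> {-1, 1}" for s
    using dev[OF that] unfolding relative_dev_def e_def h_def a_def by (simp only: not_less)
  have "\<bar>energy n p x e + 2 * R + energy n p x h - real n * (2 + 2 * r)\<bar> \<le> \<tau> * (real n * (2 + 2 * r))"
    "\<bar>energy n p x e - 2 * R + energy n p x h - real n * (2 - 2 * r)\<bar> \<le> \<tau> * (real n * (2 - 2 * r))"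
    using d[of 1] d[of "-1"] unfolding v E R_def r_def by simp_all
  moreover have "\<tau> * (real n * (2 + 2 * r)) = 2 * (\<tau> * real n) + 2 * (\<tau> * (real n * r))"
    "\<tau> * (real n * (2 - 2 * r)) = 2 * (\<tau> * real n) - 2 * (\<tau> * (real n * r))"
    "real n * (2 + 2 * r) = 2 * real n + 2 * (real n * r)" "real n * (2 - 2 * r) = 2 * real n - 2 * (real n * r)"
    by (simp_all add: algebra_simps)
  \<comment> \<open>Unit variances make the two tolerances add up to
    \<open>4 * (\<tau> * real n)\<close>: their parts in \<open>r\<close> have opposite signs and
    cancel.\<close>
  ultimately have "\<bar>4 * R - 4 * (real n * r)\<bar> \<le> 4 * (\<tau> * real n)"
    by linarith
  then have "\<bar>R / real n - r\<bar> \<le> \<tau>" using n by (simp add: field_simps abs_le_iff)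
  then have "\<bar>R / real n - r\<bar> * (sqrt a * sqrt q) \<le> \<tau> * (sqrt a * sqrt q)"
    using a q by (intro mult_right_mono) auto
  also have "\<bar>R / real n - r\<bar> * (sqrt a * sqrt q) = \<bar>(R / real n - r) * (sqrt a * sqrt q)\<bar>"
    using a q by (simp add: abs_mult)
  also have "(R / real n - r) * (sqrt a * sqrt q) = (\<Sum>i<n. x i j * (\<Sum>k<p. g k * x i k)) / real n - \<xi> j"
    using a q by (simp add: R_def r_def field_simps)
  finally have "\<bar>(\<Sum>i<n. x i j * (\<Sum>k<p. g k * x i k)) / real n - \<xi> j\<bar> \<le> \<tau> * (sqrt a * sqrt q)" .
  also have "sqrt a * sqrt q \<le> sqrt M1 * sqrt (M1 * (L2_set \<xi> {..<p})\<^sup>2)"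
    using a q q_le by (intro mult_mono real_sqrt_le_mono) auto
  also have "\<dots> = M1 * L2_set \<xi> {..<p}"
    using M1 by (simp add: real_sqrt_mult)
  finally show ?thesis using \<tau> by (simp add: mult_left_mono mult.assoc)
qed

end

end

section \<open>The interval on a good sample\<close>

definition precision_dir :: "nat \<Rightarrow> real mat \<Rightarrow> real vec \<Rightarrow> nat \<Rightarrow> real" where
  "precision_dir p \<Omega> \<xi> i = (\<Sum>k<p. entries \<Omega> i k * \<xi> $ k)"

text \<open>Normalised coordinate plus or minus normalised \<open>\<Omega>\<xi>\<close>; polarisation over the two signs turns
  control of second moments into control of \<open>\<Sigma>-hat \<Omega>\<xi> - \<xi>\<close>.\<close>

definition polar_dir :: "nat \<Rightarrow> real mat \<Rightarrow> real mat \<Rightarrow> real vec \<Rightarrow> nat \<times> real \<Rightarrow> nat \<Rightarrow> real" where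
  "polar_dir p \<Omega> \<Sigma> \<xi> = (\<lambda>(j, s) i. 1 / sqrt (entries \<Sigma> j j) * unit_fun j i
    + s * (1 / sqrt (quad_form p (entries \<Omega>) (($) \<xi>)) * precision_dir p \<Omega> \<xi> i))"

text \<open>The four groups serve the column norms, the restricted eigenvalue, the variance of
  \<open>\<Omega>\<xi>\<close> and its feasibility. The last tolerance is the factor
  \<open>12 * sqrt (ln p / n)\<close> of \<open>\<lambda>\<^sub>n\<close>.\<close>

definition good_design :: "nat \<Rightarrow> nat \<Rightarrow> nat \<Rightarrow> real mat \<Rightarrow> real mat \<Rightarrow> real vec \<Rightarrow> (nat \<Rightarrow> nat \<Rightarrow> real) \<Rightarrow> bool" where
  "good_design n p N \<Omega> \<Sigma> \<xi> x \<longleftrightarrow>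
    (\<forall>j\<in>{..<p}. \<not> relative_dev n p \<Sigma> (1 / 2) (unit_fun j) x) \<and>
    (\<forall>xs\<in>{xs. set xs \<subseteq> {..<p} \<times> {-1, 1} \<and> length xs = N}. \<not> relative_dev n p \<Sigma> (1 / 2) (signed_unit_sum xs) x) \<and>
    \<not> relative_dev n p \<Sigma> (1 / 2) (precision_dir p \<Omega> \<xi>) x \<and>
    (\<forall>js\<in>{..<p} \<times> {-1, 1}. \<not> relative_dev n p \<Sigma> (12 * sqrt (ln (real p) / real n)) (polar_dir p \<Omega> \<Sigma> \<xi> js) x)"

text \<open>The constant 2.02 exceeds 2, so that the union bound over the \<open>p\<close> columns vanishes, and satisfies
  \<open>2.02 < (404 / 406)\<^sup>2 * 2.05 * (1 - 1 / 250)\<close>, so that the noise level of the Lasso analysis is met.\<close>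

definition good_noise :: "nat \<Rightarrow> nat \<Rightarrow> real \<Rightarrow> (nat \<Rightarrow> nat \<Rightarrow> real) \<Rightarrow> (nat \<Rightarrow> real) \<Rightarrow> bool" where
  "good_noise n p \<sigma> x e \<longleftrightarrow>
    \<not> \<bar>(\<Sum>i<n. (e i)\<^sup>2) - real n * \<sigma>\<^sup>2\<bar> > 1 / 250 * (real n * \<sigma>\<^sup>2) \<and>
    (\<forall>j\<in>{..<p}. \<not> \<bar>\<Sum>i<n. x i j * e i\<bar> > \<sigma> * L2_set (\<lambda>i. x i j) {..<n} * sqrt (2.02 * ln (real p)))"

lemma sqrt_mult_power2: "0 \<le> c \<Longrightarrow> sqrt (a * c\<^sup>2) = c * sqrt a" for a c :: real
  by (simp add: real_sqrt_mult)

text \<open>Everything about one good pair of design and noise is deterministic. Probability enters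
  later, only through the two goodness conditions and the central event of the noise term.\<close>

locale good_sample = precision_bounds p \<Omega> \<Sigma> M1 for p :: nat and \<Omega> \<Sigma> :: "real mat" and M1 :: real +
  fixes n k L :: nat and \<xi> \<beta> :: "real vec" and \<sigma> :: real
    and x :: "nat \<Rightarrow> nat \<Rightarrow> real" and e :: "nat \<Rightarrow> real"
    and bhat :: "real vec \<Rightarrow> real mat \<Rightarrow> real vec" and shat :: "real vec \<Rightarrow> real mat \<Rightarrow> real"
    and uhat :: "real mat \<Rightarrow> real vec"
  assumes n: "n \<ge> 1" and p: "p \<ge> 2" and k: "k \<ge> 1"
    and L: "real L \<ge> 6 * 703\<^sup>2 * M1 ^ 4"
    and c: "real k * ln (real p) \<le> 1 / (10 ^ 14 * M1\<^sup>2) * real n"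
    and \<xi>: "\<xi> \<in> carrier_vec p" "\<xi> \<noteq> 0\<^sub>v p" and \<beta>: "\<beta> \<in> carrier_vec p" "norm_l0 \<beta> \<le> k" and \<sigma>: "\<sigma> > 0"
    and design: "good_design n p (L * k + 1) \<Omega> \<Sigma> \<xi> x" and noise: "good_noise n p \<sigma> x e"
    and sl: "scaled_lasso n p bhat shat" and pd: "projection_direction n p M1 \<xi> uhat"
begin

definition "X = mat n p (\<lambda>(i, j). x i j)"
definition "y = X *\<^sub>v \<beta> + vec n e"
definition "b = bhat y X"
definition "u = uhat X"
definition "s0 = L2_set e {..<n} / sqrt (real n)"
definition "l0 = sqrt (2.05 * ln (real p) / real n)"
definition "w j = norm_l2 (col X j) / sqrt (real n)"
definition "\<kappa> = restricted_eigenvalue n p X k (405 * (max_col_norm X / min_col_norm X))"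
definition "W = max_col_norm X / sqrt (real n)"
definition "w_min = min_col_norm X / sqrt (real n)"

lemma X: "X \<in> carrier_mat n p" by (simp add: X_def)
lemma X_index: "i < n \<Longrightarrow> j < p \<Longrightarrow> X $$ (i, j) = x i j" by (simp add: X_def)
lemma y: "y \<in> carrier_vec n"
  unfolding y_def by (intro add_carrier_vec mult_mat_vec_carrier[OF X \<beta>(1)]) simp

lemma ln_p: "ln (real p) > 0" using p by simp

lemma y_minus_fit:
  assumes "v \<in> carrier_vec p" "i < n"
  shows "(y - X *\<^sub>v v) $ i = e i - (\<Sum>j<p. x i j * (v $ j - \<beta> $ j))"
proof -
  have "(X *\<^sub>v t) $ i = (\<Sum>j<p. x i j * t $ j)" if "t \<in> carrier_vec p" for t
    using mult_mat_vec_index[OF X that assms(2)] assms(2) by (simp add: X_index del: index_mult_mat_vec)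
  then show ?thesis
    using assms \<beta>(1) X by (simp add: y_def right_diff_distrib sum_subtractf del: index_mult_mat_vec)
qed

lemma w_eq: "j < p \<Longrightarrow> w j = L2_set (\<lambda>i. x i j) {..<n} / sqrt (real n)"
  unfolding w_def col_norm_eq[OF X] by (auto intro!: arg_cong2[where f="(/)"] L2_set_cong simp: X_index)

lemma w_power2_bounds:
  assumes "j < p" shows "1 / (2 * M1) \<le> (w j)\<^sup>2" "(w j)\<^sup>2 \<le> 3 / 2 * M1"
proof -
  have d: "\<not> relative_dev n p \<Sigma> (1 / 2) (unit_fun j) x" using design assms by (simp add: good_design_def)
  have "(w j)\<^sup>2 = (\<Sum>i<n. (x i j)\<^sup>2) / real n"
    using assms by (simp add: w_eq power_divide L2_set_power2)
  then show "1 / (2 * M1) \<le> (w j)\<^sup>2" "(w j)\<^sup>2 \<le> 3 / 2 * M1"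
    using divide_right_mono[OF column_energy_bounds(1)[OF n assms d], of "real n"]
      divide_right_mono[OF column_energy_bounds(2)[OF n assms d], of "real n"] n by simp_all
qed

lemma w_bounds:
  assumes "j < p" shows "sqrt (1 / (2 * M1)) \<le> w j" "w j \<le> sqrt (3 / 2 * M1)"
proof -
  have "w j \<ge> 0" by (simp add: w_def)
  then show "sqrt (1 / (2 * M1)) \<le> w j" "w j \<le> sqrt (3 / 2 * M1)"
    using w_power2_bounds[OF assms] by (auto intro: real_le_lsqrt real_le_rsqrt)
qed

lemma w_min_max:
  shows "j < p \<Longrightarrow> w_min \<le> w j" "j < p \<Longrightarrow> w j \<le> W"
    "sqrt (1 / (2 * M1)) \<le> w_min" "W \<le> sqrt (3 / 2 * M1)" "w_min > 0" "W > 0" "W / w_min = max_col_norm X / min_col_norm X"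
proof -
  have dim: "dim_col X = p" by (simp add: X_def)
  have fin: "finite ((\<lambda>j. norm_l2 (col X j)) ` {..<p})" "(\<lambda>j. norm_l2 (col X j)) ` {..<p} \<noteq> {}" using p by (auto simp: lessThan_empty_iff)
  have N: "sqrt (real n) > 0" using n by simp
  show le: "w_min \<le> w j" "w j \<le> W" if "j < p" for j
    unfolding w_min_def W_def w_def min_col_norm_def max_col_norm_def dim
    using that N fin by (auto intro!: divide_right_mono Min_le Max_ge)
  have "min_col_norm X \<in> (\<lambda>j. norm_l2 (col X j)) ` {..<p}" "max_col_norm X \<in> (\<lambda>j. norm_l2 (col X j)) ` {..<p}"
    unfolding min_col_norm_def max_col_norm_def dim using fin by (auto intro: Min_in Max_in)
  then show lo: "sqrt (1 / (2 * M1)) \<le> w_min" and hi: "W \<le> sqrt (3 / 2 * M1)"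
    using w_bounds unfolding w_min_def W_def w_def by auto
  have "0 < sqrt (1 / (2 * M1))" using M1 by simp
  then show w0: "w_min > 0" using lo by linarith
  with le[of 0] p show "W > 0" by force
  show "W / w_min = max_col_norm X / min_col_norm X" using N by (simp add: W_def w_min_def)
qed

definition "\<alpha>0 = 405 * (max_col_norm X / min_col_norm X)"

text \<open>The ratio of extreme column norms is at most \<open>sqrt 3 * M1\<close>, and
  \<open>1 + 405 * 1.733 * M1 \<le> 703 * M1\<close> because \<open>M1 > 1\<close>.\<close>

lemma \<alpha>0: "\<alpha>0 = 405 * (W / w_min)" "\<alpha>0 \<ge> 0" "1 + \<alpha>0 \<le> 703 * M1"
proof -
  show eq: "\<alpha>0 = 405 * (W / w_min)" by (simp add: \<alpha>0_def w_min_max(7))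
  show "\<alpha>0 \<ge> 0"
    unfolding eq using w_min_max(5,6) by (intro mult_nonneg_nonneg divide_nonneg_nonneg) auto
  have "W / w_min \<le> sqrt (3 / 2 * M1) / sqrt (1 / (2 * M1))"
    using w_min_max M1 by (intro frac_le) auto
  also have "\<dots> = sqrt (3 * M1\<^sup>2)" using M1 by (simp add: power2_eq_square flip: real_sqrt_divide)
  also have "\<dots> \<le> sqrt ((1.733 * M1)\<^sup>2)"
    by (intro real_sqrt_le_mono) (simp add: power2_eq_square)
  also have "\<dots> = 1.733 * M1" using M1 by simp
  finally show "1 + \<alpha>0 \<le> 703 * M1" using M1 by (simp add: eq)
qed

lemma \<kappa>_eq: "\<kappa> = Inf (re_ratio n p x ` re_cone p k \<alpha>0)"
proof -
  have "re_ratio n p (\<lambda>i j. X $$ (i, j)) c = re_ratio n p x c" for c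
    unfolding re_ratio_def by (auto simp: X_index intro!: arg_cong2[where f="(/)"] L2_set_cong split: prod.split)
  then show ?thesis
    by (simp add: \<kappa>_def \<alpha>0_def restricted_eigenvalue_eq[OF X])
qed

lemma \<kappa>_lower: "\<kappa> \<ge> 1 / (2 * sqrt M1)"
  unfolding \<kappa>_eq
proof (rule cINF_greatest)
  show "re_cone p k \<alpha>0 \<noteq> {}" using p k \<alpha>0 by (intro re_cone_nonempty) auto
  fix c assume "c \<in> re_cone p k \<alpha>0"
  moreover obtain J d where "c = (J, d)" by force
  ultimately show "re_ratio n p x c \<ge> 1 / (2 * sqrt M1)"
    using design unfolding good_design_def
    by (auto intro!: restricted_eigenvalue_lower[OF n k L \<alpha>0(3,2)])
qed

lemma \<kappa>_pos: "\<kappa> > 0"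
proof -
  have "0 < 1 / (2 * sqrt M1)" using M1 by simp
  then show ?thesis using \<kappa>_lower by linarith
qed

text \<open>Here the first bound on \<open>c\<close> is spent: the square of the left side is at
  most \<open>12.3 / 10 ^ 14\<close>, where \<open>12.3 = 2.05 * 3 / 2 * 4\<close> collects the
  penalty level, the column norms and the restricted eigenvalue.\<close>

lemma small: "l0 * W * sqrt (real k) / \<kappa> \<le> 1 / 10 ^ 6"
proof -
  have r: "sqrt M1 > 0" using M1 by simp
  have "l0 * W * sqrt (real k) / \<kappa> \<le> l0 * sqrt (3 / 2 * M1) * sqrt (real k) / (1 / (2 * sqrt M1))"
    using w_min_max \<kappa>_lower M1 p by (intro frac_le mult_mono) (auto simp: l0_def)
  also have "\<dots> = l0 * sqrt (3 / 2 * M1) * sqrt (real k) * (2 * sqrt M1)" by simp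
  also have "\<dots> = sqrt (2.05 * ln (real p) / real n * (3 / 2 * M1) * real k * (4 * M1))"
  proof -
    have two: "2 * sqrt M1 = sqrt (4 * M1)" by (simp add: real_sqrt_mult)
    show ?thesis unfolding two l0_def by (simp only: real_sqrt_mult)
  qed
  also have "\<dots> = sqrt (12.3 * M1\<^sup>2 * (real k * ln (real p) / real n))"
    by (intro arg_cong[where f=sqrt]) (simp add: power2_eq_square)
  also have "\<dots> \<le> sqrt (12.3 * M1\<^sup>2 * (1 / (10 ^ 14 * M1\<^sup>2)))"
    using c n M1 by (intro real_sqrt_le_mono mult_left_mono) (auto simp: field_simps)
  also have "\<dots> \<le> sqrt ((1 / 10 ^ 6)\<^sup>2)"
    using M1 by (intro real_sqrt_le_mono) (simp add: field_simps)
  finally show ?thesis by simp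
qed

lemma s0_bounds: "996 / 1000 * \<sigma>\<^sup>2 \<le> s0\<^sup>2" "s0\<^sup>2 \<le> 1004 / 1000 * \<sigma>\<^sup>2" "s0 > 0"
proof -
  have s2: "s0\<^sup>2 = (\<Sum>i<n. (e i)\<^sup>2) / real n" by (simp add: s0_def power_divide L2_set_power2)
  have "\<bar>(\<Sum>i<n. (e i)\<^sup>2) - real n * \<sigma>\<^sup>2\<bar> \<le> 1 / 250 * (real n * \<sigma>\<^sup>2)"
    using noise by (simp add: good_noise_def not_less)
  then have "996 / 1000 * (real n * \<sigma>\<^sup>2) \<le> (\<Sum>i<n. (e i)\<^sup>2)" "(\<Sum>i<n. (e i)\<^sup>2) \<le> 1004 / 1000 * (real n * \<sigma>\<^sup>2)"
    by linarith+
  then show lo: "996 / 1000 * \<sigma>\<^sup>2 \<le> s0\<^sup>2" and "s0\<^sup>2 \<le> 1004 / 1000 * \<sigma>\<^sup>2"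
    using n by (simp_all add: s2 field_simps)
  have "0 < 996 / 1000 * \<sigma>\<^sup>2" using \<sigma> by simp
  then have "s0\<^sup>2 > 0" using lo by linarith
  moreover have "s0 \<ge> 0" by (simp add: s0_def)
  ultimately show "s0 > 0" by (simp add: less_le)
qed

lemma s0_le: "s0 \<le> 1002 / 1000 * \<sigma>" and le_s0: "9979 / 10000 * \<sigma> \<le> s0"
proof -
  have "1004 / 1000 * \<sigma>\<^sup>2 \<le> (1002 / 1000)\<^sup>2 * \<sigma>\<^sup>2"
    by (intro mult_right_mono) (auto simp: power2_eq_square)
  then have "s0\<^sup>2 \<le> (1002 / 1000 * \<sigma>)\<^sup>2" using s0_bounds(2) unfolding power_mult_distrib by linarith
  then show "s0 \<le> 1002 / 1000 * \<sigma>" by (rule power2_le_imp_le) (use \<sigma> in simp)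
  have "(9979 / 10000)\<^sup>2 * \<sigma>\<^sup>2 \<le> 996 / 1000 * \<sigma>\<^sup>2"
    by (intro mult_right_mono) (auto simp: power2_eq_square)
  then have "(9979 / 10000 * \<sigma>)\<^sup>2 \<le> s0\<^sup>2" using s0_bounds(1) unfolding power_mult_distrib by linarith
  then show "9979 / 10000 * \<sigma> \<le> s0" by (rule power2_le_imp_le) (use s0_bounds(3) in simp)
qed

lemma noise_bound:
  assumes j: "j < p"
  shows "\<bar>\<Sum>i<n. x i j * e i\<bar> \<le> 404 / 406 * l0 * s0 * real n * w j"
proof -
  define D where "D = L2_set (\<lambda>i. x i j) {..<n}"
  have "\<bar>\<Sum>i<n. x i j * e i\<bar> \<le> \<sigma> * D * sqrt (2.02 * ln (real p))"
    using noise j by (simp add: good_noise_def D_def not_less)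
  also have "\<dots> = D * sqrt (2.02 * \<sigma>\<^sup>2 * ln (real p))"
  proof -
    have "2.02 * \<sigma>\<^sup>2 * ln (real p) = 2.02 * ln (real p) * \<sigma>\<^sup>2" by simp
    then have "sqrt (2.02 * \<sigma>\<^sup>2 * ln (real p)) = \<sigma> * sqrt (2.02 * ln (real p))"
      using \<sigma> by (simp only: sqrt_mult_power2)
    then show ?thesis by (simp only: mult_ac)
  qed
  also have "\<dots> \<le> D * sqrt ((404 / 406)\<^sup>2 * 2.05 * s0\<^sup>2 * ln (real p))"
  proof (intro mult_left_mono real_sqrt_le_mono mult_right_mono)
    have "2.02 * \<sigma>\<^sup>2 \<le> (404 / 406)\<^sup>2 * 2.05 * (996 / 1000 * \<sigma>\<^sup>2)" by (simp add: power2_eq_square)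
    also have "\<dots> \<le> (404 / 406)\<^sup>2 * 2.05 * s0\<^sup>2" using s0_bounds(1) by (intro mult_left_mono) auto
    finally show "2.02 * \<sigma>\<^sup>2 \<le> (404 / 406)\<^sup>2 * 2.05 * s0\<^sup>2" .
  qed (use ln_p in \<open>auto simp: D_def\<close>)
  also have "\<dots> = D * (404 / 406 * s0 * sqrt (2.05 * ln (real p)))"
  proof -
    have "(404 / 406)\<^sup>2 * 2.05 * s0\<^sup>2 * ln (real p) = 2.05 * ln (real p) * (404 / 406 * s0)\<^sup>2"
      by (simp only: power_mult_distrib mult_ac)
    moreover have "0 \<le> 404 / 406 * s0" using s0_bounds(3) by simp
    ultimately show ?thesis by (simp only: sqrt_mult_power2)
  qed
  also have "\<dots> = 404 / 406 * l0 * s0 * real n * w j"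
  proof -
    define r where "r = sqrt (real n)"
    have r: "r > 0" "real n = r * r" using n by (auto simp: r_def)
    have l: "l0 = sqrt (2.05 * ln (real p)) / r" by (simp only: l0_def r_def real_sqrt_divide)
    have w: "w j = D / r" using j by (simp only: w_eq D_def r_def)
    show ?thesis unfolding l w r(2) using r(1) by simp
  qed
  finally show ?thesis .
qed

lemma lasso_locale:
  assumes v: "v \<in> carrier_vec p"
    and basic: "norm_l2 (y - X *\<^sub>v v) / sqrt (real n) + l0 * (\<Sum>j<p. w j * \<bar>v $ j\<bar>)
      \<le> norm_l2 (y - X *\<^sub>v \<beta>) / sqrt (real n) + l0 * (\<Sum>j<p. w j * \<bar>\<beta> $ j\<bar>)"
  shows "square_root_lasso n p x e (($) \<beta>) (($) v) w l0 s0 (supp_vec \<beta>)"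
    and "norm_l2 (y - X *\<^sub>v v) / sqrt (real n) = square_root_lasso.resid n p x e (($) \<beta>) (($) v)"
    and "\<kappa> * L2_set (square_root_lasso.h (($) \<beta>) (($) v)) (supp_vec \<beta>) \<le> square_root_lasso.a n p x (($) \<beta>) (($) v)"
proof -
  have Q: "norm_l2 (y - X *\<^sub>v t) = L2_set (\<lambda>i. e i - (\<Sum>j<p. x i j * (t $ j - \<beta> $ j))) {..<n}" if "t \<in> carrier_vec p" for t
    unfolding norm_l2_eq_L2_set using y X that
    by (intro L2_set_cong) (auto simp: y_minus_fit simp del: index_minus_vec index_mult_mat_vec)
  have Q\<beta>: "norm_l2 (y - X *\<^sub>v \<beta>) = L2_set e {..<n}" by (simp add: Q[OF \<beta>(1)])
  have J: "supp_vec \<beta> \<subseteq> {..<p}" using \<beta>(1) by (auto simp: supp_vec_def)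
  show loc: "square_root_lasso n p x e (($) \<beta>) (($) v) w l0 s0 (supp_vec \<beta>)"
  proof
    show "0 < n" using n by simp
    show "0 < l0" using n ln_p by (simp add: l0_def)
    show "0 < s0" by (rule s0_bounds)
    show "s0 = L2_set e {..<n} / sqrt (real n)" by (rule s0_def)
    show "w j \<ge> 0" for j by (simp add: w_def)
    show "supp_vec \<beta> \<subseteq> {..<p}" by (rule J)
    show "\<beta> $ j = 0" if "j < p" "j \<notin> supp_vec \<beta>" for j using that \<beta>(1) by (auto simp: supp_vec_def)
    show "L2_set (\<lambda>i. e i - (\<Sum>j<p. x i j * (v $ j - \<beta> $ j))) {..<n} / sqrt (real n) + l0 * (\<Sum>j<p. w j * \<bar>v $ j\<bar>)
      \<le> s0 + l0 * (\<Sum>j<p. w j * \<bar>\<beta> $ j\<bar>)"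
      using basic by (simp only: Q[OF v] Q\<beta> s0_def)
    show "\<bar>\<Sum>i<n. x i j * e i\<bar> \<le> 404 / 406 * l0 * s0 * real n * w j" if "j < p" for j
      by (rule noise_bound[OF that])
  qed
  interpret square_root_lasso n p x e "($) \<beta>" "($) v" w l0 s0 "supp_vec \<beta>" by (rule loc)
  show "norm_l2 (y - X *\<^sub>v v) / sqrt (real n) = resid"
    by (simp add: Q[OF v] resid_def Xh_def h_def)
  show "\<kappa> * L2_set h (supp_vec \<beta>) \<le> a"
  proof (cases "\<exists>j<p. h j \<noteq> 0")
    case True
    \<comment> \<open>Replacing the weights by their extremes turns the weighted cone with constant
      405 into the unweighted cone with constant \<open>\<alpha>0\<close>, the one in the definition
      of \<open>C1_const\<close>.\<close>
    have "w_min * (\<Sum>j\<in>{..<p} - supp_vec \<beta>. \<bar>h j\<bar>) \<le> Hc"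
      unfolding Hc_def sum_distrib_left using w_min_max by (intro sum_mono mult_right_mono) auto
    also note cone
    also have "405 * H \<le> 405 * (W * (\<Sum>j\<in>supp_vec \<beta>. \<bar>h j\<bar>))"
      unfolding H_def sum_distrib_left[of W] using w_min_max J by (intro mult_left_mono sum_mono mult_right_mono) auto
    finally have "(\<Sum>j\<in>{..<p} - supp_vec \<beta>. \<bar>h j\<bar>) \<le> \<alpha>0 * (\<Sum>j\<in>supp_vec \<beta>. \<bar>h j\<bar>)"
      using w_min_max(5) by (simp add: \<alpha>0 field_simps)
    then have C: "(supp_vec \<beta>, h) \<in> re_cone p k \<alpha>0"
      using J \<beta>(2) True by (simp add: re_cone_def norm_l0_def)
    have "\<kappa> \<le> re_ratio n p x (supp_vec \<beta>, h)"
      unfolding \<kappa>_eq by (intro cINF_lower bdd_below_re_ratio C)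
    also have "\<dots> = a / L2_set h (supp_vec \<beta>)"
      by (simp add: re_ratio_def a_def Xh_def[abs_def])
    finally show ?thesis using re_cone_restrict_pos(2)[OF C] by (simp add: field_simps)
  next
    case False
    then have "L2_set h (supp_vec \<beta>) = 0" using J by (auto simp: L2_set_def intro!: sum.neutral)
    then show ?thesis using nonneg(1) by simp
  qed
qed

lemma lasso_context:
  "j < p \<Longrightarrow> w j \<le> W" "W > 0" "\<kappa> > 0" "real (card (supp_vec \<beta>)) \<le> real k"
  using w_min_max \<kappa>_pos \<beta>(2) by (auto simp: norm_l0_def)

lemma lasso_estimate:
  shows "b \<in> carrier_vec p" "996 / 1000 * \<sigma> \<le> shat y X" "shat y X \<le> 101 / 100 * \<sigma>" "s0 \<le> 1002 / 1000 * shat y X"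
    "(\<Sum>j<p. w j * \<bar>b $ j - \<beta> $ j\<bar>) \<le> 329266 * s0 * l0 * W\<^sup>2 * real k / \<kappa>\<^sup>2"
proof -
  define pen where "pen v = l0 * (\<Sum>j<p. w j * \<bar>v $ j\<bar>)" for v :: "real vec"
  define Q where "Q v = norm_l2 (y - X *\<^sub>v v) / sqrt (real n)" for v
  have Qb: "999 / 1000 * s0 \<le> Q v" "Q v \<le> 1001 / 1000 * s0"
    "(\<Sum>j<p. w j * \<bar>v $ j - \<beta> $ j\<bar>) \<le> 329266 * s0 * l0 * W\<^sup>2 * real k / \<kappa>\<^sup>2"
    if v: "v \<in> carrier_vec p" and basic: "Q v + pen v \<le> Q \<beta> + pen \<beta>" for v
  proof -
    note loc = lasso_locale[OF v basic[unfolded Q_def pen_def]]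
    interpret square_root_lasso n p x e "($) \<beta>" "($) v" w l0 s0 "supp_vec \<beta>" by (rule loc)
    show "999 / 1000 * s0 \<le> Q v" "Q v \<le> 1001 / 1000 * s0"
      unfolding Q_def loc(2) using resid_bounds[OF lasso_context loc(3) small] by auto
    show "(\<Sum>j<p. w j * \<bar>v $ j - \<beta> $ j\<bar>) \<le> 329266 * s0 * l0 * W\<^sup>2 * real k / \<kappa>\<^sup>2"
      using weighted_l1_error[OF lasso_context loc(3) small] by (simp add: h_def)
  qed
  have col: "norm_l2 (col X j) > 0" if "j < p" for j
  proof -
    have "0 < w j" using w_min_max(1)[OF that] w_min_max(5) by linarith
    then show ?thesis by (simp add: w_def zero_less_divide_iff)
  qed
  have pen: "pen v = sqrt (2.05 * ln (real p) / real n) * (\<Sum>j<p. norm_l2 (col X j) / sqrt (real n) * \<bar>v $ j\<bar>)" for v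
    by (simp add: pen_def l0_def w_def)
  \<comment> \<open>This excludes interpolation by any competitor and so yields a genuine minimiser
    with positive scale.\<close>
  have pos: "Q v > 0" if "v \<in> carrier_vec p" "Q v + pen v \<le> Q \<beta> + pen \<beta>" for v
    using Qb(1)[OF that] s0_bounds(3) by linarith
  have n0: "n > 0" using n by simp
  note min = scaled_lasso_minimiser[OF sl X y \<beta>(1) n0 p col pos[unfolded Q_def pen]]
  show b: "b \<in> carrier_vec p" unfolding b_def by (rule min(1))
  have basic: "Q b + pen b \<le> Q \<beta> + pen \<beta>" unfolding b_def Q_def pen by (rule min(2))
  have shat: "shat y X = Q b" unfolding b_def Q_def by (rule min(3))
  note Qb = Qb[OF b basic]
  show "996 / 1000 * \<sigma> \<le> shat y X" "shat y X \<le> 101 / 100 * \<sigma>" "s0 \<le> 1002 / 1000 * shat y X"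
    unfolding shat using Qb(1,2) s0_le le_s0 \<sigma> s0_bounds(3) by - linarith+
  show "(\<Sum>j<p. w j * \<bar>b $ j - \<beta> $ j\<bar>) \<le> 329266 * s0 * l0 * W\<^sup>2 * real k / \<kappa>\<^sup>2" by (rule Qb)
qed

end

text \<open>A bound for \<open>C1_const\<close> on a good sample: \<open>sqrt (2 * M1)\<close>
  bounds the inverse of the least normalised column norm, and \<open>5472 = 912 * 3 / 2 * 4\<close>
  comes from the bounds on the largest one and on the restricted eigenvalue.\<close>

definition C_max :: "real \<Rightarrow> real" where
  "C_max M1 = 7000 * M1\<^sup>2 * sqrt (2 * M1) * (5472 * M1\<^sup>2)"

text \<open>The size of the first entry of the minimum in units of the rate. Once
  \<open>ln p\<close> exceeds it, the minimum on a good sample is that first entry.\<close>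

definition width_factor :: "real \<Rightarrow> real \<Rightarrow> real" where
  "width_factor \<alpha> M1 = 1.01 * sqrt (3 / 2 * M1) * normal_upper_quantile (\<alpha> / 2) + C_max M1"

context good_sample
begin

section \<open>The debiased estimator on a good sample\<close>

definition "tol = 12 * norm_l2 \<xi> * M1\<^sup>2 * sqrt (ln (real p) / real n)"

lemma norm_\<xi>: "norm_l2 \<xi> = L2_set (($) \<xi>) {..<p}" "norm_l2 \<xi> > 0" "\<exists>i<p. \<xi> $ i \<noteq> 0"
proof -
  show eq: "norm_l2 \<xi> = L2_set (($) \<xi>) {..<p}" using \<xi> by (simp add: norm_l2_eq_L2_set)
  show ex: "\<exists>i<p. \<xi> $ i \<noteq> 0" using \<xi> by (metis carrier_vecD eq_vecI index_zero_vec)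
  then have "(\<Sum>i<p. (\<xi> $ i)\<^sup>2) > 0" by (auto intro: sum_pos2)
  then show "norm_l2 \<xi> > 0" by (simp add: eq L2_set_def)
qed

lemma linf_le_iff:
  assumes "v \<in> carrier_vec p"
  shows "norm_linf (v - \<xi>) \<le> t \<longleftrightarrow> (\<forall>j<p. \<bar>v $ j - \<xi> $ j\<bar> \<le> t)"
proof -
  have "norm_linf (v - \<xi>) = (MAX j\<in>{..<p}. \<bar>v $ j - \<xi> $ j\<bar>)"
    unfolding norm_linf_def using assms \<xi> by (intro arg_cong[where f=Max] image_cong) auto
  moreover have "{..<p} \<noteq> {}" using p by (auto simp: lessThan_empty_iff)
  ultimately show ?thesis by (auto simp: Max_le_iff)
qed

lemma sample_cov_index:
  "v \<in> carrier_vec p \<Longrightarrow> j < p \<Longrightarrow> (sample_cov n X *\<^sub>v v) $ j = (\<Sum>i<n. x i j * (\<Sum>k<p. v $ k * x i k)) / real n"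
  by (simp add: sample_cov_mult_index[OF X] X_index mult.commute[of "v $ _"])

lemma sample_cov_vec_carrier: "v \<in> carrier_vec p \<Longrightarrow> sample_cov n X *\<^sub>v v \<in> carrier_vec p"
  by (rule mult_mat_vec_carrier[OF sample_cov_carrier[OF X]])

lemma sample_cov_energy:
  "v \<in> carrier_vec p \<Longrightarrow> v \<bullet> (sample_cov n X *\<^sub>v v) = energy n p x (($) v) / real n"
  by (simp add: sample_cov_quadratic[OF X] X_index energy_def mult.commute[of "v $ _"])

text \<open>The vector \<open>\<Omega>\<xi>\<close> solves the population equation
  \<open>\<Sigma> u = \<xi>\<close>. Its feasibility puts \<open>uhat\<close> under the constraint,
  and its quadratic form bounds that of the minimiser.\<close>

lemma precision_dir_feasible:
  defines "g \<equiv> vec p (precision_dir p \<Omega> \<xi>)"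
  shows "g \<in> projection_feasible n p M1 \<xi> X" "g \<bullet> (sample_cov n X *\<^sub>v g) \<le> 3 / 2 * M1 * (norm_l2 \<xi>)\<^sup>2"
proof -
  have g: "g \<in> carrier_vec p" by (simp add: g_def)
  have gi: "(\<Sum>k<p. g $ k * x i k) = (\<Sum>k<p. precision_dir p \<Omega> \<xi> k * x i k)" for i by (simp add: g_def)
  have "\<bar>(sample_cov n X *\<^sub>v g) $ j - \<xi> $ j\<bar> \<le> tol" if j: "j < p" for j
  proof -
    define \<tau> where "\<tau> = 12 * sqrt (ln (real p) / real n)"
    have \<tau>: "\<tau> \<ge> 0" using ln_p by (simp add: \<tau>_def)
    have "\<bar>(\<Sum>i<n. x i j * (\<Sum>k<p. precision_dir p \<Omega> \<xi> k * x i k)) / real n - \<xi> $ j\<bar> \<le> \<tau> * M1 * L2_set (($) \<xi>) {..<p}"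
      unfolding precision_dir_def
    proof (rule projection_feasibility[OF n norm_\<xi>(3) j \<tau>])
      fix s :: real assume "s \<in> {-1, 1}"
      then have "\<not> relative_dev n p \<Sigma> \<tau> (polar_dir p \<Omega> \<Sigma> \<xi> (j, s)) x"
        using design j by (auto simp: good_design_def \<tau>_def)
      then show "\<not> relative_dev n p \<Sigma> \<tau> (\<lambda>i. 1 / sqrt (\<Sigma> $$ (j, j)) * unit_fun j i +
        s * (1 / sqrt (quad_form p (entries \<Omega>) (($) \<xi>)) * (\<Sum>k<p. \<Omega> $$ (i, k) * \<xi> $ k))) x"
        by (simp add: polar_dir_def precision_dir_def)
    qed
    also have "\<tau> * M1 * L2_set (($) \<xi>) {..<p} \<le> \<tau> * M1\<^sup>2 * norm_l2 \<xi>"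
      unfolding norm_\<xi>(1) using \<tau> M1 by (intro mult_right_mono mult_left_mono) (auto simp: power2_eq_square)
    also have "\<dots> = tol" by (simp add: tol_def \<tau>_def)
    finally show ?thesis by (simp add: sample_cov_index[OF g j] gi del: index_mult_mat_vec)
  qed
  then show "g \<in> projection_feasible n p M1 \<xi> X"
    using g unfolding projection_feasible_def tol_def by (simp add: linf_le_iff sample_cov_vec_carrier del: index_mult_mat_vec)
  have "energy n p x (($) g) = energy n p x (precision_dir p \<Omega> \<xi>)" by (simp add: energy_def gi)
  also have "\<dots> \<le> 3 / 2 * real n * quad_form p (entries \<Sigma>) (precision_dir p \<Omega> \<xi>)"
    using design by (intro energy_half_bounds(2)[OF n]) (simp add: good_design_def)
  also have "quad_form p (entries \<Sigma>) (precision_dir p \<Omega> \<xi>) = quad_form p (entries \<Omega>) (($) \<xi>)"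
    unfolding precision_dir_def by (rule quad_form_precision[OF pp, symmetric])
  also have "3 / 2 * real n * \<dots> \<le> 3 / 2 * real n * (M1 * (norm_l2 \<xi>)\<^sup>2)"
    using upper[of "($) \<xi>"] by (intro mult_left_mono) (auto simp: norm_\<xi> L2_set_power2)
  finally show "g \<bullet> (sample_cov n X *\<^sub>v g) \<le> 3 / 2 * M1 * (norm_l2 \<xi>)\<^sup>2"
    using n by (simp add: sample_cov_energy[OF g] field_simps)
qed

definition "U = u \<bullet> (sample_cov n X *\<^sub>v u)"

lemma u: "u \<in> carrier_vec p" "j < p \<Longrightarrow> \<bar>(sample_cov n X *\<^sub>v u) $ j - \<xi> $ j\<bar> \<le> tol"
  "U \<le> 3 / 2 * M1 * (norm_l2 \<xi>)\<^sup>2" "U = (L2_set (\<lambda>i. \<Sum>j<p. x i j * u $ j) {..<n})\<^sup>2 / real n"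
proof -
  note pdD = projection_directionD[OF pd X, folded u_def]
  show uc: "u \<in> carrier_vec p" by (rule pdD)
  have "u \<in> projection_feasible n p M1 \<xi> X" by (rule pdD(2)[OF precision_dir_feasible(1)])
  then have "norm_linf (sample_cov n X *\<^sub>v u - \<xi>) \<le> tol"
    by (simp add: projection_feasible_def tol_def)
  then show "\<bar>(sample_cov n X *\<^sub>v u) $ j - \<xi> $ j\<bar> \<le> tol" if "j < p"
    using that unfolding linf_le_iff[OF sample_cov_vec_carrier[OF uc]] by blast
  show "U \<le> 3 / 2 * M1 * (norm_l2 \<xi>)\<^sup>2"
    unfolding U_def by (rule order_trans[OF pdD(3)[OF precision_dir_feasible(1)] precision_dir_feasible(2)])
  show "U = (L2_set (\<lambda>i. \<Sum>j<p. x i j * u $ j) {..<n})\<^sup>2 / real n"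
    unfolding U_def sample_cov_energy[OF uc] by (simp add: energy_def L2_set_power2 mult.commute)
qed

definition "C1 = 7000 * M1\<^sup>2 / w_min * max 1.25 (912 * W\<^sup>2 / \<kappa>\<^sup>2)"

lemma C1_const_eq: "C1_const M1 n p X k = ereal C1"
proof -
  have pos: "min_col_norm X > 0" "max_col_norm X > 0" "real n > 0"
    using w_min_max(5,6) n by (auto simp: w_min_def W_def zero_less_divide_iff)
  have 1: "ereal (7000 * M1\<^sup>2 * sqrt (real n)) / ereal (min_col_norm X) = ereal (7000 * M1\<^sup>2 / w_min)"
    using pos by (simp add: w_min_def)
  have "912 * (max_col_norm X)\<^sup>2 / (real n * \<kappa>\<^sup>2) = 912 * W\<^sup>2 / \<kappa>\<^sup>2"
    using pos by (simp add: W_def power_divide)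
  then have 2: "ereal (912 * (max_col_norm X)\<^sup>2) / ereal (real n * \<kappa>\<^sup>2) = ereal (912 * W\<^sup>2 / \<kappa>\<^sup>2)"
    using pos \<kappa>_pos by simp
  show ?thesis
    unfolding C1_const_def \<kappa>_def[symmetric] 1 2 C1_def by (simp add: max_def)
qed

lemma C1_bounds: "C1 \<le> C_max M1" "C1 \<ge> 0" "7000 * 912 * M1\<^sup>2 * (W\<^sup>2 / (w_min * \<kappa>\<^sup>2)) \<le> C1"
proof -
  have w: "w_min > 0" "sqrt (1 / (2 * M1)) \<le> w_min" "W > 0" "W \<le> sqrt (3 / 2 * M1)" by (rule w_min_max)+
  have r: "sqrt (1 / (2 * M1)) > 0" using M1 by simp
  have a: "7000 * M1\<^sup>2 / w_min \<ge> 0" using w by simp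
  have "1 / w_min \<le> 1 / sqrt (1 / (2 * M1))" by (intro frac_le) (use w r in auto)
  also have "\<dots> = sqrt (2 * M1)" by (simp add: real_sqrt_divide)
  finally have "7000 * M1\<^sup>2 * (1 / w_min) \<le> 7000 * M1\<^sup>2 * sqrt (2 * M1)" by (intro mult_left_mono) auto
  moreover have "max 1.25 (912 * W\<^sup>2 / \<kappa>\<^sup>2) \<le> 5472 * M1\<^sup>2"
  proof (rule max.boundedI)
    have "1 \<le> M1\<^sup>2" using M1 by (simp add: one_le_power)
    then show "1.25 \<le> 5472 * M1\<^sup>2" by simp
    have "W\<^sup>2 \<le> (sqrt (3 / 2 * M1))\<^sup>2" using w by (intro power_mono) auto
    then have W2: "W\<^sup>2 \<le> 3 / 2 * M1" using M1 by simp
    have "(1 / (2 * sqrt M1))\<^sup>2 \<le> \<kappa>\<^sup>2" using \<kappa>_lower M1 by (intro power_mono) auto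
    then have \<kappa>2: "1 / (4 * M1) \<le> \<kappa>\<^sup>2" using M1 by (simp add: power_divide power_mult_distrib)
    have "912 * W\<^sup>2 / \<kappa>\<^sup>2 \<le> 912 * (3 / 2 * M1) / (1 / (4 * M1))"
      using W2 \<kappa>2 M1 by (intro frac_le mult_left_mono) auto
    also have "\<dots> = 5472 * M1\<^sup>2" using M1 by (simp add: power2_eq_square)
    finally show "912 * W\<^sup>2 / \<kappa>\<^sup>2 \<le> 5472 * M1\<^sup>2" .
  qed
  ultimately show "C1 \<le> C_max M1"
    unfolding C1_def C_max_def using M1 by (intro mult_mono) auto
  show "C1 \<ge> 0" unfolding C1_def using a by (intro mult_nonneg_nonneg) auto
  have "7000 * M1\<^sup>2 / w_min * (912 * W\<^sup>2 / \<kappa>\<^sup>2) \<le> C1"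
    unfolding C1_def using a by (intro mult_left_mono) auto
  then show "7000 * 912 * M1\<^sup>2 * (W\<^sup>2 / (w_min * \<kappa>\<^sup>2)) \<le> C1" by (simp add: mult_ac)
qed

text \<open>Hoelder's inequality pairs the constraint on \<open>uhat\<close> in the maximum norm
  with the l1 error of the Lasso. One square root of \<open>ln p / n\<close> comes from either
  factor.\<close>

lemma bias_bound:
  "\<bar>\<Sum>j<p. (\<xi> $ j - (sample_cov n X *\<^sub>v u) $ j) * (b $ j - \<beta> $ j)\<bar>
    \<le> norm_l2 \<xi> * shat y X * (C1 * (real k * ln (real p) / real n))"
proof -
  define lp where "lp = ln (real p) / real n"
  have lp: "lp \<ge> 0" using ln_p by (simp add: lp_def)
  have tol: "tol \<ge> 0" using ln_p by (simp add: tol_def)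
  have s: "shat y X \<ge> 0" using lasso_estimate(2) \<sigma> by linarith
  have "w_min * (\<Sum>j<p. \<bar>b $ j - \<beta> $ j\<bar>) \<le> (\<Sum>j<p. w j * \<bar>b $ j - \<beta> $ j\<bar>)"
    unfolding sum_distrib_left by (intro sum_mono mult_right_mono w_min_max(1)) auto
  also note lasso_estimate(5)
  also have "329266 * s0 * l0 * W\<^sup>2 * real k / \<kappa>\<^sup>2 \<le> 329266 * (1002 / 1000 * shat y X) * (144 / 100 * sqrt lp) * W\<^sup>2 * real k / \<kappa>\<^sup>2"
  proof (intro divide_right_mono mult_right_mono mult_mono)
    have "l0 = sqrt 2.05 * sqrt lp" by (simp only: l0_def lp_def real_sqrt_mult[symmetric] times_divide_eq_right)
    also have "sqrt 2.05 \<le> 144 / 100" by (rule real_le_lsqrt) (auto simp: power2_eq_square)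
    finally show "l0 \<le> 144 / 100 * sqrt lp" using lp by (simp add: mult_right_mono)
    show "0 \<le> l0" using ln_p by (simp add: l0_def)
  qed (use lasso_estimate(4) s s0_bounds(3) lp in auto)
  finally have "(\<Sum>j<p. \<bar>b $ j - \<beta> $ j\<bar>) \<le>
    329266 * (1002 / 1000 * shat y X) * (144 / 100 * sqrt lp) * W\<^sup>2 * real k / \<kappa>\<^sup>2 / w_min"
    using w_min_max(5) by (simp only: pos_le_divide_eq mult.commute)
  then have "tol * (\<Sum>j<p. \<bar>b $ j - \<beta> $ j\<bar>) \<le>
    tol * (329266 * (1002 / 1000 * shat y X) * (144 / 100 * sqrt lp) * W\<^sup>2 * real k / \<kappa>\<^sup>2 / w_min)"
    using tol by (rule mult_left_mono)
  also have "\<dots> = (12 * 329266 * (1002 / 1000) * (144 / 100)) *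
    (norm_l2 \<xi> * shat y X * (M1\<^sup>2 * (W\<^sup>2 / (w_min * \<kappa>\<^sup>2)) * (real k * (sqrt lp * sqrt lp))))"
    unfolding tol_def lp_def[symmetric] by (simp add: mult_ac del: real_sqrt_mult_self)
  \<comment> \<open>The left product is about 5.70 million, the right one 6.384 million. The factor
    \<open>1002 / 1000\<close> exchanges the empirical noise level for \<open>shat\<close>, and
    \<open>144 / 100\<close> exceeds \<open>sqrt 2.05\<close>.\<close>
  also have "\<dots> \<le> (7000 * 912) * (norm_l2 \<xi> * shat y X * (M1\<^sup>2 * (W\<^sup>2 / (w_min * \<kappa>\<^sup>2)) * (real k * (sqrt lp * sqrt lp))))"
    using s w_min_max(5) lp by (intro mult_right_mono mult_nonneg_nonneg divide_nonneg_nonneg) auto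
  also have "\<dots> = norm_l2 \<xi> * shat y X * (7000 * 912 * M1\<^sup>2 * (W\<^sup>2 / (w_min * \<kappa>\<^sup>2)) * (real k * lp))"
    using lp by simp
  also have "\<dots> \<le> norm_l2 \<xi> * shat y X * (C1 * (real k * lp))"
    using s lp C1_bounds(3) by (intro mult_left_mono mult_right_mono) auto
  finally have "tol * (\<Sum>j<p. \<bar>b $ j - \<beta> $ j\<bar>) \<le> norm_l2 \<xi> * shat y X * (C1 * (real k * ln (real p) / real n))"
    by (simp add: lp_def)
  moreover have "\<bar>\<Sum>j<p. (\<xi> $ j - (sample_cov n X *\<^sub>v u) $ j) * (b $ j - \<beta> $ j)\<bar> \<le> tol * (\<Sum>j<p. \<bar>b $ j - \<beta> $ j\<bar>)"
    unfolding sum_distrib_left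
  proof (intro order_trans[OF sum_abs] sum_mono)
    fix j assume "j \<in> {..<p}"
    then have "\<bar>\<xi> $ j - (sample_cov n X *\<^sub>v u) $ j\<bar> \<le> tol" using u(2)[of j] by (simp only: abs_minus_commute lessThan_iff)
    then show "\<bar>(\<xi> $ j - (sample_cov n X *\<^sub>v u) $ j) * (b $ j - \<beta> $ j)\<bar> \<le> tol * \<bar>b $ j - \<beta> $ j\<bar>"
      unfolding abs_mult by (rule mult_right_mono) simp
  qed
  ultimately show ?thesis by linarith
qed

lemma debiased_error:
  "debiased_estimate n \<xi> y X b u - \<xi> \<bullet> \<beta> = (\<Sum>i<n. (\<Sum>j<p. x i j * u $ j) * e i) / real n
    + (\<Sum>j<p. (\<xi> $ j - (sample_cov n X *\<^sub>v u) $ j) * (b $ j - \<beta> $ j))"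
proof -
  have b: "b \<in> carrier_vec p" by (rule lasso_estimate)
  define h where "h j = b $ j - \<beta> $ j" for j
  have yb: "y $ i - (\<Sum>k<p. x i k * b $ k) = e i - (\<Sum>k<p. x i k * h k)" if "i < n" for i
    using y_minus_fit[OF b that] mult_mat_vec_index[OF X b that] X that
    by (simp add: h_def X_index del: index_mult_mat_vec)
  define S where "S i = (\<Sum>k<p. x i k * h k)" for i
  have "(\<Sum>j<p. u $ j * (\<Sum>i<n. X $$ (i, j) * (y $ i - (\<Sum>k<p. X $$ (i, k) * b $ k)))) =
    (\<Sum>j<p. u $ j * (\<Sum>i<n. x i j * (e i - S i)))"
    by (simp add: yb X_index S_def)
  also have "\<dots> = (\<Sum>j<p. \<Sum>i<n. x i j * u $ j * e i) - (\<Sum>j<p. \<Sum>i<n. x i j * u $ j * S i)"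
    unfolding sum_distrib_left sum_subtractf[symmetric]
    by (intro sum.cong refl) (simp add: algebra_simps)
  also have "(\<Sum>j<p. \<Sum>i<n. x i j * u $ j * e i) = (\<Sum>i<n. (\<Sum>j<p. x i j * u $ j) * e i)"
    unfolding sum_distrib_right by (rule sum.swap)
  also have "(\<Sum>j<p. \<Sum>i<n. x i j * u $ j * S i) = (\<Sum>i<n. \<Sum>k<p. (\<Sum>j<p. x i j * u $ j) * (x i k * h k))"
    by (subst sum.swap) (simp only: sum_distrib_right[symmetric] sum_distrib_left[symmetric] S_def)
  also have "\<dots> = (\<Sum>k<p. (\<Sum>i<n. x i k * (\<Sum>j<p. u $ j * x i j)) * h k)"
    unfolding sum_distrib_right[of _ _ "h _"] by (subst sum.swap) (intro sum.cong refl, simp add: mult_ac)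
  also have "\<dots> = (\<Sum>k<p. real n * ((sample_cov n X *\<^sub>v u) $ k * h k))"
    using n by (intro sum.cong refl) (simp add: sample_cov_index[OF u(1)] del: index_mult_mat_vec)
  finally have "(\<Sum>j<p. u $ j * (\<Sum>i<n. X $$ (i, j) * (y $ i - (\<Sum>k<p. X $$ (i, k) * b $ k)))) / real n =
    (\<Sum>i<n. (\<Sum>j<p. x i j * u $ j) * e i) / real n - (\<Sum>k<p. (sample_cov n X *\<^sub>v u) $ k * h k)"
    using n by (simp add: diff_divide_distrib sum_distrib_left[symmetric] del: index_mult_mat_vec)
  then show ?thesis
    unfolding debiased_estimate_eq[OF X u(1) b y] scalar_prod_sum[OF \<beta>(1)]
    by (simp add: h_def left_diff_distrib right_diff_distrib sum_subtractf del: index_mult_mat_vec)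
qed

text \<open>For \<open>ln p\<close> above \<open>width_factor\<close> the fallback entry is the
  larger one, so the half width consists of the normal part and the bias part needed for
  coverage.\<close>

lemma half_width_eq:
  assumes "width_factor \<alpha> M1 \<le> ln (real p)" and z: "normal_upper_quantile (\<alpha> / 2) \<ge> 0"
  shows "half_width \<alpha> M1 n p k \<xi> X s u = norm_l2 \<xi> * s *
      (1.01 * sqrt (U / (real n * (norm_l2 \<xi>)\<^sup>2)) * normal_upper_quantile (\<alpha> / 2) + C1 * (real k * ln (real p) / real n))"
    and "1.01 * sqrt (U / (real n * (norm_l2 \<xi>)\<^sup>2)) * normal_upper_quantile (\<alpha> / 2) + C1 * (real k * ln (real p) / real n)
      \<le> width_factor \<alpha> M1 * (1 / sqrt (real n) + real k * ln (real p) / real n)"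
proof -
  let ?z = "normal_upper_quantile (\<alpha> / 2)"
  let ?r = "real k * ln (real p) / real n"
  let ?f = "1.01 * sqrt (U / (real n * (norm_l2 \<xi>)\<^sup>2)) * ?z + C1 * ?r"
  have r: "?r \<ge> 0" using ln_p by simp
  have Cm: "C_max M1 \<ge> 0" using C1_bounds by linarith
  have "U / (real n * (norm_l2 \<xi>)\<^sup>2) \<le> 3 / 2 * M1 * (norm_l2 \<xi>)\<^sup>2 / (real n * (norm_l2 \<xi>)\<^sup>2)"
    using u(3) by (intro divide_right_mono) auto
  also have "\<dots> = 3 / 2 * M1 / real n" using norm_\<xi>(2) by simp
  finally have "sqrt (U / (real n * (norm_l2 \<xi>)\<^sup>2)) \<le> sqrt (3 / 2 * M1) / sqrt (real n)"
    unfolding real_sqrt_divide[symmetric] by (rule real_sqrt_le_mono)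
  then have "1.01 * sqrt (U / (real n * (norm_l2 \<xi>)\<^sup>2)) * ?z \<le> 1.01 * (sqrt (3 / 2 * M1) / sqrt (real n)) * ?z"
    using z by (intro mult_right_mono mult_left_mono) auto
  moreover have "C1 * ?r \<le> C_max M1 * ?r" using C1_bounds(1) r by (rule mult_right_mono)
  moreover have "0 \<le> 1.01 * sqrt (3 / 2 * M1) * ?z * ?r" "0 \<le> C_max M1 * (1 / sqrt (real n))"
    by (intro mult_nonneg_nonneg; use z r M1 Cm in simp)+
  moreover have "1.01 * (sqrt (3 / 2 * M1) / sqrt (real n)) * ?z = 1.01 * sqrt (3 / 2 * M1) * ?z * (1 / sqrt (real n))"
    by simp
  ultimately show f: "?f \<le> width_factor \<alpha> M1 * (1 / sqrt (real n) + ?r)"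
    unfolding width_factor_def distrib_left distrib_right by linarith
  also have "\<dots> \<le> ln (real p) * (1 / sqrt (real n) + ?r)"
    using assms r by (intro mult_right_mono) auto
  finally have "min (ereal ?f) (ereal (ln (real p) * (1 / sqrt (real n) + ?r))) = ereal ?f" by simp
  then show "half_width \<alpha> M1 n p k \<xi> X s u = norm_l2 \<xi> * s * ?f"
    unfolding half_width_def C1_const_eq U_def[symmetric] by simp
qed

text \<open>The two summands of the half width pay for the two parts of the error: the factor 1.01
  covers the replacement of \<open>\<sigma>\<close> by \<open>shat\<close>, and the part with
  \<open>C1\<close> covers the bias. The cutoff at \<open>ln p\<close> is inactive because
  \<open>shat\<close> is at most \<open>1.01 * M2\<close>.\<close>

lemma good_sample_coverage:
  assumes wf: "width_factor \<alpha> M1 \<le> ln (real p)" and z: "normal_upper_quantile (\<alpha> / 2) \<ge> 0"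
    and M2: "\<sigma> \<le> M2" "1.01 * M2 \<le> ln (real p)"
    and zs: "response n zs = y" "design n p zs = X"
    and central: "\<bar>\<Sum>i<n. (\<Sum>j<p. x i j * u $ j) * e i\<bar> \<le>
      \<sigma> * L2_set (\<lambda>i. \<Sum>j<p. x i j * u $ j) {..<n} * normal_upper_quantile (\<alpha> / 2)"
  shows "\<xi> \<bullet> \<beta> \<in> conf_int \<alpha> M1 n p k \<xi> bhat shat uhat zs"
proof -
  let ?z = "normal_upper_quantile (\<alpha> / 2)"
  define D where "D = L2_set (\<lambda>i. \<Sum>j<p. x i j * u $ j) {..<n}"
  have D: "D \<ge> 0" by (simp add: D_def)
  have s: "shat y X \<le> ln (real p)"
    using lasso_estimate(3) M2 by simp
  have \<sigma>s: "\<sigma> \<le> 1.01 * shat y X" and s0: "shat y X \<ge> 0" using lasso_estimate(2) \<sigma> by auto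
  have root: "norm_l2 \<xi> * sqrt (U / (real n * (norm_l2 \<xi>)\<^sup>2)) = D / real n"
  proof -
    have "U / (real n * (norm_l2 \<xi>)\<^sup>2) = (D / (real n * norm_l2 \<xi>))\<^sup>2"
      unfolding u(4) D_def by (simp add: power2_eq_square)
    then have "sqrt (U / (real n * (norm_l2 \<xi>)\<^sup>2)) = D / (real n * norm_l2 \<xi>)"
      using D norm_\<xi>(2) by simp
    then show ?thesis using norm_\<xi>(2) by simp
  qed
  have "\<bar>(\<Sum>i<n. (\<Sum>j<p. x i j * u $ j) * e i) / real n\<bar> \<le> \<sigma> * D * ?z / real n"
    using central by (simp add: abs_divide divide_right_mono D_def)
  also have "\<dots> \<le> (1.01 * shat y X) * D * ?z / real n"
    using \<sigma>s D z by (intro divide_right_mono mult_right_mono) auto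
  also have "\<dots> = shat y X * (1.01 * (norm_l2 \<xi> * sqrt (U / (real n * (norm_l2 \<xi>)\<^sup>2))) * ?z)"
    unfolding root by simp
  finally have "\<bar>debiased_estimate n \<xi> y X b u - \<xi> \<bullet> \<beta>\<bar> \<le>
    shat y X * (1.01 * (norm_l2 \<xi> * sqrt (U / (real n * (norm_l2 \<xi>)\<^sup>2))) * ?z)
    + norm_l2 \<xi> * shat y X * (C1 * (real k * ln (real p) / real n))"
    unfolding debiased_error using bias_bound by linarith
  also have "\<dots> = half_width \<alpha> M1 n p k \<xi> X (shat y X) u"
    unfolding half_width_eq(1)[OF wf z] by (simp add: algebra_simps)
  finally show ?thesis
    using s by (simp add: conf_int_def Let_def zs b_def[symmetric] u_def[symmetric] abs_le_iff)
qed

lemma good_sample_half_width: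
  assumes wf: "width_factor \<alpha> M1 \<le> ln (real p)" and z: "normal_upper_quantile (\<alpha> / 2) \<ge> 0" and M2: "\<sigma> \<le> M2"
  shows "half_width \<alpha> M1 n p k \<xi> X (shat y X) u \<le>
    1.01 * M2 * width_factor \<alpha> M1 * norm_l2 \<xi> * (real k * ln (real p) / real n + 1 / sqrt (real n))"
proof -
  let ?r = "real k * ln (real p) / real n"
  have s: "0 \<le> shat y X" "shat y X \<le> 1.01 * M2" using lasso_estimate(2,3) M2 \<sigma> by auto
  have K: "0 \<le> width_factor \<alpha> M1"
    using C1_bounds(1,2) z M1 by (auto simp: width_factor_def intro!: add_nonneg_nonneg mult_nonneg_nonneg)
  have "half_width \<alpha> M1 n p k \<xi> X (shat y X) u \<le> norm_l2 \<xi> * shat y X * (width_factor \<alpha> M1 * (1 / sqrt (real n) + ?r))"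
    unfolding half_width_eq(1)[OF wf z] using s by (intro mult_left_mono half_width_eq(2)[OF wf z]) auto
  also have "\<dots> \<le> norm_l2 \<xi> * (1.01 * M2) * (width_factor \<alpha> M1 * (1 / sqrt (real n) + ?r))"
    using s K ln_p by (intro mult_right_mono mult_left_mono mult_nonneg_nonneg add_nonneg_nonneg) auto
  finally show ?thesis by (simp add: mult_ac add.commute)
qed

end

section \<open>Coverage and expected length\<close>

lemma relative_dev_sets [measurable]:
  "{x \<in> space (design_law n p \<Sigma>). relative_dev n p \<Sigma> \<tau> t x} \<in> sets (design_law n p \<Sigma>)"
  unfolding relative_dev_def by measurable

lemma good_design_sets:
  "{x \<in> space (design_law n p \<Sigma>). good_design n p N \<Omega> \<Sigma> \<xi> x} \<in> sets (design_law n p \<Sigma>)"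
proof -
  have "finite ({..<p} \<times> {-1, 1 :: real})" by simp
  then have fin: "finite {xs. set xs \<subseteq> {..<p} \<times> {-1, 1 :: real} \<and> length xs = N}" by (rule finite_lists_length_eq)
  have neg: "{x \<in> space (design_law n p \<Sigma>). \<not> relative_dev n p \<Sigma> \<tau> t x} \<in> sets (design_law n p \<Sigma>)" for \<tau> t
    by (rule sets.sets_Collect_neg[OF relative_dev_sets])
  show ?thesis
    unfolding good_design_def
    by (intro sets.sets_Collect_conj sets.sets_Collect_finite_All neg fin) auto
qed

lemma emeasure_Collect_disj:
  assumes "{x \<in> space M. P x} \<in> sets M" "{x \<in> space M. Q x} \<in> sets M"
    and "emeasure M {x \<in> space M. P x} \<le> ennreal a" "emeasure M {x \<in> space M. Q x} \<le> ennreal b" "a \<ge> 0" "b \<ge> 0"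
  shows "emeasure M {x \<in> space M. P x \<or> Q x} \<le> ennreal (a + b)"
proof -
  have "{x \<in> space M. P x \<or> Q x} = {x \<in> space M. P x} \<union> {x \<in> space M. Q x}" by auto
  also have "emeasure M \<dots> \<le> emeasure M {x \<in> space M. P x} + emeasure M {x \<in> space M. Q x}"
    by (rule emeasure_subadditive) (use assms in auto)
  also have "\<dots> \<le> ennreal a + ennreal b" by (intro add_mono assms)
  finally show ?thesis using assms by simp
qed

lemma bad_design_probability:
  assumes pp: "precision_pair p \<Omega> \<Sigma>" and n: "n \<ge> 1" and p: "p \<ge> 2" and np: "144 * ln (real p) \<le> real n"
  shows "emeasure (design_law n p \<Sigma>) {x \<in> space (design_law n p \<Sigma>). \<not> good_design n p N \<Omega> \<Sigma> \<xi> x} \<le>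
    ennreal (real p * (2 * exp (- (real n / 64))) + ((2 * real p) ^ N * (2 * exp (- (real n / 64)))
      + (2 * exp (- (real n / 64)) + 2 * real p * (2 * exp (- (9 * ln (real p)))))))"
proof -
  let ?M = "design_law n p \<Sigma>"
  let ?\<tau> = "12 * sqrt (ln (real p) / real n)"
  let ?L = "{xs. set xs \<subseteq> {..<p} \<times> {-1, 1 :: real} \<and> length xs = N}"
  have fin: "finite ({..<p} \<times> {-1, 1 :: real})" by simp
  have card: "card ({..<p} \<times> {-1, 1 :: real}) = 2 * p" by (simp add: card_cartesian_product)
  have finL: "finite ?L" by (rule finite_lists_length_eq[OF fin])
  have cardL: "real (card ?L) = (2 * real p) ^ N" by (simp add: card_lists_length_eq[OF fin] card)
  have lp: "ln (real p) > 0" using p by simp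
  have \<tau>: "0 < ?\<tau>" "?\<tau> \<le> 1"
  proof -
    show "0 < ?\<tau>" using lp n by simp
    have "ln (real p) / real n \<le> (1 / 12)\<^sup>2" using np n by (simp add: power2_eq_square field_simps)
    then have "sqrt (ln (real p) / real n) \<le> 1 / 12" by (intro real_le_lsqrt) auto
    then show "?\<tau> \<le> 1" by simp
  qed
  have half: "emeasure ?M {x \<in> space ?M. relative_dev n p \<Sigma> (1 / 2) t x} \<le> ennreal (2 * exp (- (real n / 64)))" for t
    using energy_tail[OF pp, of "1 / 2" n t] by (simp add: relative_dev_def power2_eq_square)
  have small: "emeasure ?M {x \<in> space ?M. relative_dev n p \<Sigma> ?\<tau> t x} \<le> ennreal (2 * exp (- (9 * ln (real p))))" for t
  proof -
    \<comment> \<open>The constant 12 pays here: \<open>144 / 16 = 9\<close>, so each event has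
      probability of order \<open>p\<close> to the power -9, far below the inverse of the number
      \<open>2 * p\<close> of directions.\<close>
    have "real n * ?\<tau>\<^sup>2 / 16 = 9 * ln (real p)" using n lp by (simp add: power_mult_distrib)
    then show ?thesis using energy_tail[OF pp \<tau>, of n t] by (simp add: relative_dev_def)
  qed
  have "{x \<in> space ?M. \<not> good_design n p N \<Omega> \<Sigma> \<xi> x} =
    {x \<in> space ?M. (\<exists>j\<in>{..<p}. relative_dev n p \<Sigma> (1 / 2) (unit_fun j) x) \<or>
      ((\<exists>xs\<in>?L. relative_dev n p \<Sigma> (1 / 2) (signed_unit_sum xs) x) \<or>
      (relative_dev n p \<Sigma> (1 / 2) (precision_dir p \<Omega> \<xi>) x \<or>
      (\<exists>js\<in>{..<p} \<times> {-1, 1}. relative_dev n p \<Sigma> ?\<tau> (polar_dir p \<Omega> \<Sigma> \<xi> js) x)))}"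
    unfolding good_design_def by blast
  also have "emeasure ?M \<dots> \<le> ennreal (real p * (2 * exp (- (real n / 64))) + ((2 * real p) ^ N * (2 * exp (- (real n / 64)))
      + (2 * exp (- (real n / 64)) + 2 * real p * (2 * exp (- (9 * ln (real p)))))))"
  proof (intro emeasure_Collect_disj sets.sets_Collect_disj sets.sets_Collect_finite_Ex relative_dev_sets finite_lessThan finL fin half)
    show "emeasure ?M {x \<in> space ?M. \<exists>j\<in>{..<p}. relative_dev n p \<Sigma> (1 / 2) (unit_fun j) x} \<le> ennreal (real p * (2 * exp (- (real n / 64))))"
      using emeasure_exists_le[OF finite_lessThan[of p] relative_dev_sets half, of "\<lambda>j. unit_fun j"] by simp
    show "emeasure ?M {x \<in> space ?M. \<exists>xs\<in>?L. relative_dev n p \<Sigma> (1 / 2) (signed_unit_sum xs) x} \<le> ennreal ((2 * real p) ^ N * (2 * exp (- (real n / 64))))"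
      using emeasure_exists_le[OF finL relative_dev_sets half, of "\<lambda>xs. signed_unit_sum xs"] by (simp add: cardL)
    show "emeasure ?M {x \<in> space ?M. \<exists>js\<in>{..<p} \<times> {-1, 1}. relative_dev n p \<Sigma> ?\<tau> (polar_dir p \<Omega> \<Sigma> \<xi> js) x} \<le>
      ennreal (2 * real p * (2 * exp (- (9 * ln (real p)))))"
      using emeasure_exists_le[OF fin relative_dev_sets small, of "\<lambda>js. polar_dir p \<Omega> \<Sigma> \<xi> js"] by (simp add: card)
  qed auto
  finally show ?thesis .
qed

text \<open>Conditioning on the first factor: a bound uniform over slices passes to the product.
  With the design fixed, quantities computed from it become constant coefficients of the
  noise.\<close>

lemma emeasure_pair_slices_le:
  assumes "prob_space M" "prob_space N" and A: "{z \<in> space (M \<Otimes>\<^sub>M N). P z} \<in> sets (M \<Otimes>\<^sub>M N)"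
    and le: "\<And>x. x \<in> space M \<Longrightarrow> emeasure N {y \<in> space N. P (x, y)} \<le> c"
  shows "emeasure (M \<Otimes>\<^sub>M N) {z \<in> space (M \<Otimes>\<^sub>M N). P z} \<le> c"
proof -
  interpret M: prob_space M by fact
  interpret N: prob_space N by fact
  have "emeasure (M \<Otimes>\<^sub>M N) {z \<in> space (M \<Otimes>\<^sub>M N). P z} =
    (\<integral>\<^sup>+ x. emeasure N (Pair x -` {z \<in> space (M \<Otimes>\<^sub>M N). P z}) \<partial>M)"
    by (rule N.emeasure_pair_measure_alt[OF A])
  also have "\<dots> \<le> (\<integral>\<^sup>+ x. c \<partial>M)"
  proof (rule nn_integral_mono)
    fix x assume x: "x \<in> space M"
    then have "Pair x -` {z \<in> space (M \<Otimes>\<^sub>M N). P z} = {y \<in> space N. P (x, y)}" by (auto simp: space_pair_measure)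
    then show "emeasure N (Pair x -` {z \<in> space (M \<Otimes>\<^sub>M N). P z}) \<le> c" using le[OF x] by simp
  qed
  also have "\<dots> = c" by (simp add: M.emeasure_space_1)
  finally show ?thesis .
qed

lemma emeasure_pair_slices_ge:
  assumes "prob_space M" "prob_space N" and A: "{z \<in> space (M \<Otimes>\<^sub>M N). P z} \<in> sets (M \<Otimes>\<^sub>M N)"
    and ge: "\<And>x. x \<in> space M \<Longrightarrow> c \<le> emeasure N {y \<in> space N. P (x, y)}"
  shows "c \<le> emeasure (M \<Otimes>\<^sub>M N) {z \<in> space (M \<Otimes>\<^sub>M N). P z}"
proof -
  interpret M: prob_space M by fact
  interpret N: prob_space N by fact
  have "c = (\<integral>\<^sup>+ x. c \<partial>M)" by (simp add: M.emeasure_space_1)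
  also have "\<dots> \<le> (\<integral>\<^sup>+ x. emeasure N (Pair x -` {z \<in> space (M \<Otimes>\<^sub>M N). P z}) \<partial>M)"
  proof (rule nn_integral_mono)
    fix x assume x: "x \<in> space M"
    then have "Pair x -` {z \<in> space (M \<Otimes>\<^sub>M N). P z} = {y \<in> space N. P (x, y)}" by (auto simp: space_pair_measure)
    then show "c \<le> emeasure N (Pair x -` {z \<in> space (M \<Otimes>\<^sub>M N). P z})" using ge[OF x] by simp
  qed
  also have "\<dots> = emeasure (M \<Otimes>\<^sub>M N) {z \<in> space (M \<Otimes>\<^sub>M N). P z}"
    by (rule N.emeasure_pair_measure_alt[OF A, symmetric])
  finally show ?thesis .
qed

lemma emeasure_pair_fst:
  assumes "prob_space M" "prob_space N" and A: "{x \<in> space M. P x} \<in> sets M"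
  shows "emeasure (M \<Otimes>\<^sub>M N) {z \<in> space (M \<Otimes>\<^sub>M N). P (fst z)} = emeasure M {x \<in> space M. P x}"
proof -
  interpret N: prob_space N by fact
  have "{z \<in> space (M \<Otimes>\<^sub>M N). P (fst z)} = {x \<in> space M. P x} \<times> space N" by (auto simp: space_pair_measure)
  then show ?thesis using A by (simp add: N.emeasure_pair_measure_Times N.emeasure_space_1)
qed

text \<open>The factor 14 is the sum \<open>2 + 2 + 2 + 4 + 2 + 2\<close> over the six events, and
  the rate is that of the weakest one: \<open>p\<close> columns, each correlated with the noise with
  probability of order \<open>p powr (- 1.01)\<close>.\<close>

definition failure_bound :: "nat \<Rightarrow> real" where
  "failure_bound p = 14 * exp (- (ln (real p) / 100))"

text \<open>The only delicate term counts the signed sums: \<open>(2 p) ^ (L k + 1)\<close> is at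
  most \<open>exp (n / 128)\<close> by the second bound on \<open>c\<close>, half of the exponent
  \<open>n / 64\<close> being kept. The \<open>10 ^ 6\<close> in the noise term is
  \<open>16 * 250^2\<close>.\<close>

lemma failure_bound_sum:
  assumes p: "p \<ge> 2" and k: "k \<ge> 1" and kc: "real k * ln (real p) \<le> c * real n"
    and c: "c \<le> 1 / 10 ^ 14" "c \<le> 1 / (256 * (real L + 1))" and n: "n \<ge> 1"
  shows "real p * (2 * exp (- (real n / 64))) + ((2 * real p) ^ (L * k + 1) * (2 * exp (- (real n / 64)))
      + (2 * exp (- (real n / 64)) + 2 * real p * (2 * exp (- (9 * ln (real p))))))
      + (2 * exp (- (real n / 10 ^ 6)) + real p * (2 * exp (- (2.02 * ln (real p) / 2)))) \<le> failure_bound p"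
proof -
  define l where "l = ln (real p)"
  have l: "l > 0" and pl: "real p = exp l" using p by (auto simp: l_def)
  have kl: "l \<le> real k * l" using k l by (simp add: mult_le_cancel_right1)
  have "c * real n \<le> 1 / 10 ^ 14 * real n" using c by (intro mult_right_mono) auto
  then have nl: "10 ^ 14 * (real k * l) \<le> real n" using kc by (simp add: l_def)
  have "10 ^ 14 * l \<le> 10 ^ 14 * (real k * l)" using kl by (rule mult_left_mono) simp
  then have nl1: "10 ^ 14 * l \<le> real n" using nl by (rule order_trans)
  have pow: "(2 * real p) ^ (L * k + 1) * exp (- (real n / 64)) \<le> exp (- (l / 100))"
  proof -
    \<comment> \<open>Since \<open>p \<ge> 2\<close>, the factor \<open>2 * p\<close> is at most the
      square of \<open>p\<close>, which keeps the exponent a multiple of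
      \<open>ln p\<close>.\<close>
    have "2 * real p \<le> real p * real p" using p by (intro mult_right_mono) auto
    also have "\<dots> = exp (2 * l)" by (simp add: pl flip: exp_add)
    finally have "(2 * real p) ^ (L * k + 1) \<le> exp (2 * l) ^ (L * k + 1)" by (intro power_mono) auto
    also have "\<dots> = exp (real (L * k + 1) * (2 * l))" by (rule exp_of_nat_mult[symmetric])
    finally have "(2 * real p) ^ (L * k + 1) * exp (- (real n / 64)) \<le> exp (real (L * k + 1) * (2 * l)) * exp (- (real n / 64))"
      by (rule mult_right_mono) simp
    also have "\<dots> = exp (real (L * k + 1) * (2 * l) - real n / 64)" by (simp flip: exp_add)
    finally have "(2 * real p) ^ (L * k + 1) * exp (- (real n / 64)) \<le> exp (real (L * k + 1) * (2 * l) - real n / 64)" .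
    moreover have "real (L * k + 1) * (2 * l) \<le> real n / 128"
    proof -
      have "real (L * k + 1) * (2 * l) \<le> (real L + 1) * real k * (2 * l)"
        using k l by (intro mult_right_mono) (auto simp: algebra_simps)
      also have "\<dots> = 2 * (real L + 1) * (real k * l)" by simp
      also have "\<dots> \<le> 2 * (real L + 1) * (c * real n)" using kc by (intro mult_left_mono) (auto simp: l_def)
      also have "\<dots> \<le> 2 * (real L + 1) * (1 / (256 * (real L + 1)) * real n)"
        using c by (intro mult_left_mono mult_right_mono) auto
      also have "\<dots> = real n / 128" by (simp add: field_simps)
      finally show ?thesis .
    qed
    then have "exp (real (L * k + 1) * (2 * l) - real n / 64) \<le> exp (- (real n / 128))" by simp
    ultimately have "(2 * real p) ^ (L * k + 1) * exp (- (real n / 64)) \<le> exp (- (real n / 128))" by (rule order_trans)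
    also have "\<dots> \<le> exp (- (l / 100))" using nl1 l by simp
    finally show ?thesis .
  qed
  have base: "1 \<le> 2 * real p" using p by simp
  have "real p \<le> (2 * real p) ^ (L * k + 1)"
  proof -
    have "(2 * real p) ^ 1 \<le> (2 * real p) ^ (L * k + 1)" using base by (intro power_increasing) auto
    then show ?thesis using base by simp
  qed
  then have a: "real p * exp (- (real n / 64)) \<le> exp (- (l / 100))"
    by (rule order_trans[OF mult_right_mono pow]) simp
  have "1 \<le> (2 * real p) ^ (L * k + 1)" using base by (rule one_le_power)
  then have b: "exp (- (real n / 64)) \<le> exp (- (l / 100))"
    using order_trans[OF mult_right_mono[of 1 "(2 * real p) ^ (L * k + 1)" "exp (- (real n / 64))"] pow] by simp
  have d: "real p * exp (- (9 * l)) \<le> exp (- (l / 100))" using l by (simp add: pl flip: exp_add)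
  have f: "exp (- (real n / 10 ^ 6)) \<le> exp (- (l / 100))" using nl1 l by simp
  have g: "real p * exp (- (2.02 * l / 2)) \<le> exp (- (l / 100))" by (simp add: pl flip: exp_add)
  show ?thesis
    unfolding failure_bound_def l_def[symmetric] using a b d f g pow by linarith
qed

section \<open>Coverage and length for a single parameter\<close>

lemma param_space_precision:
  assumes \<theta>: "(\<beta>, \<Omega>, \<sigma>) \<in> param_space p k M1 M2" and M1: "M1 > 1"
  shows "precision_bounds p \<Omega> (the (mat_inverse \<Omega>)) M1"
    and "\<beta> \<in> carrier_vec p" "norm_l0 \<beta> \<le> k" "\<sigma> > 0" "\<sigma> \<le> M2"
proof -
  have \<Omega>: "\<Omega> \<in> carrier_mat p p" "transpose_mat \<Omega> = \<Omega>" "1 / M1 \<le> Min (spectrum \<Omega>)" "Max (spectrum \<Omega>) \<le> M1"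
    and rest: "\<beta> \<in> carrier_vec p" "norm_l0 \<beta> \<le> k" "\<sigma> > 0" "\<sigma> \<le> M2"
    using \<theta> by (auto simp: param_space_def)
  note q = spectrum_bounds_quad_form[OF \<Omega>]
  have "pos_def p (entries \<Omega>)"
    unfolding pos_def_def
  proof (intro conjI allI impI)
    fix x :: "nat \<Rightarrow> real" assume "\<exists>i<p. x i \<noteq> 0"
    then have "(\<Sum>i<p. (x i)\<^sup>2) > 0" by (auto intro: sum_pos2)
    then have "0 < 1 / M1 * (\<Sum>i<p. (x i)\<^sup>2)" using M1 by simp
    then show "quad_form p (entries \<Omega>) x > 0" using q(1)[of x] by linarith
  next
    fix i j assume "i < p" "j < p"
    then show "entries \<Omega> i j = entries \<Omega> j i" using \<Omega>(1,2) by (metis carrier_matD index_transpose_mat(1))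
  qed
  then have "precision_pair p \<Omega> (the (mat_inverse \<Omega>))" by (rule precision_pair_inverse[OF \<Omega>(1)])
  then show "precision_bounds p \<Omega> (the (mat_inverse \<Omega>)) M1"
    using M1 q by unfold_locales auto
  show "\<beta> \<in> carrier_vec p" "norm_l0 \<beta> \<le> k" "\<sigma> > 0" "\<sigma> \<le> M2" by (rule rest)+
qed

text \<open>One pair \<open>(n, p)\<close> and one parameter are fixed. The bounds obtained do not
  involve the parameter, which makes them uniform over the parameter space; \<open>wf\<close> and
  \<open>M2\<close> hold once \<open>p\<close> is large.\<close>

locale sampling =
  fixes n p k L :: nat and \<alpha> M1 M2 c :: real and \<xi> \<beta> :: "real vec" and \<Omega> :: "real mat" and \<sigma> :: real
    and bhat :: "real vec \<Rightarrow> real mat \<Rightarrow> real vec" and shat :: "real vec \<Rightarrow> real mat \<Rightarrow> real"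
    and uhat :: "real mat \<Rightarrow> real vec"
  assumes n: "n \<ge> 1" and p: "p \<ge> 2" and k: "k \<ge> 1" and M1: "M1 > 1" and \<alpha>: "0 < \<alpha>" "\<alpha> < 1"
    and L: "real L \<ge> 6 * 703\<^sup>2 * M1 ^ 4"
    and kc: "real k * ln (real p) \<le> c * real n" and c: "c \<le> 1 / (10 ^ 14 * M1\<^sup>2)" "c \<le> 1 / (256 * (real L + 1))"
    and \<xi>: "\<xi> \<in> carrier_vec p" "\<xi> \<noteq> 0\<^sub>v p" and \<theta>: "(\<beta>, \<Omega>, \<sigma>) \<in> param_space p k M1 M2"
    and sl: "scaled_lasso n p bhat shat" and pd: "projection_direction n p M1 \<xi> uhat"
    and wf: "width_factor \<alpha> M1 \<le> ln (real p)" and M2: "1.01 * M2 \<le> ln (real p)"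
begin

definition "\<Sigma> = the (mat_inverse \<Omega>)"
definition "DX = design_law n p \<Sigma>"
definition "DE = mvn n (\<sigma>\<^sup>2 \<cdot>\<^sub>m 1\<^sub>m n)"
definition "P = DX \<Otimes>\<^sub>M DE"
definition "obs = (\<lambda>(x, e). (\<lambda>i\<in>{..<n}. (mat n p (\<lambda>(i, j). x i j) *\<^sub>v \<beta> + vec n e) $ i, x :: nat \<Rightarrow> nat \<Rightarrow> real))"
definition "CI = conf_int \<alpha> M1 n p k \<xi> bhat shat uhat"
definition "z = normal_upper_quantile (\<alpha> / 2)"

lemmas param = param_space_precision[OF \<theta> M1, folded \<Sigma>_def]

lemma pp: "precision_pair p \<Omega> \<Sigma>"
  using param(1) by (rule precision_bounds.pp)

lemma z_nonneg: "z \<ge> 0"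
  unfolding z_def using \<alpha> by (intro normal_upper_quantile_nonneg) auto

lemma prob_spaces: "prob_space DX" "prob_space DE"
  unfolding DX_def DE_def by (rule prob_space_design_law[OF pp], rule prob_space_mvn[OF precision_pair_scalar(1)[OF param(4)]])

sublocale P: pair_prob_space DX DE
  by (simp add: pair_prob_space_def pair_sigma_finite_def prob_spaces prob_space_imp_sigma_finite)

lemma sample_law_eq: "sample_law n p (\<beta>, \<Omega>, \<sigma>) = distr P (sample_space n p) obs"
  by (simp add: sample_law_def P_def DX_def DE_def design_law_def \<Sigma>_def obs_def)

lemma measurable_entry [measurable]: "i < n \<Longrightarrow> j < p \<Longrightarrow> (\<lambda>\<omega>. fst \<omega> i j) \<in> borel_measurable P"
  unfolding P_def DX_def
  by (rule measurable_compose[OF measurable_fst measurable_design_law_entry])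

lemma measurable_error [measurable]: "i < n \<Longrightarrow> (\<lambda>\<omega>. snd \<omega> i) \<in> borel_measurable P"
  unfolding P_def DE_def
  by (rule measurable_compose[OF measurable_snd measurable_mvn_coordinate])

lemma response_obs: "response n (obs \<omega>) = mat n p (\<lambda>(i, j). fst \<omega> i j) *\<^sub>v \<beta> + vec n (snd \<omega>)"
  by (cases \<omega>) (auto simp: response_def obs_def intro!: eq_vecI)

lemma design_obs: "design n p (obs \<omega>) = mat n p (\<lambda>(i, j). fst \<omega> i j)"
  by (cases \<omega>) (simp add: design_def obs_def)

lemma measurable_obs [measurable]: "obs \<in> P \<rightarrow>\<^sub>M sample_space n p"
proof -
  have obs: "obs = (\<lambda>\<omega>. (\<lambda>i\<in>{..<n}. (\<Sum>j<p. fst \<omega> i j * \<beta> $ j) + snd \<omega> i, fst \<omega>))"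
    using param(2) by (auto simp: obs_def fun_eq_iff restrict_def scalar_prod_def lessThan_atLeast0)
  have "fst \<in> P \<rightarrow>\<^sub>M (\<Pi>\<^sub>M i\<in>{..<n}. \<Pi>\<^sub>M j\<in>{..<p}. borel)"
    unfolding P_def DX_def by (subst measurable_cong_sets[OF refl sets_design_law[symmetric]]) (rule measurable_fst)
  then show ?thesis
    unfolding obs sample_space_def by (intro measurable_Pair measurable_restrict) auto
qed

definition "bad \<omega> \<longleftrightarrow> \<not> good_design n p (L * k + 1) \<Omega> \<Sigma> \<xi> (fst \<omega>) \<or> \<not> good_noise n p \<sigma> (fst \<omega>) (snd \<omega>)"

lemma bad_probability:
  "{\<omega> \<in> space P. bad \<omega>} \<in> sets P" "emeasure P {\<omega> \<in> space P. bad \<omega>} \<le> ennreal (failure_bound p)"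
proof -
  let ?energy = "\<lambda>\<omega>. \<bar>(\<Sum>i<n. (snd \<omega> i)\<^sup>2) - real n * \<sigma>\<^sup>2\<bar> > 1 / 250 * (real n * \<sigma>\<^sup>2)"
  let ?corr = "\<lambda>j \<omega>. \<bar>\<Sum>i<n. fst \<omega> i j * snd \<omega> i\<bar> > \<sigma> * L2_set (\<lambda>i. fst \<omega> i j) {..<n} * sqrt (2.02 * ln (real p))"
  let ?gd = "\<lambda>x. good_design n p (L * k + 1) \<Omega> \<Sigma> \<xi> x"
  have bad: "bad \<omega> \<longleftrightarrow> \<not> ?gd (fst \<omega>) \<or> (?energy \<omega> \<or> (\<exists>j\<in>{..<p}. ?corr j \<omega>))" for \<omega>
    unfolding bad_def good_noise_def by blast
  have gd: "{x \<in> space DX. \<not> ?gd x} \<in> sets DX"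
    unfolding DX_def by (rule sets.sets_Collect_neg[OF good_design_sets])
  have m1: "{\<omega> \<in> space P. \<not> ?gd (fst \<omega>)} \<in> sets P"
  proof -
    have "{\<omega> \<in> space P. \<not> ?gd (fst \<omega>)} = {x \<in> space DX. \<not> ?gd x} \<times> space DE" by (auto simp: P_def space_pair_measure)
    then show ?thesis using gd by (simp add: P_def)
  qed
  have m2: "{\<omega> \<in> space P. ?energy \<omega>} \<in> sets P" by measurable
  have m3: "{\<omega> \<in> space P. ?corr j \<omega>} \<in> sets P" if "j \<in> {..<p}" for j
  proof -
    have j: "j < p" using that by simp
    note [measurable] = measurable_entry[OF _ j]
    have [measurable]: "(\<lambda>\<omega>. sqrt (\<Sum>i<n. (fst \<omega> i j)\<^sup>2)) \<in> borel_measurable P" by simp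
    have [measurable]: "(\<lambda>\<omega>. \<Sum>i<n. fst \<omega> i j * snd \<omega> i) \<in> borel_measurable P" by simp
    show ?thesis unfolding L2_set_def by measurable
  qed
  have m3': "{\<omega> \<in> space P. \<exists>j\<in>{..<p}. ?corr j \<omega>} \<in> sets P"
    by (intro sets.sets_Collect_finite_Ex m3) auto
  show "{\<omega> \<in> space P. bad \<omega>} \<in> sets P"
    unfolding bad by (intro sets.sets_Collect_disj m1 m2 m3')
  have lp: "ln (real p) > 0" using p by simp
  have c14: "c \<le> 1 / 10 ^ 14"
  proof -
    have "1 \<le> M1\<^sup>2" using M1 by (simp add: one_le_power)
    then have "1 / (10 ^ 14 * M1\<^sup>2) \<le> 1 / 10 ^ 14" by (intro frac_le) auto
    then show ?thesis using c by linarith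
  qed
  have np: "144 * ln (real p) \<le> real n"
  proof -
    have "ln (real p) \<le> real k * ln (real p)" using k lp by (simp add: mult_le_cancel_right1)
    also have "\<dots> \<le> 1 / 10 ^ 14 * real n" using kc mult_right_mono[OF c14, of "real n"] by simp
    finally show ?thesis by simp
  qed
  note failure = failure_bound_sum[OF p k kc c14 c(2) n]
  have b1: "emeasure P {\<omega> \<in> space P. \<not> ?gd (fst \<omega>)} \<le>
    ennreal (real p * (2 * exp (- (real n / 64))) + ((2 * real p) ^ (L * k + 1) * (2 * exp (- (real n / 64)))
      + (2 * exp (- (real n / 64)) + 2 * real p * (2 * exp (- (9 * ln (real p)))))))"
    unfolding P_def emeasure_pair_fst[OF prob_spaces gd] unfolding DX_def
    by (rule bad_design_probability[OF pp n p np])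
  have b2: "emeasure P {\<omega> \<in> space P. ?energy \<omega>} \<le> ennreal (2 * exp (- (real n / 10 ^ 6)))"
    unfolding P_def
  proof (rule emeasure_pair_slices_le[OF prob_spaces m2[unfolded P_def]])
    fix x
    show "emeasure DE {e \<in> space DE. ?energy (x, e)} \<le> ennreal (2 * exp (- (real n / 10 ^ 6)))"
      using noise_energy_tail[OF param(4), of "1 / 250" n] by (simp add: DE_def power2_eq_square)
  qed
  have b3: "emeasure P {\<omega> \<in> space P. \<exists>j\<in>{..<p}. ?corr j \<omega>} \<le> ennreal (real p * (2 * exp (- (2.02 * ln (real p) / 2))))"
  proof -
    have "emeasure P {\<omega> \<in> space P. ?corr j \<omega>} \<le> ennreal (2 * exp (- (2.02 * ln (real p) / 2)))" if "j \<in> {..<p}" for j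
      unfolding P_def
    proof (rule emeasure_pair_slices_le[OF prob_spaces m3[OF that, unfolded P_def]])
      fix x
      have "(sqrt (2.02 * ln (real p)))\<^sup>2 = 2.02 * ln (real p)" using lp by simp
      moreover have "0 < sqrt (2.02 * ln (real p))" using lp by simp
      ultimately show "emeasure DE {e \<in> space DE. ?corr j (x, e)} \<le> ennreal (2 * exp (- (2.02 * ln (real p) / 2)))"
        using mvn_linear_tail[OF param(4), of "sqrt (2.02 * ln (real p))" n "\<lambda>i. x i j"] unfolding DE_def fst_conv snd_conv by simp
    qed
    from emeasure_exists_le[OF finite_lessThan m3 this] show ?thesis by simp
  qed
  have "emeasure P {\<omega> \<in> space P. bad \<omega>} \<le> ennreal (real p * (2 * exp (- (real n / 64))) + ((2 * real p) ^ (L * k + 1) * (2 * exp (- (real n / 64)))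
      + (2 * exp (- (real n / 64)) + 2 * real p * (2 * exp (- (9 * ln (real p))))))
      + (2 * exp (- (real n / 10 ^ 6)) + real p * (2 * exp (- (2.02 * ln (real p) / 2)))))"
    unfolding bad by (intro emeasure_Collect_disj sets.sets_Collect_disj m1 m2 m3' b1 b2 b3) auto
  also have "\<dots> \<le> ennreal (failure_bound p)" using failure by (rule ennreal_leI)
  finally show "emeasure P {\<omega> \<in> space P. bad \<omega>} \<le> ennreal (failure_bound p)" .
qed

lemma good_sampleI:
  assumes "\<not> bad \<omega>"
  shows "good_sample p \<Omega> \<Sigma> M1 n k L \<xi> \<beta> \<sigma> (fst \<omega>) (snd \<omega>) bhat shat uhat"
proof (intro good_sample.intro good_sample_axioms.intro param(1))
  have "c * real n \<le> 1 / (10 ^ 14 * M1\<^sup>2) * real n" using c by (intro mult_right_mono) auto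
  then show "real k * ln (real p) \<le> 1 / (10 ^ 14 * M1\<^sup>2) * real n" using kc by linarith
qed (use n p k L \<xi> param sl pd assms in \<open>auto simp: bad_def\<close>)

lemma M1_pos: "M1 > 0" and p1: "p \<ge> 1"
  using M1 p by auto

text \<open>On the slice of a fixed design the noise part of the error is a linear form with
  constant coefficients, because \<open>uhat\<close> does not look at the response. The central
  event \<open>E\<close> thus has probability at least \<open>1 - \<alpha>\<close> on every slice,
  and outside the bad event it entails coverage.\<close>

lemma coverage: "coverage_prob n p \<xi> CI (\<beta>, \<Omega>, \<sigma>) \<ge> 1 - \<alpha> - failure_bound p"
proof -
  interpret prob_space P unfolding P_def by unfold_locales
  define E where "E = (\<lambda>\<omega>. \<bar>\<Sum>i<n. (\<Sum>j<p. fst \<omega> i j * uhat (design n p (obs \<omega>)) $ j) * snd \<omega> i\<bar> \<le>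
    \<sigma> * L2_set (\<lambda>i. \<Sum>j<p. fst \<omega> i j * uhat (design n p (obs \<omega>)) $ j) {..<n} * z)"
  have "(\<lambda>\<omega>. uhat (design n p (obs \<omega>)) $ j) \<in> borel_measurable P" if "j < p" for j
    using pd that unfolding projection_direction_def by (intro measurable_compose[OF measurable_obs]) auto
  note [measurable] = this
  have E: "{\<omega> \<in> space P. E \<omega>} \<in> sets P" unfolding E_def L2_set_def by measurable
  have "ennreal (1 - \<alpha>) \<le> emeasure P {\<omega> \<in> space P. E \<omega>}"
    unfolding P_def
  proof (rule emeasure_pair_slices_ge[OF prob_spaces E[unfolded P_def]])
    fix x
    show "ennreal (1 - \<alpha>) \<le> emeasure DE {e \<in> space DE. E (x, e)}"
      unfolding DE_def E_def design_obs fst_conv snd_conv z_def by (rule mvn_linear_central[OF param(4) \<alpha>])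
  qed
  then have pE: "1 - \<alpha> \<le> prob {\<omega> \<in> space P. E \<omega>}"
    using \<alpha> by (simp add: emeasure_eq_measure)
  have pB: "prob {\<omega> \<in> space P. bad \<omega>} \<le> failure_bound p"
    using bad_probability(2) by (simp add: emeasure_eq_measure failure_bound_def)
  have S: "{s \<in> space (sample_space n p). \<xi> \<bullet> \<beta> \<in> CI s} \<in> sets (sample_space n p)"
    unfolding CI_def by (rule measurable_conf_int(1)[OF n p1 k M1_pos sl pd])
  define Cov where "Cov = {\<omega> \<in> space P. \<xi> \<bullet> \<beta> \<in> CI (obs \<omega>)}"
  have pre: "obs -` {s \<in> space (sample_space n p). \<xi> \<bullet> \<beta> \<in> CI s} \<inter> space P = Cov"
    using measurable_space[OF measurable_obs] by (auto simp: Cov_def)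
  have covS: "Cov \<in> sets P" unfolding pre[symmetric] by (rule measurable_sets[OF measurable_obs S])
  have cov: "coverage_prob n p \<xi> CI (\<beta>, \<Omega>, \<sigma>) = prob Cov"
    unfolding coverage_prob_def sample_law_eq pre[symmetric] using S by (simp add: measure_distr)
  have "{\<omega> \<in> space P. E \<omega>} \<subseteq> Cov \<union> {\<omega> \<in> space P. bad \<omega>}"
  proof
    fix \<omega> assume w: "\<omega> \<in> {\<omega> \<in> space P. E \<omega>}"
    show "\<omega> \<in> Cov \<union> {\<omega> \<in> space P. bad \<omega>}"
    proof (cases "bad \<omega>")
      case False
      interpret g: good_sample p \<Omega> \<Sigma> M1 n k L \<xi> \<beta> \<sigma> "fst \<omega>" "snd \<omega>" bhat shat uhat
        by (rule good_sampleI[OF False])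
      have "\<xi> \<bullet> \<beta> \<in> CI (obs \<omega>)"
        unfolding CI_def
      proof (rule g.good_sample_coverage[OF wf z_nonneg[unfolded z_def] param(5) M2])
        show "response n (obs \<omega>) = g.y" "design n p (obs \<omega>) = g.X"
          by (simp_all add: response_obs design_obs g.y_def g.X_def)
        then show "\<bar>\<Sum>i<n. (\<Sum>j<p. fst \<omega> i j * g.u $ j) * snd \<omega> i\<bar> \<le>
          \<sigma> * L2_set (\<lambda>i. \<Sum>j<p. fst \<omega> i j * g.u $ j) {..<n} * normal_upper_quantile (\<alpha> / 2)"
          using w by (simp add: E_def g.u_def z_def)
      qed
      then show ?thesis using w by (simp add: Cov_def)
    qed (use w in simp)
  qed
  then have "prob {\<omega> \<in> space P. E \<omega>} \<le> prob (Cov \<union> {\<omega> \<in> space P. bad \<omega>})"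
    using covS bad_probability(1) by (intro finite_measure_mono) auto
  also have "\<dots> \<le> prob Cov + prob {\<omega> \<in> space P. bad \<omega>}"
    using covS bad_probability(1) by (intro measure_Un_le) auto
  finally show ?thesis using pE pB cov by linarith
qed

text \<open>Twice the half width of a good sample is integrated everywhere, and the fallback width
  only over the bad event, where the failure probability multiplies it.\<close>

lemma length_bound:
  defines "rate \<equiv> norm_l2 \<xi> * (real k * ln (real p) / real n + 1 / sqrt (real n))"
  shows "expected_length n p CI (\<beta>, \<Omega>, \<sigma>) \<le>
    ennreal ((2.02 * M2 * width_factor \<alpha> M1 + 2 * (ln (real p))\<^sup>2 * failure_bound p) * rate)"
proof -
  interpret prob_space P unfolding P_def by unfold_locales
  have lp: "ln (real p) > 0" using p by simp
  have rate: "rate \<ge> 0" unfolding rate_def using lp by (intro mult_nonneg_nonneg add_nonneg_nonneg) auto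
  define A where "A = 2.02 * M2 * width_factor \<alpha> M1 * rate"
  define B where "B = 2 * (ln (real p))\<^sup>2 * rate"
  have M2': "M2 > 0" using param(4,5) by linarith
  have K: "width_factor \<alpha> M1 \<ge> 0"
    unfolding width_factor_def C_max_def using M1 z_nonneg by (intro add_nonneg_nonneg mult_nonneg_nonneg) (auto simp: z_def)
  have A: "A \<ge> 0" and B: "B \<ge> 0" using rate K M2' by (auto simp: A_def B_def)
  have len: "interval_length (CI (obs \<omega>)) \<le> A + B * indicator {\<omega> \<in> space P. bad \<omega>} \<omega>" if w: "\<omega> \<in> space P" for \<omega>
  proof -
    define y where "y = response n (obs \<omega>)"
    define X where "X = design n p (obs \<omega>)"
    define s where "s = shat y X"
    define \<rho> where "\<rho> = half_width \<alpha> M1 n p k \<xi> X s (uhat X)"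
    have X: "X \<in> carrier_mat n p" unfolding X_def by (rule design_carrier)
    have y: "y \<in> carrier_vec n" unfolding y_def by (rule response_carrier)
    have s: "s > 0" using sl X y unfolding scaled_lasso_def s_def Let_def by auto
    note hw = half_width_bounds[OF X projection_directionD(1)[OF pd X] less_imp_le[OF s] n p z_nonneg[unfolded z_def], of M1 k \<xi>, folded \<rho>_def]
    have L: "interval_length (CI (obs \<omega>)) = (if s \<le> ln (real p) then 2 * \<rho> else 0)"
      using hw(1) by (simp add: CI_def conf_int_def Let_def y_def[symmetric] X_def[symmetric] s_def[symmetric] \<rho>_def[symmetric] interval_length_def)
    show ?thesis
    proof (cases "bad \<omega>")
      case True
      have "2 * \<rho> \<le> B" if "s \<le> ln (real p)"
      proof -
        have "\<rho> \<le> norm_l2 \<xi> * s * (ln (real p) * (real k * ln (real p) / real n + 1 / sqrt (real n)))" by (rule hw(2))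
        also have "\<dots> = s * (ln (real p) * rate)" by (simp add: rate_def mult_ac)
        \<comment> \<open>The cutoff \<open>s \<le> ln p\<close> supplies the second logarithm, the
          first being part of the fallback width.\<close>
        also have "\<dots> \<le> ln (real p) * (ln (real p) * rate)" using that lp rate by (intro mult_right_mono) auto
        finally show ?thesis by (simp add: B_def power2_eq_square)
      qed
      then show ?thesis using True w A B by (auto simp: L)
    next
      case False
      interpret g: good_sample p \<Omega> \<Sigma> M1 n k L \<xi> \<beta> \<sigma> "fst \<omega>" "snd \<omega>" bhat shat uhat
        by (rule good_sampleI[OF False])
      have yX: "y = g.y" "X = g.X"
        by (simp_all add: y_def X_def response_obs design_obs g.y_def g.X_def)
      have "\<rho> \<le> 1.01 * M2 * width_factor \<alpha> M1 * norm_l2 \<xi> * (real k * ln (real p) / real n + 1 / sqrt (real n))"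
        unfolding \<rho>_def s_def yX g.u_def[symmetric]
        by (rule g.good_sample_half_width[OF wf z_nonneg[unfolded z_def] param(5)])
      then have "2 * \<rho> \<le> A" by (simp add: A_def rate_def mult_ac)
      then show ?thesis using False A by (auto simp: L)
    qed
  qed
  have "expected_length n p CI (\<beta>, \<Omega>, \<sigma>) = (\<integral>\<^sup>+ \<omega>. ennreal (interval_length (CI (obs \<omega>))) \<partial>P)"
    unfolding expected_length_def sample_law_eq
    using measurable_conf_int(2)[OF n p1 k M1_pos sl pd, of \<alpha>]
    by (intro nn_integral_distr) (auto simp: CI_def)
  also have "\<dots> \<le> (\<integral>\<^sup>+ \<omega>. ennreal A + ennreal B * indicator {\<omega> \<in> space P. bad \<omega>} \<omega> \<partial>P)"
  proof (rule nn_integral_mono)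
    fix \<omega> assume "\<omega> \<in> space P"
    then have "ennreal (interval_length (CI (obs \<omega>))) \<le> ennreal (A + B * indicator {\<omega> \<in> space P. bad \<omega>} \<omega>)"
      by (intro ennreal_leI len)
    also have "\<dots> = ennreal A + ennreal B * indicator {\<omega> \<in> space P. bad \<omega>} \<omega>"
      using A B by (auto simp: indicator_def)
    finally show "ennreal (interval_length (CI (obs \<omega>))) \<le> ennreal A + ennreal B * indicator {\<omega> \<in> space P. bad \<omega>} \<omega>" .
  qed
  also have "\<dots> = ennreal A + ennreal B * emeasure P {\<omega> \<in> space P. bad \<omega>}"
    using bad_probability(1) by (simp add: nn_integral_add nn_integral_cmult emeasure_space_1)
  also have "\<dots> \<le> ennreal A + ennreal B * ennreal (failure_bound p)"
    by (intro add_left_mono mult_left_mono bad_probability(2)) simp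
  also have "\<dots> = ennreal (A + B * failure_bound p)"
    using A B by (simp add: failure_bound_def flip: ennreal_mult)
  also have "A + B * failure_bound p = (2.02 * M2 * width_factor \<alpha> M1 + 2 * (ln (real p))\<^sup>2 * failure_bound p) * rate"
    by (simp add: A_def B_def algebra_simps)
  finally show ?thesis .
qed

end

section \<open>Passage to the limit\<close>

lemma admissibleD:
  assumes "(n, p) \<in> admissible c Cq cbar k q \<xi>" and c: "c > 0"
  shows "p \<ge> 2" "n \<ge> 1" "k n p \<ge> 1" "real (k n p) * ln (real p) \<le> c * real n"
    "\<xi> n p \<in> carrier_vec p" "\<xi> n p \<noteq> 0\<^sub>v p"
proof -
  have k: "k n p \<ge> 1" "real (k n p) \<le> c * real n / ln (real p)" and \<xi>: "\<xi> n p \<in> loading_space p (q n p) cbar"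
    using assms by (auto simp: admissible_def)
  show "k n p \<ge> 1" by (rule k)
  show p: "p \<ge> 2"
  proof (rule ccontr)
    assume "\<not> p \<ge> 2"
    then have "p = 0 \<or> p = 1" by auto
    then have "ln (real p) = 0" by auto
    then show False using k by simp
  qed
  then show kc: "real (k n p) * ln (real p) \<le> c * real n" using k by (simp add: field_simps)
  have "0 < real (k n p) * ln (real p)" using k p by simp
  then have "0 < c * real n" using kc by linarith
  then show "n \<ge> 1" using c by (simp add: zero_less_mult_iff)
  show "\<xi> n p \<in> carrier_vec p" "\<xi> n p \<noteq> 0\<^sub>v p" using \<xi> by (auto simp: loading_space_def)
qed

text \<open>A threshold in \<open>p\<close> suffices for the application, since admissible pairs
  satisfy \<open>ln p \<le> c * n\<close> and so carry a lower bound on \<open>n\<close> with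
  them.\<close>

lemma eventually_limit_along:
  assumes "\<And>n p. (n, p) \<in> A \<Longrightarrow> p \<ge> N \<Longrightarrow> Q n p"
  shows "\<forall>\<^sub>F (n, p) in limit_along A. Q n p"
  unfolding limit_along_def eventually_inf_principal eventually_prod_sequentially
  using assms by (intro exI[of _ N]) auto

theorem proposition1:
  fixes \<alpha> M1 M2 cbar Cq :: real
  assumes "0 < \<alpha>" and "\<alpha> < 1 / 2" and "M1 > 1" and "M2 > 0" and "cbar \<ge> 1" and "Cq > 0"
  shows "\<exists>c>0. \<exists>C>0. \<forall>(k :: nat \<Rightarrow> nat \<Rightarrow> nat) (q :: nat \<Rightarrow> nat \<Rightarrow> nat) (\<xi> :: nat \<Rightarrow> nat \<Rightarrow> real vec)
           (bhat :: nat \<Rightarrow> nat \<Rightarrow> real vec \<Rightarrow> real mat \<Rightarrow> real vec)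
           (shat :: nat \<Rightarrow> nat \<Rightarrow> real vec \<Rightarrow> real mat \<Rightarrow> real)
           (uhat :: nat \<Rightarrow> nat \<Rightarrow> real mat \<Rightarrow> real vec).
         (\<forall>(n, p)\<in>admissible c Cq cbar k q \<xi>.
            scaled_lasso n p (bhat n p) (shat n p) \<and>
            projection_direction n p M1 (\<xi> n p) (uhat n p)) \<longrightarrow>
         (let F = limit_along (admissible c Cq cbar k q \<xi>);
              CI = (\<lambda>n p. conf_int \<alpha> M1 n p (k n p) (\<xi> n p) (bhat n p) (shat n p) (uhat n p))
          in Liminf F (\<lambda>(n, p). INF \<theta>\<in>param_space p (k n p) M1 M2.
               ereal (coverage_prob n p (\<xi> n p) (CI n p) \<theta>)) \<ge> ereal (1 - \<alpha>) \<and>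
             (\<forall>\<^sub>F (n, p) in F. (SUP \<theta>\<in>param_space p (k n p) M1 M2.
                expected_length n p (CI n p) \<theta>)
                \<le> ennreal (C * norm_l2 (\<xi> n p)
                    * (real (k n p) * ln (real p) / real n + 1 / sqrt (real n)))))"
proof -
  define K where "K = width_factor \<alpha> M1"
  define L where "L = nat \<lceil>6 * 703\<^sup>2 * M1 ^ 4\<rceil>"
  \<comment> \<open>The first bound keeps the Lasso perturbation below \<open>1 / 10 ^ 6\<close>,
    the second lets the union bound over signed sums of length \<open>L * k + 1\<close>
    succeed.\<close>
  define c where "c = min (1 / (10 ^ 14 * M1\<^sup>2)) (1 / (256 * (real L + 1)))"
  \<comment> \<open>Here \<open>2.02\<close> is twice the factor 1.01 between \<open>shat\<close>
    and \<open>\<sigma>\<close>; the summand 1 absorbs the bad event once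
    \<open>2 * (ln p)^2\<close> times the failure bound is below 1.\<close>
  define C where "C = 2.02 * M2 * K + 1"
  note M1 = \<open>M1 > 1\<close>
  have L: "real L \<ge> 6 * 703\<^sup>2 * M1 ^ 4" unfolding L_def by (rule real_nat_ceiling_ge)
  have c: "c > 0" "c \<le> 1 / (10 ^ 14 * M1\<^sup>2)" "c \<le> 1 / (256 * (real L + 1))"
    using M1 by (auto simp: c_def)
  have \<alpha>: "0 < \<alpha>" "\<alpha> < 1" using assms by auto
  have z: "normal_upper_quantile (\<alpha> / 2) \<ge> 0" using \<alpha> by (intro normal_upper_quantile_nonneg) auto
  have K: "K \<ge> 0"
    unfolding K_def width_factor_def C_max_def using M1 z by (intro add_nonneg_nonneg mult_nonneg_nonneg) auto
  have C: "C > 0" using K \<open>M2 > 0\<close> by (simp add: C_def add_nonneg_pos)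
  have "filterlim (\<lambda>p. ln (real p)) at_top sequentially" by real_asymp
  then have "\<forall>\<^sub>F p in sequentially. max K (1.01 * M2) \<le> ln (real p)"
    unfolding filterlim_at_top by blast
  moreover have "(\<lambda>p::nat. 2 * (ln (real p))\<^sup>2 * (14 * exp (- (ln (real p) / 100)))) \<longlonglongrightarrow> 0" by real_asymp
  then have "\<forall>\<^sub>F p in sequentially. 2 * (ln (real p))\<^sup>2 * (14 * exp (- (ln (real p) / 100))) < 1"
    by (rule order_tendstoD) simp
  ultimately have "\<forall>\<^sub>F p in sequentially. max K (1.01 * M2) \<le> ln (real p) \<and> 2 * (ln (real p))\<^sup>2 * failure_bound p < 1"
    unfolding failure_bound_def by eventually_elim simp
  then obtain P0 where P0: "\<And>p. p \<ge> P0 \<Longrightarrow> max K (1.01 * M2) \<le> ln (real p) \<and> 2 * (ln (real p))\<^sup>2 * failure_bound p < 1"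
    unfolding eventually_sequentially by blast
  show ?thesis
  proof (rule exI[of _ c], rule conjI[OF c(1)], rule exI[of _ C], rule conjI[OF C], intro allI impI)
    fix k q :: "nat \<Rightarrow> nat \<Rightarrow> nat" and \<xi> :: "nat \<Rightarrow> nat \<Rightarrow> real vec"
      and bhat :: "nat \<Rightarrow> nat \<Rightarrow> real vec \<Rightarrow> real mat \<Rightarrow> real vec"
      and shat :: "nat \<Rightarrow> nat \<Rightarrow> real vec \<Rightarrow> real mat \<Rightarrow> real"
      and uhat :: "nat \<Rightarrow> nat \<Rightarrow> real mat \<Rightarrow> real vec"
    let ?A = "admissible c Cq cbar k q \<xi>"
    assume est: "\<forall>(n, p)\<in>?A. scaled_lasso n p (bhat n p) (shat n p) \<and> projection_direction n p M1 (\<xi> n p) (uhat n p)"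
    define F where "F = limit_along ?A"
    define CI where "CI = (\<lambda>n p. conf_int \<alpha> M1 n p (k n p) (\<xi> n p) (bhat n p) (shat n p) (uhat n p))"
    have sampling: "sampling n p (k n p) L \<alpha> M1 M2 c (\<xi> n p) \<beta> \<Omega> \<sigma> (bhat n p) (shat n p) (uhat n p)"
      if np: "(n, p) \<in> ?A" "p \<ge> P0" and \<theta>: "(\<beta>, \<Omega>, \<sigma>) \<in> param_space p (k n p) M1 M2" for n p \<beta> \<Omega> \<sigma>
    proof
      show "scaled_lasso n p (bhat n p) (shat n p)" "projection_direction n p M1 (\<xi> n p) (uhat n p)"
        using est np(1) by auto
      show "width_factor \<alpha> M1 \<le> ln (real p)" "1.01 * M2 \<le> ln (real p)" using P0[OF np(2)] by (auto simp: K_def)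
    qed (use admissibleD[OF np(1) c(1)] M1 \<alpha> L c \<theta> in auto)
    have "ereal (1 - \<alpha>) \<le> Liminf F (\<lambda>(n, p). INF \<theta>\<in>param_space p (k n p) M1 M2. ereal (coverage_prob n p (\<xi> n p) (CI n p) \<theta>))"
    proof (rule ereal_le_epsilon2)
      fix \<epsilon> :: real assume \<epsilon>: "\<epsilon> > 0"
      have "failure_bound \<longlonglongrightarrow> 0" unfolding failure_bound_def[abs_def] by real_asymp
      then have "\<forall>\<^sub>F p in sequentially. failure_bound p < \<epsilon>" using \<epsilon> by (rule order_tendstoD)
      then obtain P1 where P1: "\<And>p. p \<ge> P1 \<Longrightarrow> failure_bound p < \<epsilon>" unfolding eventually_sequentially by blast
      \<comment> \<open>The threshold \<open>max P0 P1\<close> is chosen before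
        \<open>\<theta>\<close>, so the bound holds for the infimum over the parameter
        space.\<close>
      have "\<forall>\<^sub>F (n, p) in F. ereal (1 - \<alpha> - \<epsilon>) \<le> (INF \<theta>\<in>param_space p (k n p) M1 M2. ereal (coverage_prob n p (\<xi> n p) (CI n p) \<theta>))"
        unfolding F_def
      proof (rule eventually_limit_along[where N = "max P0 P1"], rule INF_greatest)
        fix n p \<theta> assume np: "(n, p) \<in> ?A" "max P0 P1 \<le> p" and \<theta>: "\<theta> \<in> param_space p (k n p) M1 M2"
        obtain \<beta> \<Omega> \<sigma> where \<theta>_eq: "\<theta> = (\<beta>, \<Omega>, \<sigma>)" by (cases \<theta>)
        interpret s: sampling n p "k n p" L \<alpha> M1 M2 c "\<xi> n p" \<beta> \<Omega> \<sigma> "bhat n p" "shat n p" "uhat n p"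
          using sampling np \<theta> by (simp add: \<theta>_eq)
        have "1 - \<alpha> - failure_bound p \<le> coverage_prob n p (\<xi> n p) (CI n p) \<theta>"
          using s.coverage by (simp add: s.CI_def CI_def \<theta>_eq)
        then show "ereal (1 - \<alpha> - \<epsilon>) \<le> ereal (coverage_prob n p (\<xi> n p) (CI n p) \<theta>)"
          using P1[of p] np by simp
      qed
      then have "ereal (1 - \<alpha> - \<epsilon>) \<le> Liminf F (\<lambda>(n, p). INF \<theta>\<in>param_space p (k n p) M1 M2. ereal (coverage_prob n p (\<xi> n p) (CI n p) \<theta>))"
        by (intro Liminf_bounded) (simp add: case_prod_unfold)
      then have "ereal (1 - \<alpha> - \<epsilon>) + ereal \<epsilon> \<le> Liminf F (\<lambda>(n, p). INF \<theta>\<in>param_space p (k n p) M1 M2. ereal (coverage_prob n p (\<xi> n p) (CI n p) \<theta>)) + ereal \<epsilon>"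
        by (rule add_right_mono)
      then show "ereal (1 - \<alpha>) \<le> Liminf F (\<lambda>(n, p). INF \<theta>\<in>param_space p (k n p) M1 M2. ereal (coverage_prob n p (\<xi> n p) (CI n p) \<theta>)) + ereal \<epsilon>"
        by simp
    qed
    moreover have "\<forall>\<^sub>F (n, p) in F. (SUP \<theta>\<in>param_space p (k n p) M1 M2. expected_length n p (CI n p) \<theta>)
        \<le> ennreal (C * norm_l2 (\<xi> n p) * (real (k n p) * ln (real p) / real n + 1 / sqrt (real n)))"
      unfolding F_def
    proof (rule eventually_limit_along[where N = P0], rule SUP_least)
      fix n p \<theta> assume np: "(n, p) \<in> ?A" "P0 \<le> p" and \<theta>: "\<theta> \<in> param_space p (k n p) M1 M2"
      obtain \<beta> \<Omega> \<sigma> where \<theta>_eq: "\<theta> = (\<beta>, \<Omega>, \<sigma>)" by (cases \<theta>)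
      interpret s: sampling n p "k n p" L \<alpha> M1 M2 c "\<xi> n p" \<beta> \<Omega> \<sigma> "bhat n p" "shat n p" "uhat n p"
        using sampling np \<theta> by (simp add: \<theta>_eq)
      define rate where "rate = norm_l2 (\<xi> n p) * (real (k n p) * ln (real p) / real n + 1 / sqrt (real n))"
      have "rate \<ge> 0"
        unfolding rate_def using s.p by (intro mult_nonneg_nonneg add_nonneg_nonneg) auto
      have "expected_length n p (CI n p) \<theta> \<le> ennreal ((2.02 * M2 * K + 2 * (ln (real p))\<^sup>2 * failure_bound p) * rate)"
        using s.length_bound by (simp add: s.CI_def CI_def \<theta>_eq K_def rate_def)
      also have "\<dots> \<le> ennreal (C * rate)"
        using P0[OF np(2)] \<open>rate \<ge> 0\<close> by (intro ennreal_leI mult_right_mono) (auto simp: C_def)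
      finally show "expected_length n p (CI n p) \<theta> \<le>
        ennreal (C * norm_l2 (\<xi> n p) * (real (k n p) * ln (real p) / real n + 1 / sqrt (real n)))"
        by (simp add: rate_def mult.assoc)
    qed
    ultimately show "let F = limit_along ?A;
              CI = (\<lambda>n p. conf_int \<alpha> M1 n p (k n p) (\<xi> n p) (bhat n p) (shat n p) (uhat n p))
          in Liminf F (\<lambda>(n, p). INF \<theta>\<in>param_space p (k n p) M1 M2.
               ereal (coverage_prob n p (\<xi> n p) (CI n p) \<theta>)) \<ge> ereal (1 - \<alpha>) \<and>
             (\<forall>\<^sub>F (n, p) in F. (SUP \<theta>\<in>param_space p (k n p) M1 M2.
                expected_length n p (CI n p) \<theta>)
                \<le> ennreal (C * norm_l2 (\<xi> n p)
                    * (real (k n p) * ln (real p) / real n + 1 / sqrt (real n))))"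
      unfolding Let_def F_def CI_def by blast
  qed
qed

end
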